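(* Let $d\ge1$ and for each $n\in\mathbb N$ let $F_n=(F_{n,1},\dots,F_{n,d})\in\mathcal S(V_{(n)})^d$, where $V_{(n)}=(V_{(n),1},\dots,V_{(n),J_n})$ is a noise vector as described in the context. Assume $$\sup_nA_p(V_{(n)},F_n)<\infty\quad\forall p\ge1,\qquad\text{and}\qquad\lim_{\varepsilon\to0}\ \limsup_n\ \mathbb P\big(\det\sigma_{F_n}(V_{(n)})\le\varepsilon\big)=0 .$$ Suppose also that $F$ is a random vector in $\mathbb R^d$ such that $\lim_nF_n=F$ in distribution and $\lim_n\mathbb E(F_n)=\mathbb E(F)$. Then $$\lim_nd_{TV}(F,F_n)=0 .$$ In particular, if the laws of $F$ and $F_n$ are absolutely continuous with densities $p_F$ and $p_{F_n}$, then $\lim_n\int_{\mathbb R^d}|p_F(x)-p_{F_n}(x)|\,dx=0$.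
   Context: $d_{TV}(F,G)=\sup\{|\mathbb E(f(F))-\mathbb E(f(G))|:\|f\|_\infty\le1\}$. **Noise and weights.** Each noise vector $V=(V_1,\dots,V_J)$ (here $V=V_{(n)}$, $J=J_n$; noise vectors, dimensions and weights may vary with $n$) is a random vector whose law has a density $p_J$ on $\mathbb R^J$ of polynomial growth; $\{p_J>0\}$ is open and $\ln p_J\in C^\infty$ there. Weights $\pi_i:\mathbb R^J\to[0,1]$, $\pi_i\in C_b^\infty$ (smooth, bounded with all derivatives), $i=1,\dots,J$, are fixed, and there are $-\infty\le a_i<b_i\le+\infty$ with $\{\pi_i>0\}\subset O_i:=\{v:a_i<v_i<b_i\}$; $p_J$ is smooth in $v_i$ on $O_i$. **Operators.** $\mathcal S(V)=\{f(V):f\in C_b^\infty(\mathbb R^J)\}$. For $F=f(V)$ with $f$ smooth: $D_iF=\pi_i(V)\partial_if(V)$, $DF=(D_iF)_{i\le J}$. For $U=(u_i(V))_{i\le J}$: $\delta(U)=-\sum_{i=1}^J\big(\partial_{v_i}(\pi_iu_i)+\pi_iu_i1_{O_i}\partial_{v_i}\ln p_J\big)(V)$. $LF=\delta(DF)$ (componentwise for vectors). Part of the framework: smooth functions of $V$ with polynomial growth (together with derivatives) have finite moments of all orders, $\delta$ maps processes with such components to such functionals, and $\mathbb E\langle DF,U\rangle_J=\mathbb E(F\delta(U))$ with $\langle U,U'\rangle_J=\sum_{i=1}^JU_iU_i'$. For $F=(F^1,\dots,F^d)$, $\sigma_F(V)$ is the matrix with entries $\langle DF^k,DF^{k'}\rangle_J$.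 **Norms.** $D_{(\alpha_1,\dots,\alpha_k)}F=D_{\alpha_k}(D_{(\alpha_1,\dots,\alpha_{k-1})}F)$, $|D^{(k)}F|=\big(\sum_{\alpha_1,\dots,\alpha_k=1}^J|D_{(\alpha_1,\dots,\alpha_k)}F|^2\big)^{1/2}$, $|F|_{1,l}=\sum_{k=1}^l|D^{(k)}F|$; for vectors sum over components. $\|F\|_{l,p}^p=\mathbb E(|F|^p)+\mathbb E(|F|_{1,l}^p)$. $A_p(V,F)=\|F\|_{3,p}+\|LF\|_{1,p}$, everything computed with respect to $V$. *)

theory Defs
  imports "HOL-Probability.Probability"
begin

section \<open>Smooth functions on Euclidean space of variable dimension\<close>

text \<open>
  The dimension of the noise varies along the sequence, so the Euclidean space of dimension \<open>J\<close> is
  the set of extensional functions on \<open>{..<J}\<close>, i.e. the space underlying the product measure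
  \<open>Pi\<^sub>M {..<J} (\<lambda>_. lborel)\<close>; coordinates are numbered from \<open>0\<close>. As a subspace of
  \<open>nat \<Rightarrow> real\<close> with the product topology it carries the usual Euclidean topology.
\<close>

abbreviation RJ :: "nat \<Rightarrow> (nat \<Rightarrow> real) set" where
  "RJ J \<equiv> PiE {..<J} (\<lambda>_. UNIV)"

definition pd :: "nat \<Rightarrow> ((nat \<Rightarrow> real) \<Rightarrow> real) \<Rightarrow> (nat \<Rightarrow> real) \<Rightarrow> real" where
  "pd i f v = deriv (\<lambda>t. f (v(i := t))) (v i)"

fun pds :: "nat list \<Rightarrow> ((nat \<Rightarrow> real) \<Rightarrow> real) \<Rightarrow> (nat \<Rightarrow> real) \<Rightarrow> real" where
  "pds [] f = f"
| "pds (i # \<alpha>) f = pds \<alpha> (pd i f)"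

text \<open>
  \<open>C\<^sup>\<infinity>\<close> on \<open>U\<close>, for \<open>U\<close> relatively open in \<open>RJ J\<close>: all iterated partial derivatives exist and
  are continuous on \<open>U\<close>. The second conjunct is the existence of the next derivative, which
  \<open>deriv\<close> alone does not express.
\<close>

definition smooth_fun :: "nat \<Rightarrow> (nat \<Rightarrow> real) set \<Rightarrow> ((nat \<Rightarrow> real) \<Rightarrow> real) \<Rightarrow> bool" where
  "smooth_fun J U f \<longleftrightarrow>
     (\<forall>\<alpha>. set \<alpha> \<subseteq> {..<J} \<longrightarrow>
        continuous_on U (pds \<alpha> f) \<and>
        (\<forall>i<J. \<forall>v\<in>U. (\<lambda>t. pds \<alpha> f (v(i := t))) differentiable (at (v i))))"

definition Cb_infty :: "nat \<Rightarrow> ((nat \<Rightarrow> real) \<Rightarrow> real) set" where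
  "Cb_infty J = {f. smooth_fun J (RJ J) f \<and>
     (\<forall>\<alpha>. set \<alpha> \<subseteq> {..<J} \<longrightarrow> bounded (pds \<alpha> f ` RJ J))}"

definition poly_growth :: "nat \<Rightarrow> ((nat \<Rightarrow> real) \<Rightarrow> real) \<Rightarrow> bool" where
  "poly_growth J f \<longleftrightarrow>
     (\<exists>C::real. \<exists>k::nat. \<forall>v\<in>RJ J. \<bar>f v\<bar> \<le> C * (1 + L2_set v {..<J}) ^ k)"

definition Cpol_infty :: "nat \<Rightarrow> ((nat \<Rightarrow> real) \<Rightarrow> real) set" where
  "Cpol_infty J = {f. smooth_fun J (RJ J) f \<and>
     (\<forall>\<alpha>. set \<alpha> \<subseteq> {..<J} \<longrightarrow> poly_growth J (pds \<alpha> f))}"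


section \<open>Noise vectors and the operators of the finite-dimensional Malliavin calculus\<close>

record 'a noise =
  Prob :: "'a measure"
  Dim  :: nat
  Vec  :: "'a \<Rightarrow> nat \<Rightarrow> real"
  dens :: "(nat \<Rightarrow> real) \<Rightarrow> real"
  wt   :: "nat \<Rightarrow> (nat \<Rightarrow> real) \<Rightarrow> real"
  lo   :: "nat \<Rightarrow> ereal"
  hi   :: "nat \<Rightarrow> ereal"

definition supp :: "'a noise \<Rightarrow> (nat \<Rightarrow> real) set" where
  "supp N = {v \<in> RJ (Dim N). dens N v > 0}"

definition slab :: "'a noise \<Rightarrow> nat \<Rightarrow> (nat \<Rightarrow> real) set" where
  "slab N i = {v \<in> RJ (Dim N). lo N i < ereal (v i) \<and> ereal (v i) < hi N i}"

text \<open>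
  Functionals of the noise vector \<open>V\<close> are represented by functions \<open>f\<close> on \<open>RJ J\<close>, the random
  variable being \<open>\<lambda>\<omega>. f (V \<omega>)\<close>; the operators act on these functions.
\<close>

definition Dop :: "'a noise \<Rightarrow> nat \<Rightarrow> ((nat \<Rightarrow> real) \<Rightarrow> real) \<Rightarrow> (nat \<Rightarrow> real) \<Rightarrow> real" where
  "Dop N i f v = wt N i v * pd i f v"

fun Diter :: "'a noise \<Rightarrow> nat list \<Rightarrow> ((nat \<Rightarrow> real) \<Rightarrow> real) \<Rightarrow> (nat \<Rightarrow> real) \<Rightarrow> real" where
  "Diter N [] f = f"
| "Diter N (i # \<alpha>) f = Diter N \<alpha> (Dop N i f)"

text \<open>
  The logarithmic derivative of the density is only meaningful on \<open>supp N\<close>, which carries the law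
  of \<open>V\<close>; off this set it is given the value \<open>0\<close>, which keeps it Borel measurable.
\<close>

definition score :: "'a noise \<Rightarrow> nat \<Rightarrow> (nat \<Rightarrow> real) \<Rightarrow> real" where
  "score N i v = (if v \<in> supp N then pd i (\<lambda>w. ln (dens N w)) v else 0)"

definition delta ::
  "'a noise \<Rightarrow> (nat \<Rightarrow> (nat \<Rightarrow> real) \<Rightarrow> real) \<Rightarrow> (nat \<Rightarrow> real) \<Rightarrow> real" where
  "delta N u v =
     - (\<Sum>i<Dim N. pd i (\<lambda>w. wt N i w * u i w) v
                    + wt N i v * u i v * indicator (slab N i) v * score N i v)"

definition Lop :: "'a noise \<Rightarrow> ((nat \<Rightarrow> real) \<Rightarrow> real) \<Rightarrow> (nat \<Rightarrow> real) \<Rightarrow> real" where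
  "Lop N f = delta N (\<lambda>i. Dop N i f)"

text \<open>
  The last three assumptions are the standing framework: moments, stability of the polynomial
  class under \<open>delta\<close> (equality of functionals is almost sure equality), and duality.
\<close>

locale noise_vector = prob_space "Prob N" for N :: "'a noise" (structure) +
  assumes distributed_Vec:
      "distributed (Prob N) (Pi\<^sub>M {..<Dim N} (\<lambda>_. lborel)) (Vec N) (\<lambda>v. ennreal (dens N v))"
    and dens_nonneg: "\<And>v. v \<in> RJ (Dim N) \<Longrightarrow> 0 \<le> dens N v"
    and dens_poly_growth: "poly_growth (Dim N) (dens N)"
    and open_supp: "openin (top_of_set (RJ (Dim N))) (supp N)"
    and smooth_ln_dens: "smooth_fun (Dim N) (supp N) (\<lambda>v. ln (dens N v))"
    and wt_range: "\<And>i v. i < Dim N \<Longrightarrow> v \<in> RJ (Dim N) \<Longrightarrow> wt N i v \<in> {0..1}"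
    and wt_smooth: "\<And>i. i < Dim N \<Longrightarrow> wt N i \<in> Cb_infty (Dim N)"
    and lo_less_hi: "\<And>i. i < Dim N \<Longrightarrow> lo N i < hi N i"
    and wt_supp: "\<And>i. i < Dim N \<Longrightarrow> {v \<in> RJ (Dim N). wt N i v > 0} \<subseteq> slab N i"
    and dens_smooth_slab: "\<And>i v k. i < Dim N \<Longrightarrow> v \<in> slab N i \<Longrightarrow>
          (\<lambda>t. (pd i ^^ k) (dens N) (v(i := t))) differentiable (at (v i))"
    and moments: "\<And>f k. f \<in> Cpol_infty (Dim N) \<Longrightarrow>
          integrable (Prob N) (\<lambda>\<omega>. \<bar>f (Vec N \<omega>)\<bar> ^ k)"
    and delta_Cpol: "\<And>u. (\<And>i. i < Dim N \<Longrightarrow> u i \<in> Cpol_infty (Dim N)) \<Longrightarrow>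
          \<exists>g\<in>Cpol_infty (Dim N). AE \<omega> in Prob N. delta N u (Vec N \<omega>) = g (Vec N \<omega>)"
    and duality: "\<And>f u. f \<in> Cpol_infty (Dim N) \<Longrightarrow>
          (\<And>i. i < Dim N \<Longrightarrow> u i \<in> Cpol_infty (Dim N)) \<Longrightarrow>
          (\<integral>\<omega>. (\<Sum>i<Dim N. Dop N i f (Vec N \<omega>) * u i (Vec N \<omega>)) \<partial>Prob N)
            = (\<integral>\<omega>. f (Vec N \<omega>) * delta N u (Vec N \<omega>) \<partial>Prob N)"

definition simple_functionals :: "'a noise \<Rightarrow> ((nat \<Rightarrow> real) \<Rightarrow> real ^ 'd) set" where
  "simple_functionals N = {F. \<forall>j. (\<lambda>v. F v $ j) \<in> Cb_infty (Dim N)}"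

definition Lvec ::
  "'a noise \<Rightarrow> ((nat \<Rightarrow> real) \<Rightarrow> real ^ 'd) \<Rightarrow> (nat \<Rightarrow> real) \<Rightarrow> real ^ 'd" where
  "Lvec N F v = (\<chi> j. Lop N (\<lambda>w. F w $ j) v)"

definition malliavin_matrix ::
  "'a noise \<Rightarrow> ((nat \<Rightarrow> real) \<Rightarrow> real ^ 'd) \<Rightarrow> (nat \<Rightarrow> real) \<Rightarrow> real ^ 'd ^ 'd" where
  "malliavin_matrix N F v =
     (\<chi> j j'. \<Sum>i<Dim N. Dop N i (\<lambda>w. F w $ j) v * Dop N i (\<lambda>w. F w $ j') v)"

definition Dk_norm :: "'a noise \<Rightarrow> nat \<Rightarrow> ((nat \<Rightarrow> real) \<Rightarrow> real) \<Rightarrow> (nat \<Rightarrow> real) \<Rightarrow> real" where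
  "Dk_norm N k f v =
     sqrt (\<Sum>\<alpha> | set \<alpha> \<subseteq> {..<Dim N} \<and> length \<alpha> = k. (Diter N \<alpha> f v)\<^sup>2)"

definition D_seminorm ::
  "'a noise \<Rightarrow> nat \<Rightarrow> ((nat \<Rightarrow> real) \<Rightarrow> real ^ 'd) \<Rightarrow> (nat \<Rightarrow> real) \<Rightarrow> real" where
  "D_seminorm N l F v = (\<Sum>j\<in>UNIV. \<Sum>k=1..l. Dk_norm N k (\<lambda>w. F w $ j) v)"

definition ennroot :: "real \<Rightarrow> ennreal \<Rightarrow> ennreal" where
  "ennroot q x = (if x = \<infinity> then \<infinity> else ennreal (enn2real x powr (1 / q)))"

text \<open>
  The expectations are non-negative integrals, so that the norms take the value \<open>\<infinity>\<close> when a moment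
  is infinite, and the values of \<open>pd\<close> on the null set where a derivative of \<open>Lvec N F\<close> need not
  exist are irrelevant without any measurability condition.
\<close>

definition sobolev_norm ::
  "'a noise \<Rightarrow> nat \<Rightarrow> real \<Rightarrow> ((nat \<Rightarrow> real) \<Rightarrow> real ^ 'd) \<Rightarrow> ennreal" where
  "sobolev_norm N l q F = ennroot q
     ((\<integral>\<^sup>+\<omega>. ennreal (norm (F (Vec N \<omega>)) powr q) \<partial>Prob N)
      + (\<integral>\<^sup>+\<omega>. ennreal (D_seminorm N l F (Vec N \<omega>) powr q) \<partial>Prob N))"

definition A_norm :: "real \<Rightarrow> 'a noise \<Rightarrow> ((nat \<Rightarrow> real) \<Rightarrow> real ^ 'd) \<Rightarrow> ennreal" where
  "A_norm q N F = sobolev_norm N 3 q F + sobolev_norm N 1 q (Lvec N F)"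


section \<open>Convergence of laws\<close>

text \<open>
  The random variables compared here may live on different probability spaces.
\<close>

definition tv_dist ::
  "'a measure \<Rightarrow> ('a \<Rightarrow> real ^ 'd) \<Rightarrow> 'b measure \<Rightarrow> ('b \<Rightarrow> real ^ 'd) \<Rightarrow> real" where
  "tv_dist M X N Y =
     (SUP f \<in> {f :: real ^ 'd \<Rightarrow> real. f \<in> borel_measurable borel \<and> (\<forall>x. \<bar>f x\<bar> \<le> 1)}.
        \<bar>(\<integral>\<omega>. f (X \<omega>) \<partial>M) - (\<integral>\<omega>. f (Y \<omega>) \<partial>N)\<bar>)"

definition converges_in_distribution ::
  "(nat \<Rightarrow> 'a measure) \<Rightarrow> (nat \<Rightarrow> 'a \<Rightarrow> real ^ 'd) \<Rightarrow> 'b measure \<Rightarrow> ('b \<Rightarrow> real ^ 'd) \<Rightarrow> bool" where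
  "converges_in_distribution M X N Y \<longleftrightarrow>
     (\<forall>f :: real ^ 'd \<Rightarrow> real. continuous_on UNIV f \<and> bounded (range f) \<longrightarrow>
        (\<lambda>n. \<integral>\<omega>. f (X n \<omega>) \<partial>M n) \<longlonglongrightarrow> (\<integral>\<omega>. f (Y \<omega>) \<partial>N))"

end

theory Submission
  imports Defs
begin

text \<open>
  A single integration by parts suffices. Let \<open>\<sigma>\<close> be the Malliavin matrix of \<open>F\<^sub>n\<close> and
  \<open>\<Delta> = det \<sigma>\<close>. Expanding along cofactors, the process
  \<open>u = \<Delta> / (c + \<Delta>\<^sup>2) * (\<Sum>l. cof\<^sub>k\<^sub>l DF\<^sup>l)\<close> satisfies \<open>\<langle>D f(F), u\<rangle> = w * \<partial>\<^sub>k f(F)\<close> with the weight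
  \<open>w = \<Delta>\<^sup>2 / (c + \<Delta>\<^sup>2)\<close>, so \<open>E (w * \<partial>\<^sub>k f(F)) = E (f(F) * \<delta> u)\<close>, and \<open>E \<bar>\<delta> u\<bar>\<close> is bounded uniformly
  in \<open>n\<close> by the norms \<open>A\<^sub>p\<close>. Since \<open>1 - w\<close> is small off the event \<open>\<Delta> \<le> \<epsilon>\<close>, the laws of \<open>F\<^sub>n\<close> are
  continuous in total variation under small translations, uniformly for large \<open>n\<close>, and the limit
  law inherits this. Hence all these laws are close to their convolutions with a fixed compactly
  supported continuous density. The densities of the convolved laws converge pointwise by
  convergence in distribution, hence in \<open>L\<^sup>1\<close> by Scheffe's lemma.

  To keep smoothness proofs elementary, \<open>f\<close> ranges over the algebra generated by the functions
  \<open>arctan (a x\<^sub>j + b)\<close>, which is translation invariant and dense enough to detect the total variation.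
\<close>

section \<open>Closure properties of the class of bounded smooth functions\<close>

text \<open>Weak convergence says nothing directly about Borel test functions, and the limit
  \<open>F\<close> carries no differential structure. Translation continuity bridges both gaps: it
  is an inequality between expectations of continuous test functions of sup norm at most 1, so it
  passes to the limit law. Duality supplies it with a constant that sees \<open>f\<close> only
  through this sup norm, because \<open>f(F)\<close> enters the right-hand side undifferentiated.
  Cofactors replace the inverse of \<sigma>, since they are polynomials in its entries and stay
  meaningful where \<sigma> is singular. The constants are chosen in a fixed order: a threshold for
  the determinant from nondegeneracy, then \<open>c\<close> small relative to its square, then the
  integration by parts constant, which depends on \<open>c\<close>, and last the translation radius.
  The dimension of the noise may be unbounded along the sequence. Sums over noise indices are
  therefore estimated by Cauchy-Schwarz in Euclidean or Hilbert-Schmidt norm, which keeps the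
  dimension out of every constant.\<close>

lemma RJ_upd: "v \<in> RJ J \<Longrightarrow> i < J \<Longrightarrow> v(i := t) \<in> RJ J"
  by (auto simp: PiE_def extensional_def)

lemma pd_cong:
  assumes "\<And>v. v \<in> RJ J \<Longrightarrow> f v = g v" "i < J" "v \<in> RJ J"
  shows "pd i f v = pd i g v"
  using assms by (simp add: pd_def RJ_upd)

lemma pds_cong:
  assumes "\<And>v. v \<in> RJ J \<Longrightarrow> f v = g v" "set \<alpha> \<subseteq> {..<J}" "v \<in> RJ J"
  shows "pds \<alpha> f v = pds \<alpha> g v"
  using assms
proof (induction \<alpha> arbitrary: f g)
  case (Cons i \<alpha>)
  have "\<And>v. v \<in> RJ J \<Longrightarrow> pd i f v = pd i g v"
    using Cons.prems by (intro pd_cong[where J=J]) auto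
  then have "pds \<alpha> (pd i f) v = pds \<alpha> (pd i g) v"
    using Cons.prems(2,3) by (intro Cons.IH) auto
  then show ?case by simp
qed simp

lemma Cb_inftyD:
  assumes "f \<in> Cb_infty J"
  shows "continuous_on (RJ J) f" "bounded (f ` RJ J)"
    and "\<And>i v. i < J \<Longrightarrow> v \<in> RJ J \<Longrightarrow> ((\<lambda>t. f (v(i := t))) has_real_derivative pd i f v) (at (v i))"
    and "\<And>i. i < J \<Longrightarrow> pd i f \<in> Cb_infty J"
proof -
  have s: "\<And>\<alpha>. set \<alpha> \<subseteq> {..<J} \<Longrightarrow> continuous_on (RJ J) (pds \<alpha> f)"
    "\<And>\<alpha> i v. set \<alpha> \<subseteq> {..<J} \<Longrightarrow> i < J \<Longrightarrow> v \<in> RJ J \<Longrightarrow>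
       (\<lambda>t. pds \<alpha> f (v(i := t))) differentiable (at (v i))"
    "\<And>\<alpha>. set \<alpha> \<subseteq> {..<J} \<Longrightarrow> bounded (pds \<alpha> f ` RJ J)"
    using assms by (auto simp: Cb_infty_def smooth_fun_def)
  from s(1)[of "[]"] show "continuous_on (RJ J) f" by simp
  from s(3)[of "[]"] show "bounded (f ` RJ J)" by simp
  show "((\<lambda>t. f (v(i := t))) has_real_derivative pd i f v) (at (v i))" if "i < J" "v \<in> RJ J" for i v
    using s(2)[of "[]" i v] that by (simp add: pd_def DERIV_deriv_iff_real_differentiable)
  show "pd i f \<in> Cb_infty J" if "i < J" for i
    using that s(1)[of "i # \<alpha>" for \<alpha>] s(2)[of "i # \<alpha>" for \<alpha>] s(3)[of "i # \<alpha>" for \<alpha>]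
    by (auto simp: Cb_infty_def smooth_fun_def)
qed


text \<open>By induction on the list of indices, every iterated partial derivative of
  \<open>f\<close> agrees on \<open>RJ J\<close> with some member of \<open>S\<close>. Verifying
  smoothness thus takes only first-order derivative rules and no Leibniz formula of arbitrary
  order.\<close>

lemma Cb_infty_coinduct:
  assumes "f \<in> S"
    and S: "\<And>f. f \<in> S \<Longrightarrow> continuous_on (RJ J) f \<and> bounded (f ` RJ J) \<and>
      (\<forall>i<J. \<exists>g\<in>S. \<forall>v\<in>RJ J. ((\<lambda>t. f (v(i := t))) has_real_derivative g v) (at (v i)))"
  shows "f \<in> Cb_infty J"
proof -
  have *: "\<exists>g\<in>S. \<forall>v\<in>RJ J. pds \<alpha> f v = g v" if "f \<in> S" "set \<alpha> \<subseteq> {..<J}" for f \<alpha>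
    using that
  proof (induction \<alpha> arbitrary: f)
    case (Cons i \<alpha>)
    then obtain g where g: "g \<in> S"
      "\<And>v. v \<in> RJ J \<Longrightarrow> ((\<lambda>t. f (v(i := t))) has_real_derivative g v) (at (v i))"
      using S[of f] by auto
    then have "\<And>v. v \<in> RJ J \<Longrightarrow> pd i f v = g v"
      unfolding pd_def by (intro DERIV_imp_deriv) auto
    then have "\<And>v. v \<in> RJ J \<Longrightarrow> pds \<alpha> (pd i f) v = pds \<alpha> g v"
      using Cons.prems by (intro pds_cong) auto
    with Cons g(1) show ?case by fastforce
  qed auto
  have "continuous_on (RJ J) (pds \<alpha> f) \<and> bounded (pds \<alpha> f ` RJ J) \<and>
    (\<forall>i<J. \<forall>v\<in>RJ J. (\<lambda>t. pds \<alpha> f (v(i := t))) differentiable (at (v i)))"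
    if a: "set \<alpha> \<subseteq> {..<J}" for \<alpha>
  proof -
    obtain g where g: "g \<in> S" "\<And>v. v \<in> RJ J \<Longrightarrow> pds \<alpha> f v = g v"
      using *[OF assms(1) a] by auto
    have "(\<lambda>t. pds \<alpha> f (v(i := t))) = (\<lambda>t. g (v(i := t)))" if "i < J" "v \<in> RJ J" for i v
      using g(2) RJ_upd that by blast
    moreover have "(\<lambda>t. g (v(i := t))) differentiable (at (v i))" if "i < J" "v \<in> RJ J" for i v
      using S[OF g(1)] that real_differentiable_def by blast
    moreover have "continuous_on (RJ J) (pds \<alpha> f) \<longleftrightarrow> continuous_on (RJ J) g"
      using g(2) by (intro continuous_on_cong) auto
    moreover have "pds \<alpha> f ` RJ J = g ` RJ J" using g(2) by auto
    ultimately show ?thesis using S[OF g(1)] by auto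
  qed
  then show ?thesis by (auto simp: Cb_infty_def smooth_fun_def)
qed

text \<open>
  \<open>Cb_infty\<close> is the largest class of bounded continuous functions that is closed under partial
  derivatives; as the class generated below is closed under them too, it is no larger.
\<close>

inductive_set Cb_gen :: "nat \<Rightarrow> ((nat \<Rightarrow> real) \<Rightarrow> real) set" for J where
  base: "f \<in> Cb_infty J \<Longrightarrow> f \<in> Cb_gen J"
| const: "(\<lambda>v. c) \<in> Cb_gen J"
| add: "f \<in> Cb_gen J \<Longrightarrow> g \<in> Cb_gen J \<Longrightarrow> (\<lambda>v. f v + g v) \<in> Cb_gen J"
| mult: "f \<in> Cb_gen J \<Longrightarrow> g \<in> Cb_gen J \<Longrightarrow> (\<lambda>v. f v * g v) \<in> Cb_gen J"
| inv: "f \<in> Cb_gen J \<Longrightarrow> c > 0 \<Longrightarrow> (\<lambda>v. 1 / (c + (f v)\<^sup>2)) \<in> Cb_gen J"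
| atan: "f \<in> Cb_gen J \<Longrightarrow> (\<lambda>v. arctan (f v)) \<in> Cb_gen J"

lemma bounded_real_image: "bounded (f ` S) \<longleftrightarrow> (\<exists>B. \<forall>x\<in>S. \<bar>f x :: real\<bar> \<le> B)"
  by (auto simp: bounded_iff)

lemma one_plus_square_pos: "c > 0 \<Longrightarrow> c + x\<^sup>2 > (0::real)"
  by (simp add: add_pos_nonneg)

lemma Cb_gen_bounded:
  assumes "f \<in> Cb_gen J"
  shows "bounded (f ` RJ J)"
  using assms
proof induction
  case (base f)
  then show ?case by (rule Cb_inftyD)
next
  case (const c)
  show ?case unfolding bounded_real_image by blast
next
  case (add f g)
  then show ?case by (intro bounded_plus_comp)
next
  case (mult f g)
  obtain B C where "\<forall>v\<in>RJ J. \<bar>f v\<bar> \<le> B" "\<forall>v\<in>RJ J. \<bar>g v\<bar> \<le> C"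
    using mult.IH unfolding bounded_real_image by blast
  then have "\<forall>v\<in>RJ J. \<bar>f v * g v\<bar> \<le> B * C"
    by (simp add: abs_mult mult_mono')
  then show ?case unfolding bounded_real_image by blast
next
  case (inv f c)
  have "\<bar>1 / (c + x\<^sup>2)\<bar> \<le> 1 / c" for x :: real
    using inv.hyps one_plus_square_pos[OF inv.hyps(2), of x] by (simp add: divide_simps)
  then show ?case unfolding bounded_real_image by blast
next
  case (atan f)
  have "\<bar>arctan x\<bar> \<le> pi / 2" for x
    using arctan_bounded[of x] by linarith
  then show ?case unfolding bounded_real_image by blast
qed

lemma Cb_gen_continuous:
  assumes "f \<in> Cb_gen J"
  shows "continuous_on (RJ J) f"
  using assms
proof induction
  case (base f)
  then show ?case by (rule Cb_inftyD)
next
  case (inv f c)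
  have "c + x\<^sup>2 \<noteq> 0" for x :: real
    using one_plus_square_pos[OF inv.hyps(2), of x] by simp
  with inv.IH show ?case by (intro continuous_intros) auto
qed (intro continuous_intros; assumption)+

lemma Cb_gen_deriv:
  assumes "f \<in> Cb_gen J" "i < J"
  shows "\<exists>g\<in>Cb_gen J. \<forall>v\<in>RJ J. ((\<lambda>t. f (v(i := t))) has_real_derivative g v) (at (v i))"
  using assms(1)
proof induction
  case (base f)
  then show ?case using Cb_inftyD(3,4)[OF base assms(2)] Cb_gen.base by blast
next
  case (const c)
  show ?case by (intro bexI[of _ "\<lambda>v. 0"] Cb_gen.const ballI) simp
next
  case (add f g)
  from add.IH obtain f' g' where d: "f' \<in> Cb_gen J" "g' \<in> Cb_gen J"
      "\<forall>v\<in>RJ J. ((\<lambda>t. f (v(i := t))) has_real_derivative f' v) (at (v i))"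
      "\<forall>v\<in>RJ J. ((\<lambda>t. g (v(i := t))) has_real_derivative g' v) (at (v i))"
    by (elim bexE)
  show ?case
    by (intro bexI[of _ "\<lambda>v. f' v + g' v"] ballI DERIV_add Cb_gen.add d(1,2) d(3,4)[THEN bspec])
next
  case (mult f g)
  from mult.IH obtain f' g' where d: "f' \<in> Cb_gen J" "g' \<in> Cb_gen J"
      "\<forall>v\<in>RJ J. ((\<lambda>t. f (v(i := t))) has_real_derivative f' v) (at (v i))"
      "\<forall>v\<in>RJ J. ((\<lambda>t. g (v(i := t))) has_real_derivative g' v) (at (v i))"
    by (elim bexE)
  have "((\<lambda>t. f (v(i := t)) * g (v(i := t))) has_real_derivative f' v * g v + g' v * f v) (at (v i))"
    if "v \<in> RJ J" for v
    using DERIV_mult[OF d(3,4)[THEN bspec, OF that]] by simp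
  then show ?case
    by (intro bexI[of _ "\<lambda>v. f' v * g v + g' v * f v"] ballI Cb_gen.add Cb_gen.mult d mult.hyps)
next
  case (inv f c)
  from inv.IH obtain f' where d: "f' \<in> Cb_gen J"
      "\<forall>v\<in>RJ J. ((\<lambda>t. f (v(i := t))) has_real_derivative f' v) (at (v i))"
    by (elim bexE)
  \<comment> \<open>The derivative is spelled out as a product of generators, with the reciprocal
    repeated instead of squared, so that its membership in \<open>Cb_gen\<close> follows from the
    introduction rules alone.\<close>
  have "((\<lambda>t. 1 / (c + (f (v(i := t)))\<^sup>2)) has_real_derivative
      (-2) * (f v * f' v) * ((1 / (c + (f v)\<^sup>2)) * (1 / (c + (f v)\<^sup>2)))) (at (v i))"
    if "v \<in> RJ J" for v
    using one_plus_square_pos[OF inv.hyps(2), of "f v"]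
    by (auto intro!: derivative_eq_intros d(2)[THEN bspec, OF that] simp: power2_eq_square)
  then show ?case
    by (intro bexI[of _ "\<lambda>v. (-2) * (f v * f' v) * ((1 / (c + (f v)\<^sup>2)) * (1 / (c + (f v)\<^sup>2)))"]
          ballI Cb_gen.const Cb_gen.mult Cb_gen.inv d inv.hyps)
next
  case (atan f)
  from atan.IH obtain f' where d: "f' \<in> Cb_gen J"
      "\<forall>v\<in>RJ J. ((\<lambda>t. f (v(i := t))) has_real_derivative f' v) (at (v i))"
    by (elim bexE)
  have "((\<lambda>t. arctan (f (v(i := t)))) has_real_derivative f' v * (1 / (1 + (f v)\<^sup>2))) (at (v i))"
    if "v \<in> RJ J" for v
    using DERIV_chain2[OF DERIV_arctan d(2)[THEN bspec, OF that]]
    by (simp add: field_simps)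
  then show ?case
    by (intro bexI[of _ "\<lambda>v. f' v * (1 / (1 + (f v)\<^sup>2))"]
          ballI Cb_gen.const Cb_gen.mult Cb_gen.inv d atan.hyps zero_less_one)
qed

lemma Cb_gen_eq: "Cb_gen J = Cb_infty J"
proof
  show "Cb_gen J \<subseteq> Cb_infty J"
    by (intro subsetI, erule Cb_infty_coinduct)
      (intro conjI allI impI Cb_gen_bounded Cb_gen_continuous Cb_gen_deriv)
qed (auto intro: Cb_gen.base)

lemmas Cb_const = Cb_gen.const[unfolded Cb_gen_eq]
lemmas Cb_add = Cb_gen.add[unfolded Cb_gen_eq]
lemmas Cb_mult = Cb_gen.mult[unfolded Cb_gen_eq]
lemmas Cb_inv = Cb_gen.inv[unfolded Cb_gen_eq]
lemmas Cb_atan = Cb_gen.atan[unfolded Cb_gen_eq]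

lemma Cb_sum: "(\<And>a. a \<in> A \<Longrightarrow> f a \<in> Cb_infty J) \<Longrightarrow> (\<lambda>v. \<Sum>a\<in>A. f a v) \<in> Cb_infty J"
  by (induction A rule: infinite_finite_induct) (auto intro: Cb_const Cb_add)

lemma bounded_imp_poly_growth:
  assumes "bounded (f ` RJ J)"
  shows "poly_growth J f"
proof -
  obtain B where "\<forall>v\<in>RJ J. \<bar>f v\<bar> \<le> B" using assms unfolding bounded_real_image by blast
  then have "\<forall>v\<in>RJ J. \<bar>f v\<bar> \<le> B * (1 + L2_set v {..<J}) ^ 0" by simp
  then show ?thesis unfolding poly_growth_def by blast
qed

text \<open>The framework states duality and the stability of \<open>delta\<close> for polynomial
  growth; the functionals inserted into it below are all bounded.\<close>

lemma Cb_subset_Cpol: "f \<in> Cb_infty J \<Longrightarrow> f \<in> Cpol_infty J"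
  unfolding Cb_infty_def Cpol_infty_def using bounded_imp_poly_growth by simp

lemma
  assumes "f \<in> Cb_infty J" "g \<in> Cb_infty J" "i < J" "v \<in> RJ J"
  shows pd_add: "pd i (\<lambda>w. f w + g w) v = pd i f v + pd i g v"
    and pd_mult: "pd i (\<lambda>w. f w * g w) v = f v * pd i g v + pd i f v * g v"
    and pd_inv: "c > 0 \<Longrightarrow> pd i (\<lambda>w. 1 / (c + (f w)\<^sup>2)) v = - (2 * f v * pd i f v) / (c + (f v)\<^sup>2)\<^sup>2"
proof -
  note d = Cb_inftyD(3)[OF assms(1,3,4)] Cb_inftyD(3)[OF assms(2,3,4)]
  show "pd i (\<lambda>w. f w + g w) v = pd i f v + pd i g v"
    unfolding pd_def[of _ "\<lambda>w. f w + g w"] by (intro DERIV_imp_deriv DERIV_add d)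
  show "pd i (\<lambda>w. f w * g w) v = f v * pd i g v + pd i f v * g v"
    unfolding pd_def[of _ "\<lambda>w. f w * g w"]
    by (rule DERIV_imp_deriv) (auto intro!: derivative_eq_intros d)
  assume c: "c > 0"
  have nz: "c + x\<^sup>2 \<noteq> 0" for x :: real
    using c zero_le_power2[of x] by linarith
  show "pd i (\<lambda>w. 1 / (c + (f w)\<^sup>2)) v = - (2 * f v * pd i f v) / (c + (f v)\<^sup>2)\<^sup>2"
    unfolding pd_def[of _ "\<lambda>w. 1 / (c + (f w)\<^sup>2)"]
    by (rule DERIV_imp_deriv) (use nz[of "f v"] in \<open>auto intro!: derivative_eq_intros d simp: power2_eq_square\<close>)
qed

lemma pd_const: "pd i (\<lambda>w. c) v = 0"
  by (simp add: pd_def)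

lemma pd_sum:
  assumes "\<And>a. a \<in> A \<Longrightarrow> f a \<in> Cb_infty J" "i < J" "v \<in> RJ J"
  shows "pd i (\<lambda>w. \<Sum>a\<in>A. f a w) v = (\<Sum>a\<in>A. pd i (f a) v)"
  using assms
proof (induction A rule: infinite_finite_induct)
  case (insert a A)
  then show ?case by (simp add: pd_add[of "f a" J "\<lambda>w. \<Sum>a\<in>A. f a w"] Cb_sum)
qed (simp_all add: pd_const)

section \<open>Measurability and chain rule on the noise space\<close>

text \<open>Continuity refers to the product topology on all of
  \<open>nat \<Rightarrow> real\<close>, measurability to the product over \<open>{..<J}\<close>.
  The inclusion of one space in the other is measurable because the coordinates from
  \<open>J\<close> onwards are constantly \<open>undefined\<close> on extensional functions.\<close>

lemma borel_measurable_RJ: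
  assumes "continuous_on (RJ J) f"
  shows "f \<in> borel_measurable (Pi\<^sub>M {..<J} (\<lambda>_. lborel))"
proof -
  have "(\<lambda>x. x) \<in> measurable (Pi\<^sub>M {..<J} (\<lambda>_. lborel)) (Pi\<^sub>M UNIV (\<lambda>i::nat. borel :: real measure))"
  proof (rule measurable_PiM_single')
    fix i :: nat
    show "(\<lambda>x. x i) \<in> borel_measurable (Pi\<^sub>M {..<J} (\<lambda>_. lborel :: real measure))"
    proof (cases "i < J")
      case True
      then show ?thesis using measurable_component_singleton[of i "{..<J}" "\<lambda>_. lborel :: real measure"] by simp
    next
      case False
      then have "x i = undefined" if "x \<in> space (Pi\<^sub>M {..<J} (\<lambda>_. lborel :: real measure))" for x
        using that by (auto simp: space_PiM PiE_def extensional_def)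
      then show ?thesis by (subst measurable_cong[where g="\<lambda>_. undefined"]) auto
    qed
  qed (auto simp: space_PiM)
  then have "(\<lambda>x. x) \<in> measurable (Pi\<^sub>M {..<J} (\<lambda>_. lborel)) (borel :: (nat \<Rightarrow> real) measure)"
    using measurable_cong_sets[OF refl sets_PiM_equal_borel] by blast
  then have "(\<lambda>x. x) \<in> measurable (Pi\<^sub>M {..<J} (\<lambda>_. lborel)) (restrict_space borel (RJ J))"
    by (intro measurable_restrict_space2) (auto simp: space_PiM)
  then show ?thesis
    using measurable_compose[OF _ borel_measurable_continuous_on_restrict[OF assms]] by blast
qed

text \<open>Only the curve obtained by moving the coordinate \<open>i\<close> is differentiated,
  component by component; total differentiability in the noise variables is never involved.\<close>

lemma DERIV_compose_Cb:
  fixes F :: "(nat \<Rightarrow> real) \<Rightarrow> real ^ 'd"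
  assumes F: "\<And>j. (\<lambda>v. F v $ j) \<in> Cb_infty J" and "i < J" "v \<in> RJ J"
    and f: "(f has_derivative f') (at (F v))"
  shows "pd i (\<lambda>w. f (F w)) v = (\<Sum>j\<in>UNIV. f' (axis j 1) * pd i (\<lambda>w. F w $ j) v)"
proof -
  interpret f': bounded_linear f' using f by (rule has_derivative_bounded_linear)
  have "((\<lambda>t. F (v(i := t))) has_derivative (\<lambda>s. s *\<^sub>R (\<chi> j. pd i (\<lambda>w. F w $ j) v))) (at (v i))"
    using Cb_inftyD(3)[OF F assms(2,3)]
    by (subst has_derivative_componentwise_within)
      (auto simp: Basis_vec_def inner_axis has_field_derivative_def mult.commute[of _ "pd _ _ _"])
  then have "((\<lambda>t. f (F (v(i := t)))) has_derivative (\<lambda>s. f' (s *\<^sub>R (\<chi> j. pd i (\<lambda>w. F w $ j) v)))) (at (v i))"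
    using f by (intro has_derivative_compose[of "\<lambda>t. F (v(i := t))" _ _ _ f]) auto
  then have "pd i (\<lambda>w. f (F w)) v = f' (\<chi> j. pd i (\<lambda>w. F w $ j) v)"
    unfolding pd_def[of _ "\<lambda>w. f (F w)"]
    by (intro DERIV_imp_deriv) (simp add: has_field_derivative_def f'.scaleR mult.commute[of _ "f' _"])
  also have "(\<chi> j. pd i (\<lambda>w. F w $ j) v) = (\<Sum>j\<in>UNIV. pd i (\<lambda>w. F w $ j) v *\<^sub>R axis j 1)"
    by (simp add: vec_eq_iff axis_def if_distrib cong: if_cong)
  also have "f' \<dots> = (\<Sum>j\<in>UNIV. f' (axis j 1) * pd i (\<lambda>w. F w $ j) v)"
    by (simp add: f'.sum f'.scaleR mult.commute)
  finally show ?thesis .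
qed

section \<open>The algebra of test functions\<close>

text \<open>Large slopes \<open>a\<close> make \<open>arctan\<close> of an affine function
  approximate a step, and products of steps approximate boxes. Composition with bounded smooth
  functionals stays in \<open>Cb_infty\<close> by the closure rules for constants, sums, products
  and \<open>arctan\<close>.\<close>

inductive_set arctan_algebra :: "(real ^ 'd \<Rightarrow> real) set" where
  const: "(\<lambda>x. c) \<in> arctan_algebra"
| atan: "(\<lambda>x. arctan (a * x $ j + b)) \<in> arctan_algebra"
| add: "f \<in> arctan_algebra \<Longrightarrow> g \<in> arctan_algebra \<Longrightarrow> (\<lambda>x. f x + g x) \<in> arctan_algebra"
| mult: "f \<in> arctan_algebra \<Longrightarrow> g \<in> arctan_algebra \<Longrightarrow> (\<lambda>x. f x * g x) \<in> arctan_algebra"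

lemma arctan_algebra_bounded:
  assumes "f \<in> arctan_algebra" shows "\<exists>B. \<forall>x. \<bar>f x\<bar> \<le> B"
  using assms
proof induction
  case (atan a j b)
  have "\<bar>arctan x\<bar> \<le> pi / 2" for x
    using arctan_bounded[of x] by linarith
  then show ?case by blast
next
  case (add f g)
  then obtain B C where "\<forall>x. \<bar>f x\<bar> \<le> B" "\<forall>x. \<bar>g x\<bar> \<le> C" by (elim exE)
  then have "\<forall>x. \<bar>f x + g x\<bar> \<le> B + C"
    by (meson abs_triangle_ineq add_mono order_trans)
  then show ?case by blast
next
  case (mult f g)
  then obtain B C where "\<forall>x. \<bar>f x\<bar> \<le> B" "\<forall>x. \<bar>g x\<bar> \<le> C" by (elim exE)
  then have "\<forall>x. \<bar>f x * g x\<bar> \<le> B * C" by (simp add: abs_mult mult_mono')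
  then show ?case by blast
qed blast

lemma arctan_algebra_continuous: "f \<in> arctan_algebra \<Longrightarrow> continuous_on A f"
  by (induction rule: arctan_algebra.induct) (auto intro!: continuous_intros)

lemma arctan_algebra_measurable: "f \<in> arctan_algebra \<Longrightarrow> f \<in> borel_measurable borel"
  using arctan_algebra_continuous by (rule borel_measurable_continuous_onI)

lemma arctan_algebra_translate: "f \<in> arctan_algebra \<Longrightarrow> (\<lambda>x. f (x + h)) \<in> arctan_algebra"
proof (induction rule: arctan_algebra.induct)
  case (atan a j b)
  then show ?case using arctan_algebra.atan[of a j "a * h $ j + b"] by (simp add: algebra_simps)
qed (auto intro: arctan_algebra.intros)

lemma arctan_algebra_prod: "(\<And>i. i \<in> I \<Longrightarrow> f i \<in> arctan_algebra) \<Longrightarrow> (\<lambda>x. \<Prod>i\<in>I. f i x) \<in> arctan_algebra"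
  by (induction I rule: infinite_finite_induct) (auto intro: arctan_algebra.intros)

text \<open>Used with a Weierstrass polynomial to force the values of a test function into
  [-1, 1].\<close>

lemma arctan_algebra_compose_polynomial:
  assumes "real_polynomial_function p" "f \<in> arctan_algebra"
  shows "(\<lambda>x. p (f x)) \<in> arctan_algebra"
  using assms(1)
proof induction
  case (linear h)
  have "h x = h 1 * x" for x :: real
    using linear_scale[OF bounded_linear.linear[OF linear], of x 1] by simp
  then have "(\<lambda>x. h (f x)) = (\<lambda>x. h 1 * f x)" by blast
  then show ?case using arctan_algebra.mult[OF arctan_algebra.const assms(2)] by metis
qed (auto intro: arctan_algebra.intros)

text \<open>The global bound on the derivative makes \<open>f\<close> Lipschitz and dominates the
  difference quotients when differentiating under the expectation; continuity in \<open>x\<close>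
  makes the derivative measurable. Products keep the bound because both factors are bounded.\<close>

lemma arctan_algebra_C1:
  fixes f :: "real ^ 'd \<Rightarrow> real"
  assumes "f \<in> arctan_algebra"
  shows "\<exists>f'. (\<forall>x. (f has_derivative f' x) (at x)) \<and> (\<forall>h. continuous_on UNIV (\<lambda>x. f' x h)) \<and>
     (\<exists>K. \<forall>x h. \<bar>f' x h\<bar> \<le> K * norm h)"
  using assms
proof induction
  case (const c)
  show ?case by (intro exI[of _ "\<lambda>x h. 0"]) (auto intro!: exI[of _ 0])
next
  case (atan a j b)
  have p: "1 + y\<^sup>2 \<noteq> 0" for y :: real
    using one_plus_square_pos[of 1 y] by simp
  have 1: "((\<lambda>x. arctan (a * x $ j + b)) has_derivative
      (\<lambda>h. a * h $ j / (1 + (a * x $ j + b)\<^sup>2))) (at x)" for x :: "real ^ 'd"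
    by (auto intro!: derivative_eq_intros bounded_linear.has_derivative[OF bounded_linear_vec_nth]
        simp: divide_inverse)
  have 2: "continuous_on UNIV (\<lambda>x :: real ^ 'd. a * h $ j / (1 + (a * x $ j + b)\<^sup>2))" for h :: "real ^ 'd"
    using p by (auto intro!: continuous_intros)
  have 3: "\<bar>a * h $ j / (1 + (a * x $ j + b)\<^sup>2)\<bar> \<le> \<bar>a\<bar> * norm h" for x h :: "real ^ 'd"
  proof -
    have "\<bar>a * h $ j\<bar> / (1 + (a * x $ j + b)\<^sup>2) \<le> \<bar>a * h $ j\<bar> / 1"
      by (intro divide_left_mono) (auto simp: add_pos_nonneg)
    also have "\<dots> \<le> \<bar>a\<bar> * norm h"
      by (simp add: abs_mult mult_left_mono component_le_norm_cart)
    finally show ?thesis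
      using one_plus_square_pos[of 1 "a * x $ j + b"] by (simp only: abs_divide abs_of_pos zero_less_one)
  qed
  show ?case
    by (intro exI[of _ "\<lambda>x h. a * h $ j / (1 + (a * x $ j + b)\<^sup>2)"] exI[of _ "\<bar>a\<bar>"] conjI allI 1 2 3)
next
  case (add f g)
  then obtain f' g' K L where d: "\<forall>x. (f has_derivative f' x) (at x)"
    "\<forall>h. continuous_on UNIV (\<lambda>x. f' x h)" "\<forall>x h. \<bar>f' x h\<bar> \<le> K * norm h"
    "\<forall>x. (g has_derivative g' x) (at x)"
    "\<forall>h. continuous_on UNIV (\<lambda>x. g' x h)" "\<forall>x h. \<bar>g' x h\<bar> \<le> L * norm h"
    by (elim exE conjE) 
  have 3: "\<bar>f' x h + g' x h\<bar> \<le> (K + L) * norm h" for x h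
    using abs_triangle_ineq[of "f' x h" "g' x h"] d(3)[THEN spec, THEN spec, of x h]
      d(6)[THEN spec, THEN spec, of x h]
    by (simp add: distrib_right)
  show ?case
    by (intro exI[of _ "\<lambda>x h. f' x h + g' x h"] exI[of _ "K + L"] conjI allI has_derivative_add
        continuous_on_add 3 d(1,2,4,5)[rule_format])
next
  case (mult f g)
  then obtain f' g' K L where d: "\<forall>x. (f has_derivative f' x) (at x)"
    "\<forall>h. continuous_on UNIV (\<lambda>x. f' x h)" "\<forall>x h. \<bar>f' x h\<bar> \<le> K * norm h"
    "\<forall>x. (g has_derivative g' x) (at x)"
    "\<forall>h. continuous_on UNIV (\<lambda>x. g' x h)" "\<forall>x h. \<bar>g' x h\<bar> \<le> L * norm h"
    by (elim exE conjE)
  from mult.hyps[THEN arctan_algebra_bounded] obtain B C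
    where B: "\<forall>x. \<bar>f x\<bar> \<le> B" and C: "\<forall>x. \<bar>g x\<bar> \<le> C"
    by (elim exE)
  have 3: "\<bar>f x * g' x h + f' x h * g x\<bar> \<le> (B * L + K * C) * norm h" for x h
  proof -
    have "\<bar>f x * g' x h\<bar> \<le> B * (L * norm h)" 
      unfolding abs_mult by (intro mult_mono' B[rule_format] d(6)[rule_format] abs_ge_zero)
    moreover have "\<bar>f' x h * g x\<bar> \<le> (K * norm h) * C"
      unfolding abs_mult by (intro mult_mono' C[rule_format] d(3)[rule_format] abs_ge_zero)
    ultimately show ?thesis
      using abs_triangle_ineq[of "f x * g' x h" "f' x h * g x"] by (simp add: algebra_simps)
  qed
  show ?case
    by (intro exI[of _ "\<lambda>x h. f x * g' x h + f' x h * g x"] exI[of _ "B * L + K * C"] conjI allI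
        has_derivative_mult continuous_on_add continuous_on_mult 3 d(1,2,4,5)[rule_format]
        arctan_algebra_continuous mult.hyps)
qed

lemma arctan_algebra_compose_Cb:
  fixes F :: "(nat \<Rightarrow> real) \<Rightarrow> real ^ 'd"
  assumes "f \<in> arctan_algebra" "\<And>j. (\<lambda>v. F v $ j) \<in> Cb_infty J"
  shows "(\<lambda>v. f (F v)) \<in> Cb_infty J"
  using assms(1) by induction (auto intro!: Cb_const Cb_add Cb_mult Cb_atan assms(2))

section \<open>Malliavin operators and cofactors\<close>

lemma Dop_Cb: 
  assumes "noise_vector N" "f \<in> Cb_infty (Dim N)" "i < Dim N"
  shows "Dop N i f \<in> Cb_infty (Dim N)"
  unfolding Dop_def[abs_def] using assms
  by (intro Cb_mult noise_vector.wt_smooth Cb_inftyD(4)) auto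

lemma
  assumes "f \<in> Cb_infty (Dim N)" "g \<in> Cb_infty (Dim N)" "i < Dim N" "v \<in> RJ (Dim N)"
  shows Dop_add: "Dop N i (\<lambda>w. f w + g w) v = Dop N i f v + Dop N i g v"
    and Dop_mult: "Dop N i (\<lambda>w. f w * g w) v = f v * Dop N i g v + g v * Dop N i f v"
    and Dop_inv: "c > 0 \<Longrightarrow> Dop N i (\<lambda>w. 1 / (c + (f w)\<^sup>2)) v = - (2 * f v) / (c + (f v)\<^sup>2)\<^sup>2 * Dop N i f v"
  using pd_add[OF assms] pd_mult[OF assms] pd_inv[OF assms, of c]
  by (simp_all add: Dop_def algebra_simps)

lemma Dop_sum:
  assumes "\<And>a. a \<in> A \<Longrightarrow> f a \<in> Cb_infty (Dim N)" "i < Dim N" "v \<in> RJ (Dim N)"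
  shows "Dop N i (\<lambda>w. \<Sum>a\<in>A. f a w) v = (\<Sum>a\<in>A. Dop N i (f a) v)"
  using pd_sum[of A f "Dim N" i v] assms by (simp add: Dop_def sum_distrib_left)

text \<open>The score terms are linear in \<open>G\<close>, so only the product rule for
  \<open>pd\<close> acts. In this form the divergence contains one derivative of \<open>G\<close>
  and no derivative of \<open>Lop N f\<close>, which is why moments of \<open>Lvec\<close> and of
  the derivatives of \<open>F\<close> control it.\<close>

lemma delta_mult_Dop:
  assumes N: "noise_vector N" and v: "v \<in> RJ (Dim N)"
    and G: "G \<in> Cb_infty (Dim N)" and f: "f \<in> Cb_infty (Dim N)"
  shows "delta N (\<lambda>i w. G w * Dop N i f w) v = G v * Lop N f v - (\<Sum>i<Dim N. Dop N i G v * Dop N i f v)"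
proof -
  have "pd i (\<lambda>w. wt N i w * (G w * Dop N i f w)) v
      = G v * pd i (\<lambda>w. wt N i w * Dop N i f w) v + Dop N i G v * Dop N i f v" if i: "i < Dim N" for i
  proof -
    have "(\<lambda>w. wt N i w * Dop N i f w) \<in> Cb_infty (Dim N)"
      using N i f by (intro Cb_mult Dop_Cb noise_vector.wt_smooth) auto
    from pd_mult[OF G this i v] show ?thesis
      by (simp add: Dop_def mult_ac)
  qed
  then have "delta N (\<lambda>i w. G w * Dop N i f w) v =
    - (\<Sum>i<Dim N. G v * (pd i (\<lambda>w. wt N i w * Dop N i f w) v
                    + wt N i v * Dop N i f v * indicator (slab N i) v * score N i v) 
              + Dop N i G v * Dop N i f v)"
    unfolding delta_def by (intro arg_cong[of _ _ uminus] sum.cong) (simp_all add: algebra_simps)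
  also have "\<dots> = - (G v * (\<Sum>i<Dim N. pd i (\<lambda>w. wt N i w * Dop N i f w) v
      + wt N i v * Dop N i f v * indicator (slab N i) v * score N i v))
      - (\<Sum>i<Dim N. Dop N i G v * Dop N i f v)"
    by (simp only: sum.distrib[of "\<lambda>i. G v * _ i"] sum_distrib_left)
  finally show ?thesis
    unfolding Lop_def delta_def by simp
qed

section \<open>Division-free inversion of a matrix by cofactors\<close>

lemma det_replace_row_linear:
  fixes A :: "real ^ 'd ^ 'd" and x :: "real ^ 'd"
  shows "det (\<chi> a. if a = k then x else A $ a) = (\<Sum>l\<in>UNIV. x $ l * det (\<chi> a. if a = k then axis l 1 else A $ a))"
proof -
  have "x = (\<Sum>l\<in>UNIV. x $ l *s axis l 1)"
    by (simp add: vec_eq_iff axis_def if_distrib cong: if_cong)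
  then have "det (\<chi> a. if a = k then x else A $ a) =
      det (\<chi> a. if a = k then \<Sum>l\<in>UNIV. x $ l *s axis l 1 else A $ a)"
    by (rule arg_cong[where f="\<lambda>x. det (\<chi> a. if a = k then x else A $ a)"])
  also have "\<dots> = (\<Sum>l\<in>UNIV. det (\<chi> a. if a = k then x $ l *s axis l 1 else A $ a))"
    by (subst det_linear_row_sum) auto
  also have "\<dots> = (\<Sum>l\<in>UNIV. x $ l * det (\<chi> a. if a = k then axis l 1 else A $ a))"
    by (subst det_row_mul) auto
  finally show ?thesis .
qed

text \<open>Replacing row \<open>k\<close> by a unit vector produces a cofactor, and linearity in
  that row sums these up to the determinant with row \<open>m\<close> in place of row
  \<open>k\<close>. For m = k this is \<open>A\<close> itself; otherwise two rows coincide.\<close>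

lemma cofactor_row_expansion:
  fixes A :: "real ^ 'd ^ 'd"
  shows "(\<Sum>l\<in>UNIV. A $ m $ l * det (\<chi> a. if a = k then axis l 1 else A $ a)) = (if m = k then det A else 0)"
proof -
  have "(\<Sum>l\<in>UNIV. A $ m $ l * det (\<chi> a. if a = k then axis l 1 else A $ a))
      = det (\<chi> a. if a = k then A $ m else A $ a)"
    by (rule det_replace_row_linear[symmetric])
  also have "\<dots> = (if m = k then det A else 0)"
  proof (cases "m = k")
    case True
    then have "(\<chi> a. if a = k then A $ m else A $ a) = A" by (simp add: vec_eq_iff)
    with True show ?thesis by simp
  next
    case False
    have "det (\<chi> a. if a = k then A $ m else A $ a) = 0"
      by (rule det_identical_rows[OF False]) (use False in \<open>simp add: row_def vec_eq_iff\<close>)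
    with False show ?thesis by simp
  qed
  finally show ?thesis .
qed

section \<open>Functionals controlled by the Sobolev seminorm\<close>

lemma Diter_Cb: 
  assumes "noise_vector N" "f \<in> Cb_infty (Dim N)" "set \<alpha> \<subseteq> {..<Dim N}"
  shows "Diter N \<alpha> f \<in> Cb_infty (Dim N)"
  using assms(2,3) by (induction \<alpha> arbitrary: f) (auto intro: Dop_Cb[OF assms(1)])

lemma Dk_norm_nonneg: "0 \<le> Dk_norm N k f v"
  by (simp add: Dk_norm_def sum_nonneg)

lemma D_seminorm_nonneg: "0 \<le> D_seminorm N l F v"
  by (simp add: D_seminorm_def sum_nonneg Dk_norm_nonneg)

lemma Dk_norm_le_D_seminorm:
  assumes "1 \<le> k" "k \<le> l"
  shows "Dk_norm N k (\<lambda>w. F w $ j) v \<le> D_seminorm N l F v"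
proof -
  have "Dk_norm N k (\<lambda>w. F w $ j) v \<le> (\<Sum>k=1..l. Dk_norm N k (\<lambda>w. F w $ j) v)"
    using assms by (intro member_le_sum) (auto simp: Dk_norm_nonneg)
  also have "\<dots> \<le> D_seminorm N l F v"
    unfolding D_seminorm_def by (intro member_le_sum) (auto simp: Dk_norm_nonneg sum_nonneg)
  finally show ?thesis .
qed

lemma D_seminorm_continuous:
  assumes "noise_vector N" "F \<in> simple_functionals N"
  shows "continuous_on (RJ (Dim N)) (D_seminorm N l F)"
  unfolding D_seminorm_def[abs_def] Dk_norm_def
  using assms
  by (intro continuous_on_sum continuous_on_real_sqrt continuous_on_power Cb_inftyD(1) Diter_Cb)
    (auto simp: simple_functionals_def)

section \<open>Cauchy-Schwarz estimates for the gradient\<close>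

text \<open>The first-order norm \<open>Dk_norm N 1\<close>, indexed by numbers instead of lists of
  length one so that the inequalities for \<open>L2_set\<close> apply.\<close>

definition D_norm :: "'a noise \<Rightarrow> ((nat \<Rightarrow> real) \<Rightarrow> real) \<Rightarrow> (nat \<Rightarrow> real) \<Rightarrow> real" where
  "D_norm N f v = L2_set (\<lambda>i. Dop N i f v) {..<Dim N}"

lemma D_norm_nonneg: "0 \<le> D_norm N f v"
  by (simp add: D_norm_def)

lemma Dk_norm_1: "Dk_norm N 1 f v = D_norm N f v"
proof -
  have "{\<alpha>. set \<alpha> \<subseteq> {..<Dim N} \<and> length \<alpha> = 1} = (\<lambda>i. [i]) ` {..<Dim N}"
    by (auto simp: length_Suc_conv)
  then show ?thesis
    unfolding Dk_norm_def D_norm_def L2_set_def by (simp add: sum.reindex inj_on_def)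
qed

lemma Dk_norm_2: 
  "Dk_norm N 2 f v = L2_set (\<lambda>i. L2_set (\<lambda>m. Dop N i (Dop N m f) v) {..<Dim N}) {..<Dim N}"
proof -
  \<comment> \<open>\<open>Diter\<close> applies the head of the list first, hence
    \<open>[m, i]\<close> corresponds to \<open>Dop N i (Dop N m f)\<close>.\<close>
  have "{\<alpha>. set \<alpha> \<subseteq> {..<Dim N} \<and> length \<alpha> = 2} = (\<lambda>(i, m). [m, i]) ` ({..<Dim N} \<times> {..<Dim N})"
    by (auto simp: length_Suc_conv numeral_2_eq_2 image_iff)
  then have "(\<Sum>\<alpha> | set \<alpha> \<subseteq> {..<Dim N} \<and> length \<alpha> = 2. (Diter N \<alpha> f v)\<^sup>2)
      = (\<Sum>(i, m)\<in>{..<Dim N} \<times> {..<Dim N}. (Dop N i (Dop N m f) v)\<^sup>2)"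
    by (simp add: sum.reindex inj_on_def case_prod_unfold)
  then show ?thesis
    unfolding Dk_norm_def L2_set_def by (simp add: sum_nonneg sum.cartesian_product)
qed

lemma L2_set_cmult: "L2_set (\<lambda>i. c * f i) A = \<bar>c\<bar> * L2_set f A"
  unfolding L2_set_def power_mult_distrib
  by (simp add: real_sqrt_mult flip: sum_distrib_left)

lemma abs_sum_mult_le_L2: "\<bar>\<Sum>i\<in>A. f i * g i\<bar> \<le> L2_set f A * L2_set g A"
proof -
  have "\<bar>\<Sum>i\<in>A. f i * g i\<bar> \<le> (\<Sum>i\<in>A. \<bar>f i\<bar> * \<bar>g i\<bar>)"
    using sum_abs[of "\<lambda>i. f i * g i" A] by (simp add: abs_mult)
  also have "\<dots> \<le> L2_set f A * L2_set g A" by (rule L2_set_mult_ineq)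
  finally show ?thesis .
qed

lemma L2_set_abs: "L2_set (\<lambda>i. \<bar>f i\<bar>) A = L2_set f A"
  by (simp add: L2_set_def)

text \<open>The operator norm is at most the Hilbert-Schmidt norm; the constant 1 does not depend on
  the size of the index sets.\<close>

lemma L2_set_matrix_vector_le:
  "L2_set (\<lambda>i. \<Sum>m\<in>B. a i m * b m) A \<le> L2_set (\<lambda>i. L2_set (a i) B) A * L2_set b B"
proof -
  have "L2_set (\<lambda>i. \<Sum>m\<in>B. a i m * b m) A \<le> L2_set (\<lambda>i. L2_set (a i) B * L2_set b B) A"
    by (subst L2_set_abs[symmetric]) (intro L2_set_mono abs_sum_mult_le_L2 abs_ge_zero)
  then show ?thesis by (simp add: L2_set_left_distrib)
qed

lemma
  assumes "f \<in> Cb_infty (Dim N)" "g \<in> Cb_infty (Dim N)" "v \<in> RJ (Dim N)"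
  shows D_norm_add: "D_norm N (\<lambda>w. f w + g w) v \<le> D_norm N f v + D_norm N g v"
    and D_norm_mult: "D_norm N (\<lambda>w. f w * g w) v \<le> \<bar>f v\<bar> * D_norm N g v + \<bar>g v\<bar> * D_norm N f v"
    and D_norm_inv: "c > 0 \<Longrightarrow> D_norm N (\<lambda>w. 1 / (c + (f w)\<^sup>2)) v \<le> 2 / c\<^sup>2 * (\<bar>f v\<bar> * D_norm N f v)"
proof -
  have "D_norm N (\<lambda>w. f w + g w) v = L2_set (\<lambda>i. Dop N i f v + Dop N i g v) {..<Dim N}"
    unfolding D_norm_def by (intro L2_set_cong refl Dop_add[OF assms(1,2)] assms) auto
  then show "D_norm N (\<lambda>w. f w + g w) v \<le> D_norm N f v + D_norm N g v"
    unfolding D_norm_def by (simp add: L2_set_triangle_ineq)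
  have "D_norm N (\<lambda>w. f w * g w) v = L2_set (\<lambda>i. f v * Dop N i g v + g v * Dop N i f v) {..<Dim N}"
    unfolding D_norm_def by (intro L2_set_cong refl Dop_mult[OF assms(1,2)] assms) auto
  also have "\<dots> \<le> \<bar>f v\<bar> * D_norm N g v + \<bar>g v\<bar> * D_norm N f v"
    unfolding D_norm_def L2_set_cmult[symmetric] by (rule L2_set_triangle_ineq)
  finally show "D_norm N (\<lambda>w. f w * g w) v \<le> \<bar>f v\<bar> * D_norm N g v + \<bar>g v\<bar> * D_norm N f v" .
  assume c: "c > 0"
  have "D_norm N (\<lambda>w. 1 / (c + (f w)\<^sup>2)) v
      = L2_set (\<lambda>i. - (2 * f v) / (c + (f v)\<^sup>2)\<^sup>2 * Dop N i f v) {..<Dim N}"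
    unfolding D_norm_def by (intro L2_set_cong refl Dop_inv[OF assms(1,1)] assms c) auto
  also have "\<dots> = 2 * \<bar>f v\<bar> / (c + (f v)\<^sup>2)\<^sup>2 * D_norm N f v"
    unfolding D_norm_def L2_set_cmult by (simp add: abs_mult)
  also have "\<dots> \<le> 2 * \<bar>f v\<bar> / c\<^sup>2 * D_norm N f v"
    using c by (intro mult_right_mono divide_left_mono D_norm_nonneg power_mono)
      (auto intro!: mult_pos_pos zero_less_power one_plus_square_pos)
  finally show "D_norm N (\<lambda>w. 1 / (c + (f w)\<^sup>2)) v \<le> 2 / c\<^sup>2 * (\<bar>f v\<bar> * D_norm N f v)"
    by (simp add: mult_ac)
qed

section \<open>Bounds along the sequence that do not see the dimension of the noise\<close>

locale functional_seq =
  fixes N :: "nat \<Rightarrow> 'a noise" and Fn :: "nat \<Rightarrow> (nat \<Rightarrow> real) \<Rightarrow> real ^ 'd"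
  assumes noise: "\<And>n. noise_vector (N n)"
    and Fn: "\<And>n. Fn n \<in> simple_functionals (N n)"
begin

abbreviation R where "R n \<equiv> RJ (Dim (N n))"

text \<open>The summand 1 makes powers increasing in the exponent, so that bounds with different
  exponents can be merged. The seminorm dominates the first and second derivatives of
  \<open>Fn n\<close>, which are what the Malliavin matrix and its gradient contain.\<close>

definition majorant :: "nat \<Rightarrow> (nat \<Rightarrow> real) \<Rightarrow> real" where
  "majorant n v = 1 + D_seminorm (N n) 3 (Fn n) v"

text \<open>
  The bounds do not depend on \<open>n\<close>, and in particular not on the dimension of the noise.
\<close>

definition poly_controlled :: "(nat \<Rightarrow> (nat \<Rightarrow> real) \<Rightarrow> real) \<Rightarrow> bool" where
  "poly_controlled g \<longleftrightarrow> (\<forall>n. g n \<in> Cb_infty (Dim (N n))) \<and> (\<exists>K\<ge>0. \<exists>m. \<forall>n. \<forall>v\<in>R n.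
     \<bar>g n v\<bar> \<le> K * majorant n v ^ m \<and> D_norm (N n) (g n) v \<le> K * majorant n v ^ m)"

lemma majorant_ge_1: "1 \<le> majorant n v"
  by (simp add: majorant_def D_seminorm_nonneg)

lemma Fn_Cb: "(\<lambda>w. Fn n w $ j) \<in> Cb_infty (Dim (N n))"
  using Fn by (auto simp: simple_functionals_def)

lemma tameI:
  assumes "\<And>n. g n \<in> Cb_infty (Dim (N n))" "K \<ge> 0"
    and "\<And>n v. v \<in> R n \<Longrightarrow> \<bar>g n v\<bar> \<le> K * majorant n v ^ m"
    and "\<And>n v. v \<in> R n \<Longrightarrow> D_norm (N n) (g n) v \<le> K * majorant n v ^ m"
  shows "poly_controlled g"
  unfolding poly_controlled_def using assms by blast

lemma poly_controlled_Cb: "poly_controlled g \<Longrightarrow> g n \<in> Cb_infty (Dim (N n))"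
  by (simp add: poly_controlled_def)

lemma poly_controlled_const: "poly_controlled (\<lambda>n v. c)"
proof (rule tameI)
  show "D_norm (N n) (\<lambda>v. c) v \<le> \<bar>c\<bar> * majorant n v ^ 0" for n v
    by (simp add: D_norm_def Dop_def pd_const L2_set_0')
qed (auto intro: Cb_const)

lemma poly_controlled_add:
  assumes "poly_controlled f" "poly_controlled g" shows "poly_controlled (\<lambda>n v. f n v + g n v)"
proof -
  from assms(1) obtain K m where f0: "\<forall>n. f n \<in> Cb_infty (Dim (N n))" "K \<ge> 0"
     "\<forall>n. \<forall>v\<in>R n. \<bar>f n v\<bar> \<le> K * majorant n v ^ m \<and> D_norm (N n) (f n) v \<le> K * majorant n v ^ m"
    unfolding poly_controlled_def by (elim exE conjE)
  note f = f0(1)[rule_format] f0(2) f0(3)[rule_format, THEN conjunct1] f0(3)[rule_format, THEN conjunct2]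
  from assms(2) obtain L p where g0: "\<forall>n. g n \<in> Cb_infty (Dim (N n))" "L \<ge> 0"
     "\<forall>n. \<forall>v\<in>R n. \<bar>g n v\<bar> \<le> L * majorant n v ^ p \<and> D_norm (N n) (g n) v \<le> L * majorant n v ^ p"
    unfolding poly_controlled_def by (elim exE conjE)
  note g = g0(1)[rule_format] g0(2) g0(3)[rule_format, THEN conjunct1] g0(3)[rule_format, THEN conjunct2]
  have *: "K * majorant n v ^ m + L * majorant n v ^ p \<le> (K + L) * majorant n v ^ (m + p)" for n v
    unfolding distrib_right using f(2) g(2)
    by (intro add_mono mult_left_mono power_increasing majorant_ge_1) auto
  show ?thesis
  proof (rule tameI[where K="K + L" and m="m + p"])
    fix n v assume v: "v \<in> R n"
    show "\<bar>f n v + g n v\<bar> \<le> (K + L) * majorant n v ^ (m + p)"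
      using f(3)[OF v] g(3)[OF v] * [of n v] by linarith
    show "D_norm (N n) (\<lambda>w. f n w + g n w) v \<le> (K + L) * majorant n v ^ (m + p)"
      using f(4)[OF v] g(4)[OF v] * [of n v] D_norm_add[OF f(1) g(1) v] by linarith
  qed (use f g in \<open>auto intro: Cb_add\<close>)
qed

lemma poly_controlled_mult:
  assumes "poly_controlled f" "poly_controlled g" shows "poly_controlled (\<lambda>n v. f n v * g n v)"
proof -
  from assms(1) obtain K m where f0: "\<forall>n. f n \<in> Cb_infty (Dim (N n))" "K \<ge> 0"
     "\<forall>n. \<forall>v\<in>R n. \<bar>f n v\<bar> \<le> K * majorant n v ^ m \<and> D_norm (N n) (f n) v \<le> K * majorant n v ^ m"
    unfolding poly_controlled_def by (elim exE conjE)
  note f = f0(1)[rule_format] f0(2) f0(3)[rule_format, THEN conjunct1] f0(3)[rule_format, THEN conjunct2]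
  from assms(2) obtain L p where g0: "\<forall>n. g n \<in> Cb_infty (Dim (N n))" "L \<ge> 0"
     "\<forall>n. \<forall>v\<in>R n. \<bar>g n v\<bar> \<le> L * majorant n v ^ p \<and> D_norm (N n) (g n) v \<le> L * majorant n v ^ p"
    unfolding poly_controlled_def by (elim exE conjE)
  note g = g0(1)[rule_format] g0(2) g0(3)[rule_format, THEN conjunct1] g0(3)[rule_format, THEN conjunct2]
  show ?thesis
  proof (rule tameI[where K="2 * (K * L)" and m="m + p"])
    fix n v assume v: "v \<in> R n"
    have Y0: "0 \<le> majorant n v" using majorant_ge_1[of n v] by simp
    have a: "\<bar>f n v\<bar> * \<bar>g n v\<bar> \<le> (K * majorant n v ^ m) * (L * majorant n v ^ p)"
      by (intro mult_mono' f(3) g(3) v) auto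
    have b: "\<bar>f n v\<bar> * D_norm (N n) (g n) v \<le> (K * majorant n v ^ m) * (L * majorant n v ^ p)"
      by (intro mult_mono' f(3) g(4) v D_norm_nonneg) auto
    have c: "\<bar>g n v\<bar> * D_norm (N n) (f n) v \<le> (L * majorant n v ^ p) * (K * majorant n v ^ m)"
      by (intro mult_mono' g(3) f(4) v D_norm_nonneg) auto
    have d: "(K * majorant n v ^ m) * (L * majorant n v ^ p) = K * L * majorant n v ^ (m + p)"
      "(L * majorant n v ^ p) * (K * majorant n v ^ m) = K * L * majorant n v ^ (m + p)"
      by (simp_all add: power_add)
    have e: "0 \<le> K * L * majorant n v ^ (m + p)" using f(2) g(2) Y0 by simp
    show "\<bar>f n v * g n v\<bar> \<le> 2 * (K * L) * majorant n v ^ (m + p)"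
      using a d e by (simp add: abs_mult)
    show "D_norm (N n) (\<lambda>w. f n w * g n w) v \<le> 2 * (K * L) * majorant n v ^ (m + p)"
      using b c d D_norm_mult[OF f(1) g(1) v] by simp
  qed (use f g in \<open>auto intro: Cb_mult\<close>)
qed

lemma poly_controlled_inv:
  assumes "poly_controlled f" and c: "c > 0" shows "poly_controlled (\<lambda>n v. 1 / (c + (f n v)\<^sup>2))"
proof -
  from assms(1) obtain K m where f0: "\<forall>n. f n \<in> Cb_infty (Dim (N n))" "K \<ge> 0"
     "\<forall>n. \<forall>v\<in>R n. \<bar>f n v\<bar> \<le> K * majorant n v ^ m \<and> D_norm (N n) (f n) v \<le> K * majorant n v ^ m"
    unfolding poly_controlled_def by (elim exE conjE)
  note f = f0(1)[rule_format] f0(2) f0(3)[rule_format, THEN conjunct1] f0(3)[rule_format, THEN conjunct2]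
  show ?thesis
  \<comment> \<open>The summand \<open>1 / c\<close> bounds the value, the other one the gradient.
    The constant explodes as \<open>c\<close> tends to 0, which is harmless because \<open>c\<close>
    is fixed along the sequence.\<close>
  proof (rule tameI[where K="1 / c + 2 / c\<^sup>2 * (K * K)" and m="m + m"])
    fix n v assume v: "v \<in> R n"
    have Y1: "1 \<le> majorant n v ^ (m + m)" using majorant_ge_1[of n v] by (rule one_le_power)
    have "\<bar>f n v\<bar> * D_norm (N n) (f n) v \<le> (K * majorant n v ^ m) * (K * majorant n v ^ m)"
      by (intro mult_mono' f(3) f(4) v D_norm_nonneg) auto
    then have "2 / c\<^sup>2 * (\<bar>f n v\<bar> * D_norm (N n) (f n) v) \<le> 2 / c\<^sup>2 * (K * K * majorant n v ^ (m + m))"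
      using c by (intro mult_left_mono) (simp_all add: power_add mult_ac)
    then have "D_norm (N n) (\<lambda>w. 1 / (c + (f n w)\<^sup>2)) v \<le> 2 / c\<^sup>2 * (K * K * majorant n v ^ (m + m))"
      using D_norm_inv[OF f(1) f(1) v c] by simp
    moreover have "0 \<le> 1 / c * majorant n v ^ (m + m)" using c Y1 by simp
    ultimately show "D_norm (N n) (\<lambda>w. 1 / (c + (f n w)\<^sup>2)) v \<le> (1 / c + 2 / c\<^sup>2 * (K * K)) * majorant n v ^ (m + m)"
      by (simp only: distrib_right mult.assoc)
    have "\<bar>1 / (c + (f n v)\<^sup>2)\<bar> \<le> 1 / c * 1"
      using c one_plus_square_pos[OF c, of "f n v"] by (simp add: divide_simps)
    also have "\<dots> \<le> (1 / c + 2 / c\<^sup>2 * (K * K)) * majorant n v ^ (m + m)"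
      using c Y1 f(2) by (intro mult_mono) auto
    finally show "\<bar>1 / (c + (f n v)\<^sup>2)\<bar> \<le> (1 / c + 2 / c\<^sup>2 * (K * K)) * majorant n v ^ (m + m)" .
  qed (use f c in \<open>auto intro!: Cb_inv\<close>)
qed

lemma poly_controlled_sum: "(\<And>a. a \<in> A \<Longrightarrow> poly_controlled (f a)) \<Longrightarrow> poly_controlled (\<lambda>n v. \<Sum>a\<in>A. f a n v)"
  by (induction A rule: infinite_finite_induct) (auto intro: poly_controlled_const poly_controlled_add)

lemma poly_controlled_prod: "(\<And>a. a \<in> A \<Longrightarrow> poly_controlled (f a)) \<Longrightarrow> poly_controlled (\<lambda>n v. \<Prod>a\<in>A. f a n v)"
  by (induction A rule: infinite_finite_induct) (auto intro: poly_controlled_const poly_controlled_mult)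

text \<open>The Leibniz formula is a polynomial in the entries whose number of terms depends on the
  type \<open>'e\<close> alone, hence not on \<open>n\<close>.\<close>

lemma poly_controlled_det:
  fixes M :: "nat \<Rightarrow> (nat \<Rightarrow> real) \<Rightarrow> real ^ 'e ^ 'e"
  assumes "\<And>a b. poly_controlled (\<lambda>n v. M n v $ a $ b)"
  shows "poly_controlled (\<lambda>n v. det (M n v))"
  unfolding det_def by (intro poly_controlled_sum poly_controlled_mult poly_controlled_prod poly_controlled_const assms)

lemma D_norm_Fn_le: "D_norm (N n) (\<lambda>w. Fn n w $ j) v \<le> majorant n v"
  using Dk_norm_le_D_seminorm[of 1 3 "N n" "Fn n" j v] unfolding Dk_norm_1 majorant_def by simp

text \<open>The gradient of \<langle>DF^j, DF^k\<rangle> is a sum of two terms, each a matrix of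
  second derivatives applied to a gradient. The Hilbert-Schmidt bound reduces both to the seminorms
  of order one and two; the constant 2 counts the terms.\<close>

lemma poly_controlled_malliavin_matrix: "poly_controlled (\<lambda>n v. malliavin_matrix (N n) (Fn n) v $ j $ k)"
proof (rule tameI[where K=2 and m=2])
  let ?D = "\<lambda>n i j v. Dop (N n) i (\<lambda>w. Fn n w $ j) v"
  have DC: "?D n i j \<in> Cb_infty (Dim (N n))" if "i < Dim (N n)" for n i j
    using that by (intro Dop_Cb noise Fn_Cb)
  show Cb: "(\<lambda>v. malliavin_matrix (N n) (Fn n) v $ j $ k) \<in> Cb_infty (Dim (N n))" for n
    unfolding malliavin_matrix_def by (auto intro!: Cb_sum Cb_mult DC)
  fix n v assume v: "v \<in> R n"
  have Y2: "a * b \<le> majorant n v ^ 2" if "0 \<le> a" "0 \<le> b" "a \<le> majorant n v" "b \<le> majorant n v" for a b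
    unfolding power2_eq_square using that by (intro mult_mono) auto
  have "\<bar>malliavin_matrix (N n) (Fn n) v $ j $ k\<bar>
      \<le> D_norm (N n) (\<lambda>w. Fn n w $ j) v * D_norm (N n) (\<lambda>w. Fn n w $ k) v"
    unfolding malliavin_matrix_def D_norm_def by (simp add: abs_sum_mult_le_L2)
  also have "\<dots> \<le> majorant n v ^ 2"
    by (intro Y2 D_norm_nonneg D_norm_Fn_le)
  finally show "\<bar>malliavin_matrix (N n) (Fn n) v $ j $ k\<bar> \<le> 2 * majorant n v ^ 2"
    using zero_le_power2[of "majorant n v"] by linarith
  let ?DD = "\<lambda>j. L2_set (\<lambda>i. L2_set (\<lambda>m. Dop (N n) i (?D n m j) v) {..<Dim (N n)}) {..<Dim (N n)}"
  have DD: "?DD j \<le> majorant n v" for j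
    using Dk_norm_le_D_seminorm[of 2 3 "N n" "Fn n" j v] unfolding Dk_norm_2 majorant_def by simp
  have "Dop (N n) i (\<lambda>v. malliavin_matrix (N n) (Fn n) v $ j $ k) v =
      (\<Sum>m<Dim (N n). Dop (N n) i (?D n m j) v * ?D n m k v)
    + (\<Sum>m<Dim (N n). Dop (N n) i (?D n m k) v * ?D n m j v)" if i: "i < Dim (N n)" for i
  proof -
    have "Dop (N n) i (\<lambda>v. malliavin_matrix (N n) (Fn n) v $ j $ k) v
        = (\<Sum>m<Dim (N n). Dop (N n) i (\<lambda>v. ?D n m j v * ?D n m k v) v)"
      unfolding malliavin_matrix_def vec_lambda_beta
      by (intro Dop_sum Cb_mult DC i v) auto
    also have "\<dots> = (\<Sum>m<Dim (N n). Dop (N n) i (?D n m j) v * ?D n m k v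
        + Dop (N n) i (?D n m k) v * ?D n m j v)"
      using i v by (intro sum.cong refl) (simp add: Dop_mult DC)
    finally show ?thesis by (simp add: sum.distrib)
  qed
  then have "D_norm (N n) (\<lambda>v. malliavin_matrix (N n) (Fn n) v $ j $ k) v =
    L2_set (\<lambda>i. (\<Sum>m<Dim (N n). Dop (N n) i (?D n m j) v * ?D n m k v)
    + (\<Sum>m<Dim (N n). Dop (N n) i (?D n m k) v * ?D n m j v)) {..<Dim (N n)}"
    unfolding D_norm_def by (intro L2_set_cong) auto
  also have "\<dots> \<le> L2_set (\<lambda>i. \<Sum>m<Dim (N n). Dop (N n) i (?D n m j) v * ?D n m k v) {..<Dim (N n)}
    + L2_set (\<lambda>i. \<Sum>m<Dim (N n). Dop (N n) i (?D n m k) v * ?D n m j v) {..<Dim (N n)}"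
    by (rule L2_set_triangle_ineq)
  also have "\<dots> \<le> ?DD j * D_norm (N n) (\<lambda>w. Fn n w $ k) v + ?DD k * D_norm (N n) (\<lambda>w. Fn n w $ j) v"
    unfolding D_norm_def by (intro add_mono L2_set_matrix_vector_le)
  also have "\<dots> \<le> majorant n v ^ 2 + majorant n v ^ 2"
    by (intro add_mono Y2 D_norm_nonneg L2_set_nonneg DD D_norm_Fn_le)
  finally show "D_norm (N n) (\<lambda>v. malliavin_matrix (N n) (Fn n) v $ j $ k) v \<le> 2 * majorant n v ^ 2"
    by simp
qed simp

end

section \<open>Integration by parts\<close>

lemma ennroot_le_iff_bound:
  assumes "ennroot q x \<le> ennreal B" "q > 0"
  shows "x \<le> ennreal (B powr q)"
proof -
  have x: "x \<noteq> \<infinity>" using assms(1) by (auto simp: ennroot_def top_unique)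
  then have le: "ennreal (enn2real x powr (1 / q)) \<le> ennreal B"
    using assms(1) by (simp add: ennroot_def)
  have "enn2real x \<le> B powr q"
  \<comment> \<open>\<open>ennreal\<close> truncates a negative \<open>B\<close> to 0, so the
    inequality can be read back in the reals only when the root is positive.\<close>
  proof (cases "enn2real x = 0")
    case False
    then have x0: "0 < enn2real x" using enn2real_nonneg[of x] by linarith
    then have "enn2real x powr (1 / q) \<le> B"
      using le by (metis ennreal_le_iff2 not_le powr_gt_zero less_le)
    then have "(enn2real x powr (1 / q)) powr q \<le> B powr q"
      using assms(2) by (intro powr_mono2) auto
    then show ?thesis using assms(2) x0 by (simp add: powr_powr)
  qed simp
  then have "ennreal (enn2real x) \<le> ennreal (B powr q)" by (rule ennreal_leI)
  moreover have "ennreal (enn2real x) = x" using x by (simp add: less_top)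
  ultimately show ?thesis by (simp only:)
qed

lemma ennreal_add_leD:
  fixes a b c :: ennreal
  assumes "a + b \<le> c"
  shows "a \<le> c" "b \<le> c"
  using assms by (metis le_iff_add order_trans, metis le_iff_add add.commute order_trans)

context noise_vector
begin

lemma Vec_measurable: "Vec N \<in> measurable (Prob N) (Pi\<^sub>M {..<Dim N} (\<lambda>_. lborel))"
  using distributed_measurable[OF distributed_Vec] .

lemma Vec_RJ: "\<omega> \<in> space (Prob N) \<Longrightarrow> Vec N \<omega> \<in> RJ (Dim N)"
  using measurable_space[OF Vec_measurable] by (auto simp: space_PiM)

lemma continuous_Vec_measurable:
  "continuous_on (RJ (Dim N)) f \<Longrightarrow> (\<lambda>\<omega>. f (Vec N \<omega>)) \<in> borel_measurable (Prob N)"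
  using measurable_compose[OF Vec_measurable borel_measurable_RJ] .

lemma Cb_Vec_integrable:
  assumes "f \<in> Cb_infty (Dim N)"
  shows "integrable (Prob N) (\<lambda>\<omega>. f (Vec N \<omega>))"
proof -
  obtain B where B: "\<forall>v\<in>RJ (Dim N). \<bar>f v\<bar> \<le> B"
    using Cb_inftyD(2)[OF assms] unfolding bounded_real_image by blast
  show ?thesis
    using B Vec_RJ continuous_Vec_measurable[OF Cb_inftyD(1)[OF assms]]
    by (intro integrable_const_bound[of _ B]) auto
qed

text \<open>The non-integrable case is covered by the default value 0 of the Bochner integral. The
  lemma therefore applies directly to \<open>delta\<close>, which is identified with a regular
  functional only almost surely.\<close>

lemma abs_integral_mult_le:
  assumes "(\<integral>\<^sup>+\<omega>. ennreal \<bar>g \<omega>\<bar> \<partial>Prob N) \<le> ennreal C" "0 \<le> C"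
    and "\<And>\<omega>. \<omega> \<in> space (Prob N) \<Longrightarrow> \<bar>f \<omega>\<bar> \<le> (1::real)"
  shows "\<bar>\<integral>\<omega>. f \<omega> * g \<omega> \<partial>Prob N\<bar> \<le> C"
proof (cases "integrable (Prob N) (\<lambda>\<omega>. f \<omega> * g \<omega>)")
  case True
  have "ennreal \<bar>\<integral>\<omega>. f \<omega> * g \<omega> \<partial>Prob N\<bar> \<le> (\<integral>\<^sup>+\<omega>. ennreal \<bar>f \<omega> * g \<omega>\<bar> \<partial>Prob N)"
    using integral_norm_bound_ennreal[OF True] by simp
  also have "\<dots> \<le> (\<integral>\<^sup>+\<omega>. ennreal \<bar>g \<omega>\<bar> \<partial>Prob N)"
    using assms(3) by (intro nn_integral_mono ennreal_leI) (simp add: abs_mult mult_left_le_one_le)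
  also have "\<dots> \<le> ennreal C" by (rule assms(1))
  finally show ?thesis using assms(2) by simp
qed (simp add: not_integrable_integral_eq assms(2))

text \<open>Splitting a non-negative integral into summands requires measurable integrands; the
  framework supplies a continuous version of \<open>Lop N f\<close> to which one can pass.\<close>

lemma Lop_AE_measurable:
  assumes "f \<in> Cb_infty (Dim N)"
  obtains g where "g \<in> borel_measurable (Prob N)" "AE \<omega> in Prob N. Lop N f (Vec N \<omega>) = g \<omega>"
proof -
  have "\<exists>g\<in>Cpol_infty (Dim N). AE \<omega> in Prob N. Lop N f (Vec N \<omega>) = g (Vec N \<omega>)"
    unfolding Lop_def
    by (intro delta_Cpol Cb_subset_Cpol Dop_Cb assms noise_vector_axioms)
  then obtain g where g: "g \<in> Cpol_infty (Dim N)"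
    "AE \<omega> in Prob N. Lop N f (Vec N \<omega>) = g (Vec N \<omega>)" by blast
  have "\<forall>\<alpha>. set \<alpha> \<subseteq> {..<Dim N} \<longrightarrow> continuous_on (RJ (Dim N)) (pds \<alpha> g)"
    using g(1) by (simp add: Cpol_infty_def smooth_fun_def)
  from this[THEN spec, of "[]"] have "continuous_on (RJ (Dim N)) g" by simp
  from that[OF continuous_Vec_measurable[OF this] g(2)] show thesis .
qed

end

context functional_seq
begin

lemma A_bounded_moments:
  assumes A: "(SUP n. A_norm q (N n) (Fn n)) < \<infinity>" and q: "q \<ge> 1"
  shows "\<exists>C\<ge>0. \<forall>n.
    (\<integral>\<^sup>+\<omega>. ennreal (D_seminorm (N n) 3 (Fn n) (Vec (N n) \<omega>) powr q) \<partial>Prob (N n)) \<le> ennreal C \<and>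
    (\<integral>\<^sup>+\<omega>. ennreal (norm (Lvec (N n) (Fn n) (Vec (N n) \<omega>)) powr q) \<partial>Prob (N n)) \<le> ennreal C"
proof -
  obtain B where B: "B \<ge> 0" "(SUP n. A_norm q (N n) (Fn n)) = ennreal B"
    using A by (cases "SUP n. A_norm q (N n) (Fn n)") auto
  have "A_norm q (N n) (Fn n) \<le> ennreal B" for n
    unfolding B(2)[symmetric] by (rule SUP_upper) simp
  then have "sobolev_norm (N n) 3 q (Fn n) \<le> ennreal B"
    "sobolev_norm (N n) 1 q (Lvec (N n) (Fn n)) \<le> ennreal B" for n
    unfolding A_norm_def by (blast dest: ennreal_add_leD)+
  then have "(\<integral>\<^sup>+\<omega>. ennreal (norm (Fn n (Vec (N n) \<omega>)) powr q) \<partial>Prob (N n))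
      + (\<integral>\<^sup>+\<omega>. ennreal (D_seminorm (N n) 3 (Fn n) (Vec (N n) \<omega>) powr q) \<partial>Prob (N n)) \<le> ennreal (B powr q)"
    "(\<integral>\<^sup>+\<omega>. ennreal (norm (Lvec (N n) (Fn n) (Vec (N n) \<omega>)) powr q) \<partial>Prob (N n))
      + (\<integral>\<^sup>+\<omega>. ennreal (D_seminorm (N n) 1 (Lvec (N n) (Fn n)) (Vec (N n) \<omega>) powr q) \<partial>Prob (N n)) \<le> ennreal (B powr q)" for n
    unfolding sobolev_norm_def using q by (auto intro!: ennroot_le_iff_bound)
  then show ?thesis
    by (intro exI[of _ "B powr q"] conjI allI) (blast intro: powr_ge_zero dest: ennreal_add_leD)+
qed

lemma majorant_Vec_measurable: "(\<lambda>\<omega>. majorant n (Vec (N n) \<omega>)) \<in> borel_measurable (Prob (N n))"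
  unfolding majorant_def
  by (intro borel_measurable_add borel_measurable_const
      noise_vector.continuous_Vec_measurable noise D_seminorm_continuous Fn)

lemma majorant_moments:
  assumes A: "\<And>q::real. q \<ge> 1 \<Longrightarrow> (SUP n. A_norm q (N n) (Fn n)) < \<infinity>"
  shows "\<exists>C\<ge>0. \<forall>n. (\<integral>\<^sup>+\<omega>. ennreal (majorant n (Vec (N n) \<omega>) ^ m) \<partial>Prob (N n)) \<le> ennreal C"
proof -
  \<comment> \<open>The successor keeps the exponent at least 1 even for m = 0, as the norm bounds
    require, and makes \<open>powr\<close> agree with the power at the base 0.\<close>
  define q where "q = real (Suc m)"
  have "q \<ge> 1" by (simp add: q_def)
  from A_bounded_moments[OF A[OF this] this] obtain C where C: "C \<ge> 0"
    "\<forall>n. (\<integral>\<^sup>+\<omega>. ennreal (D_seminorm (N n) 3 (Fn n) (Vec (N n) \<omega>) powr q) \<partial>Prob (N n)) \<le> ennreal C"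
    by blast
  have "(\<integral>\<^sup>+\<omega>. ennreal (majorant n (Vec (N n) \<omega>) ^ m) \<partial>Prob (N n)) \<le> ennreal (2 ^ Suc m * (1 + C))" for n
  proof -
    interpret noise_vector "N n" by (rule noise)
    let ?s = "\<lambda>\<omega>. D_seminorm (N n) 3 (Fn n) (Vec (N n) \<omega>)"
    have [measurable]: "?s \<in> borel_measurable (Prob (N n))"
      by (intro continuous_Vec_measurable D_seminorm_continuous noise Fn)
    have e: "ennreal (2 ^ Suc m * (1 + s)) = ennreal (2 ^ Suc m) * (1 + ennreal s)" if "0 \<le> s" for s
      using that by (simp add: ennreal_mult' del: power_Suc)
    have "majorant n (Vec (N n) \<omega>) ^ m \<le> 2 ^ Suc m * (1 + ?s \<omega> powr q)" for \<omega>
    proof -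
      have s: "0 \<le> ?s \<omega>" by (rule D_seminorm_nonneg)
      have pw: "?s \<omega> powr q = ?s \<omega> ^ Suc m"
        using s powr_realpow[of "?s \<omega>" "Suc m"] unfolding q_def by (cases "?s \<omega> = 0") auto
      have "majorant n (Vec (N n) \<omega>) ^ m \<le> majorant n (Vec (N n) \<omega>) ^ Suc m"
        by (intro power_increasing majorant_ge_1) simp
      also have "\<dots> \<le> (2 * max 1 (?s \<omega>)) ^ Suc m"
        unfolding majorant_def using s by (intro power_mono) auto
      also have "\<dots> = 2 ^ Suc m * (max 1 (?s \<omega>)) ^ Suc m"
        by (rule power_mult_distrib)
      also have "\<dots> \<le> 2 ^ Suc m * (1 + ?s \<omega> ^ Suc m)"
        using zero_le_power[OF s, of "Suc m"] by (intro mult_left_mono) (auto simp: max_def)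
      finally show ?thesis unfolding pw .
    qed
    then have "(\<integral>\<^sup>+\<omega>. ennreal (majorant n (Vec (N n) \<omega>) ^ m) \<partial>Prob (N n))
        \<le> (\<integral>\<^sup>+\<omega>. ennreal (2 ^ Suc m) * (1 + ennreal (?s \<omega> powr q)) \<partial>Prob (N n))"
      unfolding e[OF powr_ge_zero, symmetric] by (intro nn_integral_mono ennreal_leI)
    also have "\<dots> = ennreal (2 ^ Suc m) * (1 + (\<integral>\<^sup>+\<omega>. ennreal (?s \<omega> powr q) \<partial>Prob (N n)))"
      by (subst nn_integral_cmult) (simp_all add: nn_integral_add emeasure_space_1 del: power_Suc)
    also have "\<dots> \<le> ennreal (2 ^ Suc m) * (1 + ennreal C)"
      using C(2) by (intro mult_left_mono add_left_mono) auto
    also have "\<dots> = ennreal (2 ^ Suc m * (1 + C))"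
      using C(1) by (simp add: ennreal_mult' del: power_Suc)
    finally show ?thesis .
  qed
  moreover have "0 \<le> 2 ^ Suc m * (1 + C)" using C(1) by simp
  ultimately show ?thesis by blast
qed

text \<open>By the product formula the divergence is at most |G| |LF| + |DG| |DF|. The first product
  is separated by ab \<le> a^2 + b^2, so a second moment of LF and one moment of the majorant
  suffice.\<close>

lemma delta_L1_bound:
  assumes A: "\<And>q::real. q \<ge> 1 \<Longrightarrow> (SUP n. A_norm q (N n) (Fn n)) < \<infinity>" and G: "poly_controlled G"
  shows "\<exists>C\<ge>0. \<forall>n. (\<integral>\<^sup>+\<omega>. ennreal \<bar>delta (N n) (\<lambda>i w. G n w * Dop (N n) i (\<lambda>w. Fn n w $ l) w) (Vec (N n) \<omega>)\<bar>
     \<partial>Prob (N n)) \<le> ennreal C"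
proof -
  from G obtain K m where G0: "\<forall>n. G n \<in> Cb_infty (Dim (N n))" and K: "K \<ge> 0"
     and Gb: "\<forall>n. \<forall>v\<in>R n. \<bar>G n v\<bar> \<le> K * majorant n v ^ m \<and> D_norm (N n) (G n) v \<le> K * majorant n v ^ m"
    unfolding poly_controlled_def by (elim exE conjE)
  have "\<exists>C\<ge>0. \<forall>n. (\<integral>\<^sup>+\<omega>. ennreal (majorant n (Vec (N n) \<omega>) ^ (2 * m + 1)) \<partial>Prob (N n)) \<le> ennreal C"
    by (intro majorant_moments A)
  then obtain C1 where C1: "C1 \<ge> 0"
    "\<forall>n. (\<integral>\<^sup>+\<omega>. ennreal (majorant n (Vec (N n) \<omega>) ^ (2 * m + 1)) \<partial>Prob (N n)) \<le> ennreal C1" by blast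
  have "(1::real) \<le> 2" by simp
  from A_bounded_moments[OF A[OF this] this] obtain C2 where C2: "C2 \<ge> 0"
    "\<forall>n. (\<integral>\<^sup>+\<omega>. ennreal (norm (Lvec (N n) (Fn n) (Vec (N n) \<omega>)) powr 2) \<partial>Prob (N n)) \<le> ennreal C2"
    by blast
  have "(\<integral>\<^sup>+\<omega>. ennreal \<bar>delta (N n) (\<lambda>i w. G n w * Dop (N n) i (\<lambda>w. Fn n w $ l) w) (Vec (N n) \<omega>)\<bar>
     \<partial>Prob (N n)) \<le> ennreal (2 * K * C1 + K * C2)" for n
  proof -
    interpret noise_vector "N n" by (rule noise)
    obtain g where [measurable]: "g \<in> borel_measurable (Prob (N n))"
      and g: "AE \<omega> in Prob (N n). Lop (N n) (\<lambda>w. Fn n w $ l) (Vec (N n) \<omega>) = g \<omega>"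
      by (rule Lop_AE_measurable[OF Fn_Cb[of n l]])
    note [measurable] = majorant_Vec_measurable[of n]
    \<comment> \<open>The exponent 2m + 1 dominates both m + 1, from |DG| |DF|, and 2m, from the
      square of the bound for G. Each of the two contributes one \<open>K\<close>.\<close>
    have pw: "\<bar>delta (N n) (\<lambda>i w. G n w * Dop (N n) i (\<lambda>w. Fn n w $ l) w) v\<bar>
        \<le> 2 * K * majorant n v ^ (2 * m + 1) + K * (Lop (N n) (\<lambda>w. Fn n w $ l) v)\<^sup>2" if v: "v \<in> R n" for v
    proof -
      let ?L = "Lop (N n) (\<lambda>w. Fn n w $ l) v" and ?y = "majorant n v"
      have y1: "1 \<le> ?y" by (rule majorant_ge_1)
      have g1: "\<bar>G n v\<bar> \<le> K * ?y ^ m" "D_norm (N n) (G n) v \<le> K * ?y ^ m"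
        using Gb v by auto
      have "\<bar>\<Sum>i<Dim (N n). Dop (N n) i (G n) v * Dop (N n) i (\<lambda>w. Fn n w $ l) v\<bar>
          \<le> D_norm (N n) (G n) v * D_norm (N n) (\<lambda>w. Fn n w $ l) v"
        unfolding D_norm_def by (rule abs_sum_mult_le_L2)
      also have "\<dots> \<le> (K * ?y ^ m) * ?y"
        by (intro mult_mono' g1 D_norm_Fn_le D_norm_nonneg)
      also have "\<dots> = K * ?y ^ (m + 1)" by simp
      also have "\<dots> \<le> K * ?y ^ (2 * m + 1)"
        using K y1 by (intro mult_left_mono power_increasing) auto
      finally have a: "\<bar>\<Sum>i<Dim (N n). Dop (N n) i (G n) v * Dop (N n) i (\<lambda>w. Fn n w $ l) v\<bar> \<le> K * ?y ^ (2 * m + 1)" .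
      have "\<bar>G n v * ?L\<bar> \<le> (K * ?y ^ m) * \<bar>?L\<bar>"
        unfolding abs_mult by (intro mult_right_mono g1) auto
      also have "\<dots> = K * (?y ^ m * \<bar>?L\<bar>)" by simp
      also have "\<dots> \<le> K * ((?y ^ m)\<^sup>2 + ?L\<^sup>2)"
      proof (rule mult_left_mono[OF _ K])
        have "0 \<le> (?y ^ m - \<bar>?L\<bar>)\<^sup>2" "0 \<le> (?y ^ m)\<^sup>2" "0 \<le> ?L\<^sup>2" by auto
        then show "?y ^ m * \<bar>?L\<bar> \<le> (?y ^ m)\<^sup>2 + ?L\<^sup>2"
          unfolding power2_diff power2_abs by linarith
      qed
      also have "(?y ^ m)\<^sup>2 = ?y ^ (2 * m)"
        by (simp add: power_mult[symmetric] mult.commute)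
      also have "K * (?y ^ (2 * m) + ?L\<^sup>2) \<le> K * (?y ^ (2 * m + 1) + ?L\<^sup>2)"
        using K y1 by (intro mult_left_mono add_right_mono power_increasing) auto
      finally have b: "\<bar>G n v * ?L\<bar> \<le> K * ?y ^ (2 * m + 1) + K * ?L\<^sup>2"
        by (simp add: distrib_left)
      show ?thesis
        using a b unfolding delta_mult_Dop[OF noise v G0[rule_format] Fn_Cb] by linarith
    qed
    let ?L = "\<lambda>\<omega>. Lop (N n) (\<lambda>w. Fn n w $ l) (Vec (N n) \<omega>)" and ?y = "\<lambda>\<omega>. majorant n (Vec (N n) \<omega>)"
    have y0: "0 \<le> ?y \<omega>" for \<omega> using majorant_ge_1[of n "Vec (N n) \<omega>"] by simp
    have "(\<integral>\<^sup>+\<omega>. ennreal \<bar>delta (N n) (\<lambda>i w. G n w * Dop (N n) i (\<lambda>w. Fn n w $ l) w) (Vec (N n) \<omega>)\<bar> \<partial>Prob (N n))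
       \<le> (\<integral>\<^sup>+\<omega>. ennreal (2 * K * ?y \<omega> ^ (2 * m + 1) + K * (?L \<omega>)\<^sup>2) \<partial>Prob (N n))"
      by (intro nn_integral_mono ennreal_leI pw Vec_RJ)
    also have "\<dots> = (\<integral>\<^sup>+\<omega>. ennreal (2 * K) * ennreal (?y \<omega> ^ (2 * m + 1)) + ennreal K * ennreal ((g \<omega>)\<^sup>2) \<partial>Prob (N n))"
      using g K y0 by (intro nn_integral_cong_AE) (auto simp: ennreal_mult' ennreal_plus)
    also have "\<dots> = ennreal (2 * K) * (\<integral>\<^sup>+\<omega>. ennreal (?y \<omega> ^ (2 * m + 1)) \<partial>Prob (N n))
        + ennreal K * (\<integral>\<^sup>+\<omega>. ennreal ((g \<omega>)\<^sup>2) \<partial>Prob (N n))"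
      by (subst nn_integral_add) (simp_all add: nn_integral_cmult del: power_Suc)
    also have "(\<integral>\<^sup>+\<omega>. ennreal ((g \<omega>)\<^sup>2) \<partial>Prob (N n)) = (\<integral>\<^sup>+\<omega>. ennreal ((?L \<omega>)\<^sup>2) \<partial>Prob (N n))"
      using g by (intro nn_integral_cong_AE) auto
    also have "\<dots> \<le> (\<integral>\<^sup>+\<omega>. ennreal (norm (Lvec (N n) (Fn n) (Vec (N n) \<omega>)) powr 2) \<partial>Prob (N n))"
    proof (intro nn_integral_mono ennreal_leI)
      fix \<omega>
      have "\<bar>?L \<omega>\<bar> \<le> norm (Lvec (N n) (Fn n) (Vec (N n) \<omega>))"
        using component_le_norm_cart[of "Lvec (N n) (Fn n) (Vec (N n) \<omega>)" l] by (simp add: Lvec_def)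
      then have "(?L \<omega>)\<^sup>2 \<le> (norm (Lvec (N n) (Fn n) (Vec (N n) \<omega>)))\<^sup>2"
        by (metis abs_ge_zero power2_abs power_mono)
      then show "(?L \<omega>)\<^sup>2 \<le> norm (Lvec (N n) (Fn n) (Vec (N n) \<omega>)) powr 2" by simp
    qed
    also have "\<dots> \<le> ennreal C2" using C2 by blast
    also have "(\<integral>\<^sup>+\<omega>. ennreal (?y \<omega> ^ (2 * m + 1)) \<partial>Prob (N n)) \<le> ennreal C1" using C1 by blast
    finally show ?thesis
      using K C1(1) C2(1) by (simp add: ennreal_mult' add_mono mult_left_mono)
  qed
  moreover have "0 \<le> 2 * K * C1 + K * C2" using K C1(1) C2(1) by simp
  ultimately show ?thesis by blast
qed

text \<open>After duality \<open>f\<close> appears undifferentiated and is replaced by its bound 1,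
  so one constant serves all \<open>f\<close> and all \<open>n\<close>.\<close>

lemma duality_bound:
  assumes A: "\<And>q::real. q \<ge> 1 \<Longrightarrow> (SUP n. A_norm q (N n) (Fn n)) < \<infinity>" and G: "poly_controlled G"
  shows "\<exists>C\<ge>0. \<forall>n f. f \<in> Cb_infty (Dim (N n)) \<longrightarrow> (\<forall>v\<in>R n. \<bar>f v\<bar> \<le> 1) \<longrightarrow>
     \<bar>\<integral>\<omega>. (\<Sum>i<Dim (N n). Dop (N n) i f (Vec (N n) \<omega>) *
        (G n (Vec (N n) \<omega>) * Dop (N n) i (\<lambda>w. Fn n w $ l) (Vec (N n) \<omega>))) \<partial>Prob (N n)\<bar> \<le> C"
proof -
  obtain C where C: "C \<ge> 0" "\<forall>n. (\<integral>\<^sup>+\<omega>. ennreal \<bar>delta (N n) (\<lambda>i w. G n w * Dop (N n) i (\<lambda>w. Fn n w $ l) w) (Vec (N n) \<omega>)\<bar>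
     \<partial>Prob (N n)) \<le> ennreal C" using delta_L1_bound[OF A G] by blast
  have "\<bar>\<integral>\<omega>. (\<Sum>i<Dim (N n). Dop (N n) i f (Vec (N n) \<omega>) *
        (G n (Vec (N n) \<omega>) * Dop (N n) i (\<lambda>w. Fn n w $ l) (Vec (N n) \<omega>))) \<partial>Prob (N n)\<bar> \<le> C"
    if f: "f \<in> Cb_infty (Dim (N n))" "\<forall>v\<in>R n. \<bar>f v\<bar> \<le> 1" for n f
  proof -
    interpret noise_vector "N n" by (rule noise)
    have "(\<lambda>w. G n w * Dop (N n) i (\<lambda>w. Fn n w $ l) w) \<in> Cpol_infty (Dim (N n))" if "i < Dim (N n)" for i
      using that G by (intro Cb_subset_Cpol Cb_mult Dop_Cb noise Fn_Cb) (auto simp: poly_controlled_def)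
    then show ?thesis
      using C f Vec_RJ by (subst duality) (auto intro!: abs_integral_mult_le Cb_subset_Cpol)
  qed
  with C(1) show ?thesis by blast
qed

end

section \<open>The weight built from the determinant and the cofactors\<close>

context functional_seq
begin

definition sigma_det :: "nat \<Rightarrow> (nat \<Rightarrow> real) \<Rightarrow> real" where
  "sigma_det n v = det (malliavin_matrix (N n) (Fn n) v)"

text \<open>The cofactor at position (k, l), encoded by a substituted row so that the matrix keeps
  its type and no minor of smaller size occurs.\<close>

definition sigma_cofactor :: "'d \<Rightarrow> 'd \<Rightarrow> nat \<Rightarrow> (nat \<Rightarrow> real) \<Rightarrow> real" where
  "sigma_cofactor k l n v = det (\<chi> a. if a = k then axis l 1 else malliavin_matrix (N n) (Fn n) v $ a)"

text \<open>
  A smooth substitute for \<open>1 / \<Delta>\<close>, which makes a cut-off near \<open>\<Delta> = 0\<close> unnecessary.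
\<close>

definition reg_inverse :: "real \<Rightarrow> nat \<Rightarrow> (nat \<Rightarrow> real) \<Rightarrow> real" where
  "reg_inverse c n v = sigma_det n v * (1 / (c + (sigma_det n v)\<^sup>2))"

definition ibp_weight :: "real \<Rightarrow> nat \<Rightarrow> (nat \<Rightarrow> real) \<Rightarrow> real" where
  "ibp_weight c n v = sigma_det n v * reg_inverse c n v"

lemma poly_controlled_sigma_det: "poly_controlled sigma_det"
  unfolding sigma_det_def[abs_def] by (intro poly_controlled_det poly_controlled_malliavin_matrix)

lemma poly_controlled_sigma_cofactor: "poly_controlled (sigma_cofactor k l)"
  unfolding sigma_cofactor_def[abs_def]
proof (rule poly_controlled_det)
  fix a b
  have "poly_controlled (\<lambda>n v. if a = k then axis l 1 $ b else malliavin_matrix (N n) (Fn n) v $ a $ b)"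
    by (cases "a = k") (simp_all add: poly_controlled_const poly_controlled_malliavin_matrix)
  then show "poly_controlled (\<lambda>n v. (\<chi> a. if a = k then axis l 1 else malliavin_matrix (N n) (Fn n) v $ a) $ a $ b)"
    by (simp add: if_distrib[of "\<lambda>x. x $ b"])
qed

lemma poly_controlled_reg_inverse: "c > 0 \<Longrightarrow> poly_controlled (reg_inverse c)"
  unfolding reg_inverse_def[abs_def] by (intro poly_controlled_mult poly_controlled_inv poly_controlled_sigma_det)

lemma ibp_weight_Cb: "c > 0 \<Longrightarrow> ibp_weight c n \<in> Cb_infty (Dim (N n))"
  unfolding ibp_weight_def[abs_def] by (intro Cb_mult poly_controlled_Cb poly_controlled_sigma_det poly_controlled_reg_inverse)

lemma ibp_weight_eq: "ibp_weight c n v = (sigma_det n v)\<^sup>2 / (c + (sigma_det n v)\<^sup>2)"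
  by (simp add: ibp_weight_def reg_inverse_def power2_eq_square)

lemma ibp_weight_bounds:
  assumes "c > 0" shows "0 \<le> ibp_weight c n v" "ibp_weight c n v \<le> 1"
  using one_plus_square_pos[OF assms, of "sigma_det n v"] assms unfolding ibp_weight_eq by simp_all

lemma one_minus_ibp_weight_le:
  assumes "c > 0" "d > 0" "d < sigma_det n v"
  shows "1 - ibp_weight c n v \<le> c / d\<^sup>2"
proof -
  have p: "0 < c + (sigma_det n v)\<^sup>2" using assms(1) by (rule one_plus_square_pos)
  have "1 - ibp_weight c n v = c / (c + (sigma_det n v)\<^sup>2)"
    using p unfolding ibp_weight_eq by (simp add: field_simps)
  also have "\<dots> \<le> c / d\<^sup>2"
  proof (rule divide_left_mono)
    have "d\<^sup>2 \<le> (sigma_det n v)\<^sup>2" using assms by (intro power_mono) auto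
    then show "d\<^sup>2 \<le> c + (sigma_det n v)\<^sup>2" using assms(1) by simp
  qed (use assms p in auto)
  finally show ?thesis .
qed

lemma weighted_partial_derivative:
  assumes v: "v \<in> R n" and f: "(f has_derivative f') (at (Fn n v))"
  shows "(\<Sum>l\<in>UNIV. \<Sum>i<Dim (N n). Dop (N n) i (\<lambda>w. f (Fn n w)) v *
      (reg_inverse c n v * sigma_cofactor k l n v * Dop (N n) i (\<lambda>w. Fn n w $ l) v))
    = f' (axis k 1) * ibp_weight c n v"
proof -
  let ?D = "\<lambda>i j. Dop (N n) i (\<lambda>w. Fn n w $ j) v" and ?M = "malliavin_matrix (N n) (Fn n) v"
    and ?t = "reg_inverse c n v"
  have D: "Dop (N n) i (\<lambda>w. f (Fn n w)) v = (\<Sum>m\<in>UNIV. f' (axis m 1) * ?D i m)" if "i < Dim (N n)" for i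
    unfolding Dop_def DERIV_compose_Cb[OF Fn_Cb that v f] by (simp add: sum_distrib_left mult_ac)
  have "(\<Sum>l\<in>UNIV. \<Sum>i<Dim (N n). Dop (N n) i (\<lambda>w. f (Fn n w)) v * (?t * sigma_cofactor k l n v * ?D i l))
      = (\<Sum>l\<in>UNIV. \<Sum>i<Dim (N n). \<Sum>m\<in>UNIV. f' (axis m 1) * ?t * (?D i m * ?D i l * sigma_cofactor k l n v))"
    by (intro sum.cong refl) (simp add: D sum_distrib_left sum_distrib_right mult_ac)
  \<comment> \<open>The noise index is moved innermost, where the sum over \<open>i\<close>
    collapses to the entry (m, l) of the Malliavin matrix; the cofactor expansion then leaves only m
    = k.\<close>
  also have "\<dots> = (\<Sum>l\<in>UNIV. \<Sum>m\<in>UNIV. \<Sum>i<Dim (N n). f' (axis m 1) * ?t * (?D i m * ?D i l * sigma_cofactor k l n v))"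
    by (intro sum.cong refl sum.swap)
  also have "\<dots> = (\<Sum>m\<in>UNIV. \<Sum>l\<in>UNIV. \<Sum>i<Dim (N n). f' (axis m 1) * ?t * (?D i m * ?D i l * sigma_cofactor k l n v))"
    by (rule sum.swap)
  also have "\<dots> = (\<Sum>m\<in>UNIV. f' (axis m 1) * ?t * (\<Sum>l\<in>UNIV. ?M $ m $ l * sigma_cofactor k l n v))"
    by (simp add: malliavin_matrix_def sum_distrib_left sum_distrib_right)
  also have "\<dots> = (\<Sum>m\<in>UNIV. f' (axis m 1) * ?t * (if m = k then sigma_det n v else 0))"
    unfolding sigma_cofactor_def sigma_det_def cofactor_row_expansion ..
  also have "\<dots> = f' (axis k 1) * ?t * sigma_det n v"
    by (simp add: if_distrib cong: if_cong)
  finally show ?thesis by (simp add: ibp_weight_def mult_ac)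
qed

text \<open>Each \<open>l\<close> contributes one process, a controlled functional times the
  gradient of the l-th component, to which \<open>duality_bound\<close> applies. The constant is the
  sum over \<open>l\<close> and depends on \<open>c\<close> and \<open>k\<close> but not on
  \<open>f\<close> or \<open>n\<close>.\<close>

lemma weighted_partial_derivative_bound:
  assumes A: "\<And>q::real. q \<ge> 1 \<Longrightarrow> (SUP n. A_norm q (N n) (Fn n)) < \<infinity>" and c: "c > 0"
  shows "\<exists>C\<ge>0. \<forall>n f f'. f \<in> arctan_algebra \<longrightarrow> (\<forall>x. \<bar>f x\<bar> \<le> 1) \<longrightarrow> (\<forall>x. (f has_derivative f' x) (at x)) \<longrightarrow>
     \<bar>\<integral>\<omega>. f' (Fn n (Vec (N n) \<omega>)) (axis k 1) * ibp_weight c n (Vec (N n) \<omega>) \<partial>Prob (N n)\<bar> \<le> C"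
proof -
  let ?G = "\<lambda>l n v. reg_inverse c n v * sigma_cofactor k l n v"
  have G: "poly_controlled (?G l)" for l
    by (intro poly_controlled_mult poly_controlled_sigma_cofactor poly_controlled_reg_inverse c)
  let ?I = "\<lambda>l n f \<omega>. \<Sum>i<Dim (N n). Dop (N n) i (\<lambda>w. f (Fn n w)) (Vec (N n) \<omega>) *
        (?G l n (Vec (N n) \<omega>) * Dop (N n) i (\<lambda>w. Fn n w $ l) (Vec (N n) \<omega>))"
  have "\<forall>l. \<exists>C\<ge>0. \<forall>n f. f \<in> Cb_infty (Dim (N n)) \<longrightarrow> (\<forall>v\<in>R n. \<bar>f v\<bar> \<le> 1) \<longrightarrow>
     \<bar>\<integral>\<omega>. (\<Sum>i<Dim (N n). Dop (N n) i f (Vec (N n) \<omega>) *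
        (?G l n (Vec (N n) \<omega>) * Dop (N n) i (\<lambda>w. Fn n w $ l) (Vec (N n) \<omega>))) \<partial>Prob (N n)\<bar> \<le> C"
    by (intro allI duality_bound A G)
  then obtain C where C: "\<forall>l. C l \<ge> 0 \<and> (\<forall>n f. f \<in> Cb_infty (Dim (N n)) \<longrightarrow> (\<forall>v\<in>R n. \<bar>f v\<bar> \<le> 1) \<longrightarrow>
     \<bar>\<integral>\<omega>. (\<Sum>i<Dim (N n). Dop (N n) i f (Vec (N n) \<omega>) *
        (?G l n (Vec (N n) \<omega>) * Dop (N n) i (\<lambda>w. Fn n w $ l) (Vec (N n) \<omega>))) \<partial>Prob (N n)\<bar> \<le> C l)"
    by (subst (asm) choice_iff) blast
  have "\<bar>\<integral>\<omega>. f' (Fn n (Vec (N n) \<omega>)) (axis k 1) * ibp_weight c n (Vec (N n) \<omega>) \<partial>Prob (N n)\<bar> \<le> (\<Sum>l\<in>UNIV. C l)"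
    if f: "f \<in> arctan_algebra" "\<forall>x. \<bar>f x\<bar> \<le> 1" "\<forall>x. (f has_derivative f' x) (at x)" for n f f'
  proof -
    interpret noise_vector "N n" by (rule noise)
    have fF: "(\<lambda>w. f (Fn n w)) \<in> Cb_infty (Dim (N n))"
      by (rule arctan_algebra_compose_Cb[OF f(1) Fn_Cb])
    have GC: "?G l n \<in> Cb_infty (Dim (N n))" for l
      using poly_controlled_Cb[OF G] .
    have int: "integrable (Prob (N n)) (?I l n f)" for l
    proof (rule Cb_Vec_integrable)
      show "(\<lambda>v. \<Sum>i<Dim (N n). Dop (N n) i (\<lambda>w. f (Fn n w)) v *
          (?G l n v * Dop (N n) i (\<lambda>w. Fn n w $ l) v)) \<in> Cb_infty (Dim (N n))"
        by (intro Cb_sum Cb_mult[OF Dop_Cb Cb_mult[OF GC Dop_Cb]] noise fF Fn_Cb) auto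
    qed
    have e1: "(\<integral>\<omega>. f' (Fn n (Vec (N n) \<omega>)) (axis k 1) * ibp_weight c n (Vec (N n) \<omega>) \<partial>Prob (N n))
        = (\<integral>\<omega>. (\<Sum>l\<in>UNIV. ?I l n f \<omega>) \<partial>Prob (N n))"
      using f(3) by (intro Bochner_Integration.integral_cong refl weighted_partial_derivative[symmetric] Vec_RJ) auto
    have e2: "(\<integral>\<omega>. (\<Sum>l\<in>UNIV. ?I l n f \<omega>) \<partial>Prob (N n)) = (\<Sum>l\<in>UNIV. \<integral>\<omega>. ?I l n f \<omega> \<partial>Prob (N n))"
      by (rule Bochner_Integration.integral_sum[OF int])
    have "\<bar>\<Sum>l\<in>UNIV. \<integral>\<omega>. ?I l n f \<omega> \<partial>Prob (N n)\<bar> \<le> (\<Sum>l\<in>UNIV. \<bar>\<integral>\<omega>. ?I l n f \<omega> \<partial>Prob (N n)\<bar>)"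
      by (rule sum_abs)
    also have "\<dots> \<le> (\<Sum>l\<in>UNIV. C l)"
    proof (rule sum_mono)
      fix l
      have "\<forall>v\<in>R n. \<bar>f (Fn n v)\<bar> \<le> 1" using f(2) by blast
      from C[THEN spec[of _ l], THEN conjunct2, THEN spec[of _ n], THEN spec[of _ "\<lambda>w. f (Fn n w)"],
          THEN mp, OF fF, THEN mp, OF this]
      show "\<bar>\<integral>\<omega>. ?I l n f \<omega> \<partial>Prob (N n)\<bar> \<le> C l" .
    qed
    finally show ?thesis unfolding e1 e2 .
  qed
  moreover have "0 \<le> (\<Sum>l\<in>UNIV. C l)" using C by (intro sum_nonneg) auto
  ultimately show ?thesis by (intro exI[of _ "\<Sum>l\<in>UNIV. C l"]) simp
qed

end

section \<open>Continuity of the laws under translations\<close>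

lemma arctan_algebra_Lipschitz:
  fixes f :: "real ^ 'd \<Rightarrow> real"
  assumes "\<forall>x. (f has_derivative f' x) (at x)" "\<forall>x h. \<bar>f' x h\<bar> \<le> K * norm h"
  shows "\<bar>f x - f y\<bar> \<le> K * norm (x - y)"
proof -
  have "norm (f x - f y) \<le> K * norm (x - y)"
  proof (rule differentiable_bound[of UNIV f f'])
    show "onorm (f' x) \<le> K" for x
      using assms(2) by (intro onorm_le) auto
  qed (use assms(1) in auto)
  then show ?thesis by simp
qed

context functional_seq
begin

abbreviation X :: "nat \<Rightarrow> 'a \<Rightarrow> real ^ 'd" where
  "X n \<omega> \<equiv> Fn n (Vec (N n) \<omega>)"

lemma X_measurable [measurable]: "X n \<in> borel_measurable (Prob (N n))"
proof -
  have "continuous_on (R n) (\<lambda>v. \<chi> j. Fn n v $ j)"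
    by (intro continuous_on_vec_lambda Cb_inftyD(1) Fn_Cb)
  then show ?thesis
    using measurable_compose[OF noise_vector.Vec_measurable[OF noise] borel_measurable_RJ] by simp
qed

lemma ibp_weight_measurable: "c > 0 \<Longrightarrow> (\<lambda>\<omega>. ibp_weight c n (Vec (N n) \<omega>)) \<in> borel_measurable (Prob (N n))"
  by (intro noise_vector.continuous_Vec_measurable noise Cb_inftyD(1) ibp_weight_Cb)

text \<open>Mean value theorem for the expectation of \<open>f\<close> along the segment from X to X
  + h, with the weight kept fixed. At an intermediate point the derivative is the weighted
  derivative of a translate of \<open>f\<close>, and the uniform bound applies because translates
  stay in the algebra.\<close>

lemma weighted_translation_bound:
  assumes A: "\<And>q::real. q \<ge> 1 \<Longrightarrow> (SUP n. A_norm q (N n) (Fn n)) < \<infinity>" and c: "c > 0"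
  shows "\<exists>C\<ge>0. \<forall>n f h. f \<in> arctan_algebra \<longrightarrow> (\<forall>x. \<bar>f x\<bar> \<le> 1) \<longrightarrow>
     \<bar>\<integral>\<omega>. (f (X n \<omega> + h) - f (X n \<omega>)) * ibp_weight c n (Vec (N n) \<omega>) \<partial>Prob (N n)\<bar> \<le> C * norm h"
proof -
  have "\<forall>k. \<exists>C\<ge>0. \<forall>n f f'. f \<in> arctan_algebra \<longrightarrow> (\<forall>x. \<bar>f x\<bar> \<le> 1) \<longrightarrow> (\<forall>x. (f has_derivative f' x) (at x)) \<longrightarrow>
     \<bar>\<integral>\<omega>. f' (X n \<omega>) (axis k 1) * ibp_weight c n (Vec (N n) \<omega>) \<partial>Prob (N n)\<bar> \<le> C"
    by (intro allI weighted_partial_derivative_bound A c)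
  then obtain C where C: "\<forall>k. C k \<ge> 0 \<and> (\<forall>n f f'. f \<in> arctan_algebra \<longrightarrow> (\<forall>x. \<bar>f x\<bar> \<le> 1) \<longrightarrow> (\<forall>x. (f has_derivative f' x) (at x)) \<longrightarrow>
     \<bar>\<integral>\<omega>. f' (X n \<omega>) (axis k 1) * ibp_weight c n (Vec (N n) \<omega>) \<partial>Prob (N n)\<bar> \<le> C k)"
    by (subst (asm) choice_iff) blast
  have "\<bar>\<integral>\<omega>. (f (X n \<omega> + h) - f (X n \<omega>)) * ibp_weight c n (Vec (N n) \<omega>) \<partial>Prob (N n)\<bar> \<le> (\<Sum>k\<in>UNIV. C k) * norm h"
    if f: "f \<in> arctan_algebra" "\<forall>x. \<bar>f x\<bar> \<le> 1" for n f h
  proof -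
    interpret noise_vector "N n" by (rule noise)
    from arctan_algebra_C1[OF f(1)] obtain f' K where d: "\<forall>x. (f has_derivative f' x) (at x)"
      "\<forall>h. continuous_on UNIV (\<lambda>x. f' x h)" "\<forall>x h. \<bar>f' x h\<bar> \<le> K * norm h"
      by (elim exE conjE)
    have lin: "linear (f' x)" for x
      using d(1) by (blast intro: has_derivative_bounded_linear bounded_linear.linear)
    let ?w = "\<lambda>\<omega>. ibp_weight c n (Vec (N n) \<omega>)"
    note [measurable] = ibp_weight_measurable[OF c, of n] arctan_algebra_measurable[OF f(1)]
    have f'm [measurable]: "(\<lambda>x. f' x h) \<in> borel_measurable borel" for h
      using d(2) by (intro borel_measurable_continuous_onI) auto
    have w: "\<bar>?w \<omega>\<bar> \<le> 1" for \<omega> using ibp_weight_bounds[OF c, of n "Vec (N n) \<omega>"] by simp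
    have ib: "integrable (Prob (N n)) (\<lambda>\<omega>. g \<omega> * ?w \<omega>)"
      if g: "\<exists>B. \<forall>\<omega>. \<bar>g \<omega>\<bar> \<le> B" and [measurable]: "g \<in> borel_measurable (Prob (N n))" for g
    proof -
      obtain B where B: "\<And>\<omega>. \<bar>g \<omega>\<bar> \<le> B" using g by blast
      have "\<bar>g \<omega> * ?w \<omega>\<bar> \<le> B" for \<omega>
        using mult_mono'[OF B w] by (simp add: abs_mult)
      then show ?thesis by (intro integrable_const_bound[of _ B]) auto
    qed
    have fi: "integrable (Prob (N n)) (\<lambda>\<omega>. f (X n \<omega> + y) * ?w \<omega>)" for y
      using f(2) by (intro ib) auto
    define \<phi> where "\<phi> t = (\<integral>\<omega>. f (X n \<omega> + t *\<^sub>R h) * ?w \<omega> \<partial>Prob (N n))" for t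
    define \<psi> where "\<psi> t = (\<integral>\<omega>. f' (X n \<omega> + t *\<^sub>R h) h * ?w \<omega> \<partial>Prob (N n))" for t
    have D: "(\<phi> has_real_derivative \<psi> t) (at t)" for t
    proof -
      have "((\<lambda>s. (\<phi> (t + s) - \<phi> t) / s) \<longlongrightarrow> \<psi> t) (at 0)"
        unfolding tendsto_at_iff_sequentially comp_def
      proof (intro allI impI)
        fix S :: "nat \<Rightarrow> real" assume S: "\<forall>i. S i \<in> UNIV - {0}" "S \<longlonglongrightarrow> 0"
        have "(\<lambda>i. \<integral>\<omega>. (f (X n \<omega> + (t + S i) *\<^sub>R h) - f (X n \<omega> + t *\<^sub>R h)) / S i * ?w \<omega> \<partial>Prob (N n)) \<longlonglongrightarrow> \<psi> t"
          unfolding \<psi>_def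
        \<comment> \<open>The dominating constant \<open>K\<close> depends on \<open>f\<close>. It
          only justifies differentiation under the expectation and does not enter the final
          estimate.\<close>
        proof (rule integral_dominated_convergence[where w="\<lambda>_. K * norm h"])
          have "(\<lambda>i. (f (x + (t + S i) *\<^sub>R h) - f (x + t *\<^sub>R h)) / S i) \<longlonglongrightarrow> f' (x + t *\<^sub>R h) h" for x
          proof -
            have "((\<lambda>s. f (x + s *\<^sub>R h)) has_derivative (\<lambda>s. f' (x + t *\<^sub>R h) (s *\<^sub>R h))) (at t)"
              by (rule has_derivative_compose[of "\<lambda>s. x + s *\<^sub>R h" _ _ _ f])
                (use d(1) in \<open>auto intro!: derivative_eq_intros\<close>)
            then have "((\<lambda>s. f (x + s *\<^sub>R h)) has_real_derivative f' (x + t *\<^sub>R h) h) (at t)"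
              by (simp add: has_field_derivative_def linear_scale[OF lin] mult.commute[of _ "f' _ _"])
            then have "((\<lambda>s. (f (x + (t + s) *\<^sub>R h) - f (x + t *\<^sub>R h)) / s) \<longlongrightarrow> f' (x + t *\<^sub>R h) h) (at 0)"
              by (simp add: DERIV_def)
            then show ?thesis using S unfolding tendsto_at_iff_sequentially comp_def by blast
          qed
          then show "AE \<omega> in Prob (N n). (\<lambda>i. (f (X n \<omega> + (t + S i) *\<^sub>R h) - f (X n \<omega> + t *\<^sub>R h)) / S i * ?w \<omega>)
              \<longlonglongrightarrow> f' (X n \<omega> + t *\<^sub>R h) h * ?w \<omega>"
            by (intro AE_I2 tendsto_mult tendsto_const)
          fix i
          have "\<bar>(f (x + (t + S i) *\<^sub>R h) - f (x + t *\<^sub>R h)) / S i\<bar> \<le> K * norm h" for x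
          proof -
            have "\<bar>f (x + (t + S i) *\<^sub>R h) - f (x + t *\<^sub>R h)\<bar> \<le> K * norm ((x + (t + S i) *\<^sub>R h) - (x + t *\<^sub>R h))"
              by (rule arctan_algebra_Lipschitz[OF d(1,3)])
            also have "\<dots> = (K * norm h) * \<bar>S i\<bar>"
              by (simp add: scaleR_left_distrib)
            finally show ?thesis using S(1) by (simp add: abs_divide divide_le_eq)
          qed
          then show "AE \<omega> in Prob (N n). norm ((f (X n \<omega> + (t + S i) *\<^sub>R h) - f (X n \<omega> + t *\<^sub>R h)) / S i * ?w \<omega>) \<le> K * norm h"
            unfolding real_norm_def abs_mult using mult_mono'[OF _ w] by (intro AE_I2) fastforce
        qed measurable
        also have "(\<lambda>i. \<integral>\<omega>. (f (X n \<omega> + (t + S i) *\<^sub>R h) - f (X n \<omega> + t *\<^sub>R h)) / S i * ?w \<omega> \<partial>Prob (N n))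
            = (\<lambda>i. (\<phi> (t + S i) - \<phi> t) / S i)"
          unfolding \<phi>_def using fi by (subst Bochner_Integration.integral_diff[symmetric]) 
            (auto simp: left_diff_distrib diff_divide_distrib)
        finally show "(\<lambda>i. (\<phi> (t + S i) - \<phi> t) / S i) \<longlonglongrightarrow> \<psi> t" .
      qed
      then show ?thesis
        by (simp add: DERIV_def)
    qed
    have B: "\<bar>\<psi> t\<bar> \<le> (\<Sum>k\<in>UNIV. C k) * norm h" for t
    proof -
      have hexp: "h = (\<Sum>k\<in>UNIV. h $ k *\<^sub>R axis k 1)"
        by (simp add: vec_eq_iff axis_def if_distrib cong: if_cong)
      have "f' x h = (\<Sum>k\<in>UNIV. h $ k * f' x (axis k 1))" for x
        by (subst hexp) (simp add: linear_sum[OF lin] linear_scale[OF lin] comp_def)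
      then have e1: "\<psi> t = (\<integral>\<omega>. (\<Sum>k\<in>UNIV. h $ k * (f' (X n \<omega> + t *\<^sub>R h) (axis k 1) * ?w \<omega>)) \<partial>Prob (N n))"
        unfolding \<psi>_def by (simp add: sum_distrib_right mult.assoc)
      have e2: "(\<integral>\<omega>. (\<Sum>k\<in>UNIV. h $ k * (f' (X n \<omega> + t *\<^sub>R h) (axis k 1) * ?w \<omega>)) \<partial>Prob (N n))
          = (\<Sum>k\<in>UNIV. \<integral>\<omega>. h $ k * (f' (X n \<omega> + t *\<^sub>R h) (axis k 1) * ?w \<omega>) \<partial>Prob (N n))"
        using d(3) by (intro Bochner_Integration.integral_sum integrable_mult_right ib) auto
      have e3: "\<psi> t = (\<Sum>k\<in>UNIV. h $ k * (\<integral>\<omega>. f' (X n \<omega> + t *\<^sub>R h) (axis k 1) * ?w \<omega> \<partial>Prob (N n)))"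
        unfolding e1 e2 by simp
      have "\<bar>\<Sum>k\<in>UNIV. h $ k * (\<integral>\<omega>. f' (X n \<omega> + t *\<^sub>R h) (axis k 1) * ?w \<omega> \<partial>Prob (N n))\<bar> \<le> (\<Sum>k\<in>UNIV. norm h * C k)"
      proof (rule order_trans[OF sum_abs sum_mono])
        fix k
        have "\<forall>x. ((\<lambda>x. f (x + t *\<^sub>R h)) has_derivative f' (x + t *\<^sub>R h)) (at x)"
        proof
          fix x
          show "((\<lambda>x. f (x + t *\<^sub>R h)) has_derivative f' (x + t *\<^sub>R h)) (at x)"
            by (rule has_derivative_compose[of "\<lambda>x. x + t *\<^sub>R h" "\<lambda>x. x" _ _ f, simplified])
              (use d(1) in \<open>auto intro!: derivative_eq_intros\<close>)
        qed
        then have "\<bar>\<integral>\<omega>. f' (X n \<omega> + t *\<^sub>R h) (axis k 1) * ?w \<omega> \<partial>Prob (N n)\<bar> \<le> C k"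
          using C[THEN spec, THEN conjunct2, rule_format, of "\<lambda>x. f (x + t *\<^sub>R h)" "\<lambda>x. f' (x + t *\<^sub>R h)" n k]
            arctan_algebra_translate[OF f(1)] f(2) by simp
        then show "\<bar>h $ k * (\<integral>\<omega>. f' (X n \<omega> + t *\<^sub>R h) (axis k 1) * ?w \<omega> \<partial>Prob (N n))\<bar> \<le> norm h * C k"
          unfolding abs_mult by (intro mult_mono' component_le_norm_cart) auto
      qed
      then show ?thesis unfolding e3 by (simp add: sum_distrib_left mult.commute)
    qed
    have "\<exists>z::real. z > 0 \<and> z < 1 \<and> \<phi> 1 - \<phi> 0 = (1 - 0) * \<psi> z"
      by (rule MVT2) (use D in auto)
    then have "\<bar>\<phi> 1 - \<phi> 0\<bar> \<le> (\<Sum>k\<in>UNIV. C k) * norm h"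
      using B by auto
    moreover have "\<phi> 1 - \<phi> 0 = (\<integral>\<omega>. (f (X n \<omega> + h) - f (X n \<omega>)) * ?w \<omega> \<partial>Prob (N n))"
      unfolding \<phi>_def using fi[of h] fi[of 0] by (simp add: left_diff_distrib)
    ultimately show ?thesis by simp
  qed
  moreover have "0 \<le> (\<Sum>k\<in>UNIV. C k)" using C by (intro sum_nonneg) auto
  ultimately show ?thesis by blast
qed

text \<open>On the event that the determinant is at most \<open>d\<close> the integrand is bounded
  by 1, elsewhere by the second summand.\<close>

lemma expectation_one_minus_ibp_weight:
  assumes "c > 0" "d > 0"
  shows "(\<integral>\<omega>. 1 - ibp_weight c n (Vec (N n) \<omega>) \<partial>Prob (N n))
     \<le> measure (Prob (N n)) {\<omega> \<in> space (Prob (N n)). sigma_det n (Vec (N n) \<omega>) \<le> d} + c / d\<^sup>2"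
proof -
  interpret noise_vector "N n" by (rule noise)
  have [measurable]: "(\<lambda>\<omega>. sigma_det n (Vec (N n) \<omega>)) \<in> borel_measurable (Prob (N n))"
    using poly_controlled_sigma_det by (intro continuous_Vec_measurable Cb_inftyD(1)) (auto simp: poly_controlled_def)
  let ?S = "{\<omega> \<in> space (Prob (N n)). sigma_det n (Vec (N n) \<omega>) \<le> d}"
  have "(\<integral>\<omega>. 1 - ibp_weight c n (Vec (N n) \<omega>) \<partial>Prob (N n)) \<le> (\<integral>\<omega>. indicator ?S \<omega> + c / d\<^sup>2 \<partial>Prob (N n))"
  proof (rule integral_mono)
    show "integrable (Prob (N n)) (\<lambda>\<omega>. 1 - ibp_weight c n (Vec (N n) \<omega>))"
      by (intro Bochner_Integration.integrable_diff integrable_const Cb_Vec_integrable ibp_weight_Cb assms)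
    show "integrable (Prob (N n)) (\<lambda>\<omega>. indicator ?S \<omega> + c / d\<^sup>2)"
      by (intro Bochner_Integration.integrable_add integrable_const integrable_real_indicator) 
        (auto simp: emeasure_eq_measure)
    fix \<omega> assume \<omega>: "\<omega> \<in> space (Prob (N n))"
    show "1 - ibp_weight c n (Vec (N n) \<omega>) \<le> indicator ?S \<omega> + c / d\<^sup>2"
    proof (cases "sigma_det n (Vec (N n) \<omega>) \<le> d")
      case True
      then show ?thesis using \<omega> ibp_weight_bounds(1)[OF assms(1), of n "Vec (N n) \<omega>"] assms
        by (simp add: add_increasing2)
    next
      case False
      then show ?thesis using one_minus_ibp_weight_le[OF assms, of n "Vec (N n) \<omega>"] by simp
    qed
  qed
  also have "\<dots> = measure (Prob (N n)) ?S + c / d\<^sup>2"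
    by (subst Bochner_Integration.integral_add) (auto simp: emeasure_eq_measure prob_space)
  finally show ?thesis .
qed

text \<open>The increment of \<open>f\<close> is split by 1 = w + (1 - w). The factor 2 is the
  largest possible increment of a function bounded by 1.\<close>

lemma translation_bound:
  assumes c: "c > 0" and d: "d > 0" and f: "f \<in> arctan_algebra" "\<forall>x. \<bar>f x\<bar> \<le> 1"
    and C: "\<bar>\<integral>\<omega>. (f (X n \<omega> + h) - f (X n \<omega>)) * ibp_weight c n (Vec (N n) \<omega>) \<partial>Prob (N n)\<bar> \<le> B"
  shows "\<bar>(\<integral>\<omega>. f (X n \<omega> + h) \<partial>Prob (N n)) - (\<integral>\<omega>. f (X n \<omega>) \<partial>Prob (N n))\<bar>
    \<le> B + 2 * (measure (Prob (N n)) {\<omega> \<in> space (Prob (N n)). sigma_det n (Vec (N n) \<omega>) \<le> d} + c / d\<^sup>2)"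
proof -
  interpret noise_vector "N n" by (rule noise)
  let ?w = "\<lambda>\<omega>. ibp_weight c n (Vec (N n) \<omega>)" and ?g = "\<lambda>\<omega>. f (X n \<omega> + h) - f (X n \<omega>)"
  note [measurable] = ibp_weight_measurable[OF c, of n] arctan_algebra_measurable[OF f(1)]
  have w: "0 \<le> ?w \<omega>" "?w \<omega> \<le> 1" for \<omega> using ibp_weight_bounds[OF c] by auto
  have g: "\<bar>?g \<omega>\<bar> \<le> 2" for \<omega>
    using f(2)[THEN spec, of "X n \<omega> + h"] f(2)[THEN spec, of "X n \<omega>"] by linarith
  have fi: "integrable (Prob (N n)) (\<lambda>\<omega>. f (X n \<omega> + y))" for y
    using f(2) by (intro integrable_const_bound[of _ 1]) auto
  have gi: "integrable (Prob (N n)) ?g"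
    using fi[of h] fi[of 0] by simp
  have gwi: "integrable (Prob (N n)) (\<lambda>\<omega>. ?g \<omega> * ?w \<omega>)"
  proof (rule integrable_const_bound[of _ 2])
    show "AE \<omega> in Prob (N n). norm (?g \<omega> * ?w \<omega>) \<le> 2"
      using g w mult_mono'[of "\<bar>?g _\<bar>" 2 "\<bar>?w _\<bar>" 1] by (intro AE_I2) (simp add: abs_mult)
  qed measurable
  have wi: "integrable (Prob (N n)) (\<lambda>\<omega>. 1 - ?w \<omega>)"
    by (intro Bochner_Integration.integrable_diff integrable_const Cb_Vec_integrable ibp_weight_Cb c)
  have "(\<integral>\<omega>. f (X n \<omega> + h) \<partial>Prob (N n)) - (\<integral>\<omega>. f (X n \<omega>) \<partial>Prob (N n)) = (\<integral>\<omega>. ?g \<omega> \<partial>Prob (N n))"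
    using fi[of h] fi[of 0] by simp
  also have "\<dots> = (\<integral>\<omega>. ?g \<omega> * ?w \<omega> + ?g \<omega> * (1 - ?w \<omega>) \<partial>Prob (N n))"
    by (simp add: right_diff_distrib)
  also have "\<dots> = (\<integral>\<omega>. ?g \<omega> * ?w \<omega> \<partial>Prob (N n)) + (\<integral>\<omega>. ?g \<omega> * (1 - ?w \<omega>) \<partial>Prob (N n))"
    using gi gwi by (intro Bochner_Integration.integral_add) (auto simp: right_diff_distrib)
  finally have e: "(\<integral>\<omega>. f (X n \<omega> + h) \<partial>Prob (N n)) - (\<integral>\<omega>. f (X n \<omega>) \<partial>Prob (N n))
    = (\<integral>\<omega>. ?g \<omega> * ?w \<omega> \<partial>Prob (N n)) + (\<integral>\<omega>. ?g \<omega> * (1 - ?w \<omega>) \<partial>Prob (N n))" .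
  have "\<bar>\<integral>\<omega>. ?g \<omega> * (1 - ?w \<omega>) \<partial>Prob (N n)\<bar> \<le> (\<integral>\<omega>. \<bar>?g \<omega> * (1 - ?w \<omega>)\<bar> \<partial>Prob (N n))"
    by (rule integral_abs_bound)
  also have "\<dots> \<le> (\<integral>\<omega>. 2 * (1 - ?w \<omega>) \<partial>Prob (N n))"
  proof (rule integral_mono)
    show "integrable (Prob (N n)) (\<lambda>\<omega>. \<bar>?g \<omega> * (1 - ?w \<omega>)\<bar>)"
      using gi gwi by (intro integrable_abs) (auto simp: right_diff_distrib)
    show "\<bar>?g \<omega> * (1 - ?w \<omega>)\<bar> \<le> 2 * (1 - ?w \<omega>)" for \<omega>
      using g[of \<omega>] w[of \<omega>] unfolding abs_mult by (intro mult_mono) auto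
    show "integrable (Prob (N n)) (\<lambda>\<omega>. 2 * (1 - ?w \<omega>))"
      using wi by (rule integrable_mult_right)
  qed
  also have "\<dots> = 2 * (\<integral>\<omega>. 1 - ?w \<omega> \<partial>Prob (N n))" by (rule integral_mult_right_zero)
  also have "\<dots> \<le> 2 * (measure (Prob (N n)) {\<omega> \<in> space (Prob (N n)). sigma_det n (Vec (N n) \<omega>) \<le> d} + c / d\<^sup>2)"
    by (intro mult_left_mono expectation_one_minus_ibp_weight c d) simp
  finally have "\<bar>\<integral>\<omega>. ?g \<omega> * (1 - ?w \<omega>) \<partial>Prob (N n)\<bar>
    \<le> 2 * (measure (Prob (N n)) {\<omega> \<in> space (Prob (N n)). sigma_det n (Vec (N n) \<omega>) \<le> d} + c / d\<^sup>2)" .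
  with C show ?thesis
    unfolding e by (intro order_trans[OF abs_triangle_ineq] add_mono)
qed

lemma eventually_translation_small:
  assumes A: "\<And>q::real. q \<ge> 1 \<Longrightarrow> (SUP n. A_norm q (N n) (Fn n)) < \<infinity>"
    and nondegenerate:
      "((\<lambda>\<epsilon>::real. limsup (\<lambda>n. ereal (measure (Prob (N n))
            {\<omega> \<in> space (Prob (N n)). det (malliavin_matrix (N n) (Fn n) (Vec (N n) \<omega>)) \<le> \<epsilon>})))
        \<longlongrightarrow> 0) (at_right 0)"
    and \<eta>: "\<eta> > 0"
  shows "\<exists>r>0. \<forall>\<^sub>F n in sequentially. \<forall>f\<in>arctan_algebra. (\<forall>x. \<bar>f x\<bar> \<le> 1) \<longrightarrow> (\<forall>h. norm h \<le> r \<longrightarrow>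
    \<bar>(\<integral>\<omega>. f (X n \<omega> + h) \<partial>Prob (N n)) - (\<integral>\<omega>. f (X n \<omega>) \<partial>Prob (N n))\<bar> \<le> \<eta>)"
proof -
  let ?P = "\<lambda>d n. measure (Prob (N n)) {\<omega> \<in> space (Prob (N n)). sigma_det n (Vec (N n) \<omega>) \<le> d}"
  have "\<forall>\<^sub>F d in at_right 0. limsup (\<lambda>n. ereal (?P d n)) < ereal (\<eta> / 8)"
    using order_tendstoD(2)[OF nondegenerate, of "ereal (\<eta> / 8)"] \<eta> by (simp add: sigma_det_def)
  then have "\<forall>\<^sub>F d in at_right 0. 0 < d \<and> limsup (\<lambda>n. ereal (?P d n)) < ereal (\<eta> / 8)"
    using eventually_at_right_less[of 0] by (rule eventually_conj[rotated])
  then obtain d where d: "0 < d" "limsup (\<lambda>n. ereal (?P d n)) < ereal (\<eta> / 8)"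
    using eventually_happens'[OF trivial_limit_at_right_real] by blast
  have ev: "\<forall>\<^sub>F n in sequentially. ?P d n < \<eta> / 8"
    using Limsup_lessD[OF d(2)] by simp
  \<comment> \<open>With this \<open>c\<close> and a degeneracy probability below \<eta> / 8, the
    part carried by 1 - w costs at most 2 (\<eta> / 8 + \<eta> / 8) = \<eta> / 2. The other half is
    left for \<open>C * norm h\<close>.\<close>
  define c where "c = d\<^sup>2 * (\<eta> / 8)"
  have c: "c > 0" "c / d\<^sup>2 = \<eta> / 8" using d \<eta> by (auto simp: c_def)
  obtain C where C: "C \<ge> 0" "\<forall>n f h. f \<in> arctan_algebra \<longrightarrow> (\<forall>x. \<bar>f x\<bar> \<le> 1) \<longrightarrow>
     \<bar>\<integral>\<omega>. (f (X n \<omega> + h) - f (X n \<omega>)) * ibp_weight c n (Vec (N n) \<omega>) \<partial>Prob (N n)\<bar> \<le> C * norm h"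
    using weighted_translation_bound[OF A c(1)] by blast
  \<comment> \<open>\<open>C + 1\<close> guards against division by zero, as \<open>C\<close> may
    vanish.\<close>
  define r where "r = \<eta> / (2 * (C + 1))"
  have r: "r > 0" using C(1) \<eta> by (simp add: r_def)
  have Cr: "C * s \<le> \<eta> / 2" if "0 \<le> s" "s \<le> r" for s
  proof -
    have "C * s \<le> (C + 1) * r" using that C(1) by (intro mult_mono) auto
    also have "\<dots> = \<eta> / 2" using C(1) by (simp add: r_def field_simps)
    finally show ?thesis .
  qed
  show ?thesis
  proof (intro exI conjI, rule r, rule eventually_mono[OF ev], intro ballI impI allI)
    fix n and f :: "real ^ 'd \<Rightarrow> real" and h :: "real ^ 'd"
    assume "?P d n < \<eta> / 8" and f: "f \<in> arctan_algebra" "\<forall>x. \<bar>f x\<bar> \<le> 1" and h: "norm h \<le> r"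
    then show "\<bar>(\<integral>\<omega>. f (X n \<omega> + h) \<partial>Prob (N n)) - (\<integral>\<omega>. f (X n \<omega>) \<partial>Prob (N n))\<bar> \<le> \<eta>"
      using translation_bound[OF c(1) d(1) f, of n h "C * norm h"] C(2) f Cr[of "norm h"] c(2) by simp
  qed
qed

end

section \<open>Mollification\<close>

text \<open>A normalised tent function; continuity is all that the mollification uses. Its integral
  is positive because the tent is at least r / 2 on the ball of radius r / 2.\<close>

lemma ex_mollifier:
  assumes r: "r > 0"
  obtains \<phi> :: "real ^ 'd \<Rightarrow> real" and B where "continuous_on UNIV \<phi>" "\<And>y. 0 \<le> \<phi> y"
    "\<And>y. \<phi> y \<le> B" "\<And>y. norm y > r \<Longrightarrow> \<phi> y = 0" "integrable lborel \<phi>" "(\<integral>y. \<phi> y \<partial>lborel) = 1"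
proof -
  define g where "g y = max 0 (r - norm y)" for y :: "real ^ 'd"
  define Z where "Z = (\<integral>y. g y \<partial>lborel)"
  have gc: "continuous_on UNIV g" unfolding g_def by (intro continuous_intros)
  have gm: "g \<in> borel_measurable borel" using gc by (rule borel_measurable_continuous_onI)
  have g0: "0 \<le> g y" "g y \<le> r" for y using r by (auto simp: g_def)
  have ind: "integrable lborel (\<lambda>y :: real ^ 'd. c * indicator (cball 0 s) y)" for c s :: real
    using emeasure_lborel_cball_finite[of "0 :: real ^ 'd" s]
    by (intro integrable_mult_right integrable_real_indicator) (auto simp: less_top)
  have gi: "integrable lborel g"
    by (rule Bochner_Integration.integrable_bound[OF ind[of r r]])
      (use gm g0 r in \<open>auto simp: g_def indicator_def\<close>)
  have "0 < r / 2 * measure lborel (cball (0 :: real ^ 'd) (r / 2))"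
    using r by (intro mult_pos_pos content_cball_pos) auto
  also have "\<dots> = (\<integral>y. r / 2 * indicator (cball (0 :: real ^ 'd) (r / 2)) y \<partial>lborel)"
    by simp
  also have "\<dots> \<le> Z"
    unfolding Z_def using r by (intro integral_mono ind gi) (auto simp: g_def indicator_def)
  finally have Z: "Z > 0" .
  show thesis
  proof
    show "continuous_on UNIV (\<lambda>y. g y / Z)" using gc Z by (intro continuous_intros) auto
    show "0 \<le> g y / Z" for y using g0 Z by simp
    show "g y / Z \<le> r / Z" for y using g0 Z by (simp add: divide_right_mono)
    show "norm y > r \<Longrightarrow> g y / Z = 0" for y by (simp add: g_def)
    show "integrable lborel (\<lambda>y. g y / Z)" using gi by simp
    show "(\<integral>y. g y / Z \<partial>lborel) = 1" using Z by (simp add: Z_def)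
  qed
qed

lemma lborel_integral_translate:
  fixes g :: "'e :: euclidean_space \<Rightarrow> real"
  assumes [measurable]: "g \<in> borel_measurable borel"
  shows "(\<integral>y. g y \<partial>lborel) = (\<integral>y. g (c + y) \<partial>lborel)"
    and "integrable lborel g \<longleftrightarrow> integrable lborel (\<lambda>y. g (c + y))"
proof -
  have "(\<integral>y. g y \<partial>lborel) = (\<integral>y. g y \<partial>distr lborel borel ((+) c))"
    by (simp add: lborel_distr_plus)
  also have "\<dots> = (\<integral>y. g (c + y) \<partial>lborel)"
    by (rule integral_distr) auto
  finally show "(\<integral>y. g y \<partial>lborel) = (\<integral>y. g (c + y) \<partial>lborel)" .
  have "integrable lborel g \<longleftrightarrow> integrable (distr lborel borel ((+) c)) g"
    by (simp add: lborel_distr_plus)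
  also have "\<dots> \<longleftrightarrow> integrable lborel (\<lambda>y. g (c + y))"
    by (rule integrable_distr_eq) auto
  finally show "integrable lborel g \<longleftrightarrow> integrable lborel (\<lambda>y. g (c + y))" .
qed

context
  fixes M :: "'a measure" and X :: "'a \<Rightarrow> 'e :: euclidean_space" and \<phi> :: "'e \<Rightarrow> real"
  assumes M: "prob_space M" and X [measurable]: "X \<in> borel_measurable M"
    and \<phi>: "continuous_on UNIV \<phi>" "\<And>y. 0 \<le> \<phi> y" "integrable lborel \<phi>" "(\<integral>y. \<phi> y \<partial>lborel) = 1"
begin

text \<open>Fubini and translation invariance of Lebesgue measure. Both sides are E f(X + Y) with Y
  independent of X and distributed with density \<phi>: once via the density of the sum, once by
  conditioning on Y.\<close>

lemma mollified_swap:
  fixes f :: "'e \<Rightarrow> real"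
  assumes f [measurable]: "f \<in> borel_measurable borel" and f1: "\<And>x. \<bar>f x\<bar> \<le> 1"
  shows "integrable lborel (\<lambda>y. f y * (\<integral>\<omega>. \<phi> (y - X \<omega>) \<partial>M))"
    and "integrable lborel (\<lambda>h. (\<integral>\<omega>. f (X \<omega> + h) \<partial>M) * \<phi> h)"
    and "(\<integral>y. f y * (\<integral>\<omega>. \<phi> (y - X \<omega>) \<partial>M) \<partial>lborel) = (\<integral>h. (\<integral>\<omega>. f (X \<omega> + h) \<partial>M) * \<phi> h \<partial>lborel)"
proof -
  interpret M: prob_space M by (rule M)
  interpret P: pair_sigma_finite M "lborel :: 'e measure" ..
  have \<phi>m [measurable]: "\<phi> \<in> borel_measurable borel"
    using \<phi>(1) by (rule borel_measurable_continuous_onI)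
  have si: "integrable lborel (\<lambda>y. \<phi> (y - c))" "(\<integral>y. \<phi> (y - c) \<partial>lborel) = 1" for c
    using lborel_integral_translate[of "\<lambda>y. \<phi> (y - c)" c] \<phi>(3,4) by simp_all
  have f\<phi>: "\<bar>f x * \<phi> y\<bar> \<le> \<phi> y" for x y
    using f1[of x] \<phi>(2)[of y] by (simp add: abs_mult mult_left_le_one_le)
  have fi: "integrable lborel (\<lambda>y. f y * \<phi> (y - c))" for c
    by (rule Bochner_Integration.integrable_bound[OF si(1)[of c]]) (use f\<phi> \<phi>(2) in auto)
  have gi: "integrable lborel (\<lambda>h. f (c + h) * \<phi> h)" for c
    by (rule Bochner_Integration.integrable_bound[OF \<phi>(3)]) (use f\<phi> \<phi>(2) in auto)
  have "integrable (M \<Otimes>\<^sub>M lborel) (\<lambda>(\<omega>, y). f y * \<phi> (y - X \<omega>))"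
  proof (rule P.Fubini_integrable)
    show "integrable M (\<lambda>\<omega>. \<integral>y. norm (case (\<omega>, y) of (\<omega>, y) \<Rightarrow> f y * \<phi> (y - X \<omega>)) \<partial>lborel)"
    proof (rule M.integrable_const_bound[of _ 1])
      have "(\<integral>y. \<bar>f y * \<phi> (y - c)\<bar> \<partial>lborel) \<le> (\<integral>y. \<phi> (y - c) \<partial>lborel)" for c
        by (intro integral_mono integrable_abs fi si f\<phi>)
      then show "AE \<omega> in M. norm (\<integral>y. norm (case (\<omega>, y) of (\<omega>, y) \<Rightarrow> f y * \<phi> (y - X \<omega>)) \<partial>lborel) \<le> 1"
        by (intro AE_I2) (simp add: si)
    qed measurable
  qed (use fi in auto)
  note 1 = this
  have "integrable (M \<Otimes>\<^sub>M lborel) (\<lambda>(\<omega>, h). f (X \<omega> + h) * \<phi> h)"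
  proof (rule P.Fubini_integrable)
    show "integrable M (\<lambda>\<omega>. \<integral>y. norm (case (\<omega>, y) of (\<omega>, h) \<Rightarrow> f (X \<omega> + h) * \<phi> h) \<partial>lborel)"
    proof (rule M.integrable_const_bound[of _ 1])
      have "(\<integral>y. \<bar>f (c + y) * \<phi> y\<bar> \<partial>lborel) \<le> (\<integral>y. \<phi> y \<partial>lborel)" for c
        by (intro integral_mono integrable_abs gi \<phi>(3) f\<phi>)
      then show "AE \<omega> in M. norm (\<integral>y. norm (case (\<omega>, y) of (\<omega>, h) \<Rightarrow> f (X \<omega> + h) * \<phi> h) \<partial>lborel) \<le> 1"
        by (intro AE_I2) (simp add: \<phi>(4))
    qed measurable
  qed (use gi in auto)
  note 2 = this
  show "integrable lborel (\<lambda>y. f y * (\<integral>\<omega>. \<phi> (y - X \<omega>) \<partial>M))"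
    using P.integrable_snd[OF 1] by simp
  show "integrable lborel (\<lambda>h. (\<integral>\<omega>. f (X \<omega> + h) \<partial>M) * \<phi> h)"
    using P.integrable_snd[OF 2] by simp
  have "(\<integral>y. f y * (\<integral>\<omega>. \<phi> (y - X \<omega>) \<partial>M) \<partial>lborel) = (\<integral>y. (\<integral>\<omega>. f y * \<phi> (y - X \<omega>) \<partial>M) \<partial>lborel)"
    by simp
  also have "\<dots> = (\<integral>\<omega>. (\<integral>y. f y * \<phi> (y - X \<omega>) \<partial>lborel) \<partial>M)"
    by (rule P.Fubini_integral[OF 1])
  also have "\<dots> = (\<integral>\<omega>. (\<integral>h. f (X \<omega> + h) * \<phi> h \<partial>lborel) \<partial>M)"
  proof (rule Bochner_Integration.integral_cong[OF refl])
    fix \<omega>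
    show "(\<integral>y. f y * \<phi> (y - X \<omega>) \<partial>lborel) = (\<integral>h. f (X \<omega> + h) * \<phi> h \<partial>lborel)"
      using lborel_integral_translate(1)[of "\<lambda>y. f y * \<phi> (y - X \<omega>)" "X \<omega>"] by simp
  qed
  also have "\<dots> = (\<integral>h. (\<integral>\<omega>. f (X \<omega> + h) * \<phi> h \<partial>M) \<partial>lborel)"
    by (rule P.Fubini_integral[OF 2, symmetric])
  finally show "(\<integral>y. f y * (\<integral>\<omega>. \<phi> (y - X \<omega>) \<partial>M) \<partial>lborel) = (\<integral>h. (\<integral>\<omega>. f (X \<omega> + h) \<partial>M) * \<phi> h \<partial>lborel)"
    by simp
qed

text \<open>Total mass 1 holds for each mollified law, so Scheffe's lemma can compare their
  norms.\<close>

lemma mollified_density: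
  shows "integrable lborel (\<lambda>y. \<integral>\<omega>. \<phi> (y - X \<omega>) \<partial>M)"
    and "(\<integral>\<^sup>+y. norm (\<integral>\<omega>. \<phi> (y - X \<omega>) \<partial>M) \<partial>lborel) = 1"
proof -
  interpret M: prob_space M by (rule M)
  show i: "integrable lborel (\<lambda>y. \<integral>\<omega>. \<phi> (y - X \<omega>) \<partial>M)"
    using mollified_swap(1)[of "\<lambda>_. 1"] by simp
  have "(\<integral>y. (\<integral>\<omega>. \<phi> (y - X \<omega>) \<partial>M) \<partial>lborel) = 1"
    using mollified_swap(3)[of "\<lambda>_. 1"] \<phi>(4) by (simp add: M.prob_space)
  moreover have "0 \<le> (\<integral>\<omega>. \<phi> (y - X \<omega>) \<partial>M)" for y using \<phi>(2) by (intro Bochner_Integration.integral_nonneg) auto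
  ultimately show "(\<integral>\<^sup>+y. norm (\<integral>\<omega>. \<phi> (y - X \<omega>) \<partial>M) \<partial>lborel) = 1"
    using nn_integral_eq_integral[OF i] by simp
qed

text \<open>The error is an average, against the probability density \<phi> living on the ball of
  radius \<open>r\<close>, of increments bounded by \<eta>.\<close>

lemma mollification_error:
  fixes f :: "'e \<Rightarrow> real"
  assumes f [measurable]: "f \<in> borel_measurable borel" and f1: "\<And>x. \<bar>f x\<bar> \<le> 1"
    and supp: "\<And>y. norm y > r \<Longrightarrow> \<phi> y = 0"
    and tr: "\<And>h. norm h \<le> r \<Longrightarrow> \<bar>(\<integral>\<omega>. f (X \<omega> + h) \<partial>M) - (\<integral>\<omega>. f (X \<omega>) \<partial>M)\<bar> \<le> \<eta>"
  shows "\<bar>(\<integral>y. f y * (\<integral>\<omega>. \<phi> (y - X \<omega>) \<partial>M) \<partial>lborel) - (\<integral>\<omega>. f (X \<omega>) \<partial>M)\<bar> \<le> \<eta>"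
proof -
  let ?E = "\<integral>\<omega>. f (X \<omega>) \<partial>M" and ?g = "\<lambda>h. \<integral>\<omega>. f (X \<omega> + h) \<partial>M"
  note i = mollified_swap(2)[OF f f1]
  have "(\<integral>y. f y * (\<integral>\<omega>. \<phi> (y - X \<omega>) \<partial>M) \<partial>lborel) - ?E = (\<integral>h. ?g h * \<phi> h \<partial>lborel) - (\<integral>h. ?E * \<phi> h \<partial>lborel)"
    using mollified_swap(3)[OF f f1] \<phi>(4) by simp
  also have "\<dots> = (\<integral>h. ?g h * \<phi> h - ?E * \<phi> h \<partial>lborel)"
    using i \<phi>(3) by (intro Bochner_Integration.integral_diff[symmetric] integrable_mult_right)
  finally have e: "(\<integral>y. f y * (\<integral>\<omega>. \<phi> (y - X \<omega>) \<partial>M) \<partial>lborel) - ?E = (\<integral>h. ?g h * \<phi> h - ?E * \<phi> h \<partial>lborel)" .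
  have "\<bar>\<integral>h. ?g h * \<phi> h - ?E * \<phi> h \<partial>lborel\<bar> \<le> (\<integral>h. \<bar>?g h * \<phi> h - ?E * \<phi> h\<bar> \<partial>lborel)"
    by (rule integral_abs_bound)
  also have "\<dots> \<le> (\<integral>h. \<eta> * \<phi> h \<partial>lborel)"
  proof (rule integral_mono)
    show "integrable lborel (\<lambda>h. \<bar>?g h * \<phi> h - ?E * \<phi> h\<bar>)"
      using i \<phi>(3) by (intro integrable_abs Bochner_Integration.integrable_diff integrable_mult_right)
    show "integrable lborel (\<lambda>h. \<eta> * \<phi> h)" using \<phi>(3) by (rule integrable_mult_right)
    show "\<bar>?g h * \<phi> h - ?E * \<phi> h\<bar> \<le> \<eta> * \<phi> h" for h
    proof (cases "norm h \<le> r")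
      case True
      have "\<bar>?g h * \<phi> h - ?E * \<phi> h\<bar> = \<bar>?g h - ?E\<bar> * \<phi> h"
        using \<phi>(2)[of h] by (simp add: abs_mult flip: left_diff_distrib)
      then show ?thesis using tr[OF True] \<phi>(2)[of h] by (simp add: mult_right_mono)
    qed (simp add: supp)
  qed
  also have "\<dots> = \<eta>" using \<phi>(4) by simp
  finally show ?thesis unfolding e .
qed

end

section \<open>Comparison with the limit law\<close>

text \<open>One \<eta> for mollifying each of the two laws, and one for the L1 distance of the
  mollified densities. The last bound holds for all \<open>f\<close> in the class at once, and this
  uniformity upgrades weak convergence.\<close>

lemma eventually_expectations_close:
  fixes X :: "nat \<Rightarrow> 'a \<Rightarrow> real ^ 'd" and F :: "'b \<Rightarrow> real ^ 'd"
  assumes M: "\<And>n. prob_space (M n)" and X: "\<And>n. X n \<in> borel_measurable (M n)"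
    and Q: "prob_space Q" and F: "F \<in> borel_measurable Q"
    and conv: "converges_in_distribution M X Q F"
    and C: "\<And>f. f \<in> C \<Longrightarrow> continuous_on UNIV f" "\<And>f x. f \<in> C \<Longrightarrow> \<bar>f x :: real\<bar> \<le> 1"
    and r: "r > 0" and \<eta>: "\<eta> > 0"
    and tr: "\<forall>\<^sub>F n in sequentially. \<forall>f\<in>C. \<forall>h. norm h \<le> r \<longrightarrow>
      \<bar>(\<integral>\<omega>. f (X n \<omega> + h) \<partial>M n) - (\<integral>\<omega>. f (X n \<omega>) \<partial>M n)\<bar> \<le> \<eta>"
  shows "\<forall>\<^sub>F n in sequentially. \<forall>f\<in>C. \<bar>(\<integral>\<omega>. f (F \<omega>) \<partial>Q) - (\<integral>\<omega>. f (X n \<omega>) \<partial>M n)\<bar> \<le> 3 * \<eta>"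
proof -
  obtain \<phi> :: "real ^ 'd \<Rightarrow> real" and B where \<phi>: "continuous_on UNIV \<phi>" "\<And>y. 0 \<le> \<phi> y"
    "\<And>y. \<phi> y \<le> B" "\<And>y. norm y > r \<Longrightarrow> \<phi> y = 0" "integrable lborel \<phi>" "(\<integral>y. \<phi> y \<partial>lborel) = 1"
    by (rule ex_mollifier[OF r]) (rule that)
  \<comment> \<open>For fixed \<open>f\<close> and \<open>h\<close> both expectations converge,
    since \<open>f\<close> and its translate are bounded and continuous; the eventual bound survives
    in the limit.\<close>
  have trF: "\<bar>(\<integral>\<omega>. f (F \<omega> + h) \<partial>Q) - (\<integral>\<omega>. f (F \<omega>) \<partial>Q)\<bar> \<le> \<eta>" if f: "f \<in> C" and h: "norm h \<le> r" for f h
  proof (rule tendsto_upperbound)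
    have c: "continuous_on UNIV (\<lambda>x. f (x + y))" for y
      by (rule continuous_on_compose2[OF C(1)[OF f]]) (intro continuous_intros, simp)
    have b: "bounded (range (\<lambda>x. f (x + y)))" for y
      unfolding bounded_real_image using C(2)[OF f] by blast
    have "(\<lambda>n. \<integral>\<omega>. f (X n \<omega> + y) \<partial>M n) \<longlonglongrightarrow> (\<integral>\<omega>. f (F \<omega> + y) \<partial>Q)" for y
      using conv[unfolded converges_in_distribution_def, rule_format, of "\<lambda>x. f (x + y)"] c b by blast
    from this[of h] this[of 0]
    show "(\<lambda>n. \<bar>(\<integral>\<omega>. f (X n \<omega> + h) \<partial>M n) - (\<integral>\<omega>. f (X n \<omega>) \<partial>M n)\<bar>)
        \<longlonglongrightarrow> \<bar>(\<integral>\<omega>. f (F \<omega> + h) \<partial>Q) - (\<integral>\<omega>. f (F \<omega>) \<partial>Q)\<bar>"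
      by (intro tendsto_rabs tendsto_diff) simp_all
    show "\<forall>\<^sub>F n in sequentially. \<bar>(\<integral>\<omega>. f (X n \<omega> + h) \<partial>M n) - (\<integral>\<omega>. f (X n \<omega>) \<partial>M n)\<bar> \<le> \<eta>"
      using tr by eventually_elim (use f h in blast)
  qed simp
  define q where "q n y = (\<integral>\<omega>. \<phi> (y - X n \<omega>) \<partial>M n)" for n y
  define p where "p y = (\<integral>\<omega>. \<phi> (y - F \<omega>) \<partial>Q)" for y
  note qd = mollified_density[OF M X \<phi>(1,2,5,6), folded q_def]
  note pd = mollified_density[OF Q F \<phi>(1,2,5,6), folded p_def]
  have "(\<lambda>n. \<integral>\<^sup>+y. norm (q n y - p y) \<partial>lborel) \<longlonglongrightarrow> 0"
  proof (rule Scheffe_lemma2)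
    show "q n \<in> borel_measurable lborel" for n using qd(1) by (rule borel_measurable_integrable)
    show "integrable lborel p" by (rule pd)
    have "(\<lambda>n. q n y) \<longlonglongrightarrow> p y" for y
    proof -
      have "continuous_on UNIV (\<lambda>x. \<phi> (y - x))"
        by (rule continuous_on_compose2[OF \<phi>(1)]) (intro continuous_intros, simp)
      moreover have "\<bar>\<phi> x\<bar> \<le> B" for x using \<phi>(2,3)[of x] by simp
      then have "bounded (range (\<lambda>x. \<phi> (y - x)))" unfolding bounded_real_image by blast
      ultimately show ?thesis
        unfolding q_def p_def
        using conv[unfolded converges_in_distribution_def, rule_format, of "\<lambda>x. \<phi> (y - x)"] by blast
    qed
    then show "AE y in lborel. (\<lambda>n. q n y) \<longlonglongrightarrow> p y" by simp
    show "(\<integral>\<^sup>+y. norm (q n y) \<partial>lborel) \<le> (\<integral>\<^sup>+y. norm (p y) \<partial>lborel)" for n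
      unfolding qd(2) pd(2) ..
  qed
  then have "\<forall>\<^sub>F n in sequentially. (\<integral>\<^sup>+y. norm (q n y - p y) \<partial>lborel) < ennreal \<eta>"
    using \<eta> by (intro order_tendstoD(2)) auto
  with tr show ?thesis
  proof eventually_elim
    case (elim n)
    show ?case
    proof
      fix f assume f: "f \<in> C"
      have fm: "f \<in> borel_measurable borel"
        using C(1)[OF f] by (rule borel_measurable_continuous_onI)
      have 1: "\<bar>(\<integral>y. f y * q n y \<partial>lborel) - (\<integral>\<omega>. f (X n \<omega>) \<partial>M n)\<bar> \<le> \<eta>"
        unfolding q_def
        by (rule mollification_error[OF M X \<phi>(1,2,5,6) fm C(2)[OF f] \<phi>(4)]) (use elim f in auto)
      have 2: "\<bar>(\<integral>y. f y * p y \<partial>lborel) - (\<integral>\<omega>. f (F \<omega>) \<partial>Q)\<bar> \<le> \<eta>"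
        unfolding p_def
        by (rule mollification_error[OF Q F \<phi>(1,2,5,6) fm C(2)[OF f] \<phi>(4)]) (use trF f in auto)
      have i: "integrable lborel (\<lambda>y. f y * q n y)" "integrable lborel (\<lambda>y. f y * p y)"
        unfolding q_def p_def
        using mollified_swap(1)[OF M X \<phi>(1,2,5,6) fm C(2)[OF f]] mollified_swap(1)[OF Q F \<phi>(1,2,5,6) fm C(2)[OF f]]
        by blast+
      have "ennreal \<bar>\<integral>y. f y * q n y - f y * p y \<partial>lborel\<bar> \<le> (\<integral>\<^sup>+y. norm (f y * q n y - f y * p y) \<partial>lborel)"
        using integral_norm_bound_ennreal[OF Bochner_Integration.integrable_diff[OF i]] by simp
      also have "\<dots> \<le> (\<integral>\<^sup>+y. norm (q n y - p y) \<partial>lborel)"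
        using C(2)[OF f]
        by (intro nn_integral_mono ennreal_leI)
          (simp add: abs_mult mult_left_le_one_le flip: right_diff_distrib)
      also have "\<dots> \<le> ennreal \<eta>" using elim(2) by simp
      finally have "\<bar>\<integral>y. f y * q n y - f y * p y \<partial>lborel\<bar> \<le> \<eta>" using \<eta> by simp
      then have "\<bar>(\<integral>y. f y * q n y \<partial>lborel) - (\<integral>y. f y * p y \<partial>lborel)\<bar> \<le> \<eta>"
        using i by simp
      with 1 2 show "\<bar>(\<integral>\<omega>. f (F \<omega>) \<partial>Q) - (\<integral>\<omega>. f (X n \<omega>) \<partial>M n)\<bar> \<le> 3 * \<eta>" by linarith
    qed
  qed
qed

section \<open>Approximation of Borel functions\<close>

text \<open>One \<open>g\<close> must serve all measures of \<open>S\<close> simultaneously: the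
  definition is applied to the set of the two laws under comparison.\<close>

definition arctan_algebra_approx :: "(real ^ 'd) measure set \<Rightarrow> (real ^ 'd \<Rightarrow> real) \<Rightarrow> bool" where
  "arctan_algebra_approx S u \<longleftrightarrow> u \<in> borel_measurable borel \<and> (\<exists>B. \<forall>x. \<bar>u x\<bar> \<le> B) \<and>
     (\<forall>e>0. \<exists>g\<in>arctan_algebra. \<forall>\<mu>\<in>S. (\<integral>x. \<bar>u x - g x\<bar> \<partial>\<mu>) < e)"

locale prob_family =
  fixes S :: "(real ^ 'd) measure set"
  assumes fin: "finite S" and prob: "\<And>\<mu>. \<mu> \<in> S \<Longrightarrow> prob_space \<mu>"
    and sets: "\<And>\<mu>. \<mu> \<in> S \<Longrightarrow> sets \<mu> = sets borel"
begin

lemma bounded_integrable: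
  assumes "\<mu> \<in> S" "u \<in> borel_measurable borel" "\<forall>x. \<bar>u x :: real\<bar> \<le> B"
  shows "integrable \<mu> u"
proof -
  interpret prob_space \<mu> by (rule prob[OF assms(1)])
  have "u \<in> borel_measurable \<mu>" using assms(2) measurable_cong_sets[OF sets[OF assms(1)] refl] by blast
  then show ?thesis using assms(3) by (intro integrable_const_bound[of _ B]) auto
qed

lemma arctan_algebra_integrable: "\<mu> \<in> S \<Longrightarrow> g \<in> arctan_algebra \<Longrightarrow> integrable \<mu> g"
  using arctan_algebra_bounded[of g] bounded_integrable[OF _ arctan_algebra_measurable] by blast

lemma arctan_algebra_approx_integrable: "\<mu> \<in> S \<Longrightarrow> arctan_algebra_approx S u \<Longrightarrow> integrable \<mu> u"
  unfolding arctan_algebra_approx_def using bounded_integrable by blast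

lemma arctan_algebra_approx_triangle:
  assumes "\<mu> \<in> S" "integrable \<mu> u" "integrable \<mu> v" "integrable \<mu> w"
  shows "(\<integral>x. \<bar>u x - w x\<bar> \<partial>\<mu>) \<le> (\<integral>x. \<bar>u x - v x\<bar> \<partial>\<mu>) + (\<integral>x. \<bar>v x - w x :: real\<bar> \<partial>\<mu>)"
proof -
  have "(\<integral>x. \<bar>u x - w x\<bar> \<partial>\<mu>) \<le> (\<integral>x. \<bar>u x - v x\<bar> + \<bar>v x - w x\<bar> \<partial>\<mu>)"
    using assms by (intro integral_mono) auto
  then show ?thesis using assms by simp
qed

lemma arctan_algebra_approx_arctan_algebra: "g \<in> arctan_algebra \<Longrightarrow> arctan_algebra_approx S g"
  unfolding arctan_algebra_approx_def using arctan_algebra_bounded[of g] arctan_algebra_measurable[of g] by (auto intro!: bexI[of _ g])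

text \<open>Dominated convergence under each measure; finiteness of \<open>S\<close> yields an index
  that works for all of them.\<close>

lemma arctan_algebra_approx_limit:
  assumes U: "\<And>i. arctan_algebra_approx S (U i)" and B: "\<And>i x. \<bar>U i x\<bar> \<le> B"
    and lim: "\<And>x. (\<lambda>i::nat. U i x) \<longlonglongrightarrow> u x"
  shows "arctan_algebra_approx S u"
  unfolding arctan_algebra_approx_def
proof (intro conjI allI impI)
  have Um: "U i \<in> borel_measurable borel" for i using U by (simp add: arctan_algebra_approx_def)
  show um: "u \<in> borel_measurable borel"
    using Um lim by (rule borel_measurable_LIMSEQ_real[rotated])
  have "\<bar>u x\<bar> \<le> B" for x
    by (rule tendsto_upperbound[OF tendsto_rabs[OF lim]]) (auto simp: B)
  then have uB: "\<forall>x. \<bar>u x\<bar> \<le> B" by blast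
  then show "\<exists>B. \<forall>x. \<bar>u x\<bar> \<le> B" by blast
  fix e :: real assume e: "e > 0"
  have "\<forall>\<mu>\<in>S. \<forall>\<^sub>F i in sequentially. (\<integral>x. \<bar>u x - U i x\<bar> \<partial>\<mu>) < e / 2"
  proof
    fix \<mu> assume \<mu>: "\<mu> \<in> S"
    interpret prob_space \<mu> by (rule prob[OF \<mu>])
    have m: "\<And>i. U i \<in> borel_measurable \<mu>" "u \<in> borel_measurable \<mu>"
      using Um um measurable_cong_sets[OF sets[OF \<mu>] refl] by blast+
    have "(\<lambda>i. \<integral>x. \<bar>u x - U i x\<bar> \<partial>\<mu>) \<longlonglongrightarrow> (\<integral>x. 0 \<partial>\<mu>)"
    proof (rule integral_dominated_convergence[where w="\<lambda>_. 2 * B"])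
      have "(\<lambda>i. \<bar>u x - U i x\<bar>) \<longlonglongrightarrow> \<bar>u x - u x\<bar>" for x
        by (intro tendsto_intros lim)
      then show "AE x in \<mu>. (\<lambda>i. \<bar>u x - U i x\<bar>) \<longlonglongrightarrow> 0" by simp
      have "\<bar>u x - U i x\<bar> \<le> 2 * B" for i x
        using uB[rule_format, of x] B[of i x] by linarith
      then show "AE x in \<mu>. norm \<bar>u x - U i x\<bar> \<le> 2 * B" for i by simp
    qed (use m in auto)
    then have "(\<lambda>i. \<integral>x. \<bar>u x - U i x\<bar> \<partial>\<mu>) \<longlonglongrightarrow> 0" by simp
    then show "\<forall>\<^sub>F i in sequentially. (\<integral>x. \<bar>u x - U i x\<bar> \<partial>\<mu>) < e / 2"
      using e by (intro order_tendstoD(2)) auto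
  qed
  then have "\<forall>\<^sub>F i in sequentially. \<forall>\<mu>\<in>S. (\<integral>x. \<bar>u x - U i x\<bar> \<partial>\<mu>) < e / 2"
    using fin by (simp add: eventually_ball_finite)
  then obtain i where i: "\<forall>\<mu>\<in>S. (\<integral>x. \<bar>u x - U i x\<bar> \<partial>\<mu>) < e / 2"
    using eventually_happens'[OF sequentially_bot] by blast
  obtain g where g: "g \<in> arctan_algebra" "\<forall>\<mu>\<in>S. (\<integral>x. \<bar>U i x - g x\<bar> \<partial>\<mu>) < e / 2"
    using U[of i] e unfolding arctan_algebra_approx_def by (meson half_gt_zero)
  have "(\<integral>x. \<bar>u x - g x\<bar> \<partial>\<mu>) < e" if \<mu>: "\<mu> \<in> S" for \<mu>
  proof -
    have "(\<integral>x. \<bar>u x - g x\<bar> \<partial>\<mu>) \<le> (\<integral>x. \<bar>u x - U i x\<bar> \<partial>\<mu>) + (\<integral>x. \<bar>U i x - g x\<bar> \<partial>\<mu>)"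
      by (rule arctan_algebra_approx_triangle[OF \<mu> bounded_integrable[OF \<mu> um uB]
            arctan_algebra_approx_integrable[OF \<mu> U] arctan_algebra_integrable[OF \<mu> g(1)]])
    also have "\<dots> < e / 2 + e / 2" using i g(2) \<mu> by (intro add_strict_mono) auto
    finally show ?thesis by simp
  qed
  with g(1) show "\<exists>g\<in>arctan_algebra. \<forall>\<mu>\<in>S. (\<integral>x. \<bar>u x - g x\<bar> \<partial>\<mu>) < e" by blast
qed

lemma arctan_algebra_approx_add:
  assumes u: "arctan_algebra_approx S u" and v: "arctan_algebra_approx S v"
  shows "arctan_algebra_approx S (\<lambda>x. u x + v x)"
  unfolding arctan_algebra_approx_def
proof (intro conjI allI impI)
  show "(\<lambda>x. u x + v x) \<in> borel_measurable borel"
    using u v by (auto simp: arctan_algebra_approx_def)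
  obtain B C where "\<And>x. \<bar>u x\<bar> \<le> B" "\<And>x. \<bar>v x\<bar> \<le> C"
    using u v unfolding arctan_algebra_approx_def by blast
  then have "\<bar>u x + v x\<bar> \<le> B + C" for x
    by (meson abs_triangle_ineq add_mono order_trans)
  then show "\<exists>B. \<forall>x. \<bar>u x + v x\<bar> \<le> B" by blast
  fix e :: real assume e: "e > 0"
  obtain g where g: "g \<in> arctan_algebra" "\<forall>\<mu>\<in>S. (\<integral>x. \<bar>u x - g x\<bar> \<partial>\<mu>) < e / 2"
    using u e unfolding arctan_algebra_approx_def by (meson half_gt_zero)
  obtain h where h: "h \<in> arctan_algebra" "\<forall>\<mu>\<in>S. (\<integral>x. \<bar>v x - h x\<bar> \<partial>\<mu>) < e / 2"
    using v e unfolding arctan_algebra_approx_def by (meson half_gt_zero)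
  have "(\<integral>x. \<bar>u x + v x - (g x + h x)\<bar> \<partial>\<mu>) < e" if \<mu>: "\<mu> \<in> S" for \<mu>
  proof -
    note i = arctan_algebra_approx_integrable[OF \<mu> u] arctan_algebra_approx_integrable[OF \<mu> v]
      arctan_algebra_integrable[OF \<mu> g(1)] arctan_algebra_integrable[OF \<mu> h(1)]
    have "(\<integral>x. \<bar>u x + v x - (g x + h x)\<bar> \<partial>\<mu>) \<le> (\<integral>x. \<bar>u x - g x\<bar> + \<bar>v x - h x\<bar> \<partial>\<mu>)"
      using i by (intro integral_mono) auto
    also have "\<dots> = (\<integral>x. \<bar>u x - g x\<bar> \<partial>\<mu>) + (\<integral>x. \<bar>v x - h x\<bar> \<partial>\<mu>)"
      using i by simp
    also have "\<dots> < e / 2 + e / 2" using g(2) h(2) \<mu> by (intro add_strict_mono) auto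
    finally show ?thesis by simp
  qed
  with arctan_algebra.add[OF g(1) h(1)] show "\<exists>g\<in>arctan_algebra. \<forall>\<mu>\<in>S. (\<integral>x. \<bar>u x + v x - g x\<bar> \<partial>\<mu>) < e"
    by (intro bexI[of _ "\<lambda>x. g x + h x"]) auto
qed

lemma arctan_algebra_approx_cmult:
  assumes u: "arctan_algebra_approx S u"
  shows "arctan_algebra_approx S (\<lambda>x. c * u x)"
  unfolding arctan_algebra_approx_def
proof (intro conjI allI impI)
  show "(\<lambda>x. c * u x) \<in> borel_measurable borel"
    using u by (auto simp: arctan_algebra_approx_def)
  obtain B where "\<And>x. \<bar>u x\<bar> \<le> B"
    using u unfolding arctan_algebra_approx_def by blast
  then have "\<bar>c * u x\<bar> \<le> \<bar>c\<bar> * B" for x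
    unfolding abs_mult by (intro mult_left_mono) auto
  then show "\<exists>B. \<forall>x. \<bar>c * u x\<bar> \<le> B" by blast
  fix e :: real assume e: "e > 0"
  then have "e / (\<bar>c\<bar> + 1) > 0" by simp
  then obtain g where g: "g \<in> arctan_algebra" "\<forall>\<mu>\<in>S. (\<integral>x. \<bar>u x - g x\<bar> \<partial>\<mu>) < e / (\<bar>c\<bar> + 1)"
    using u unfolding arctan_algebra_approx_def by meson
  have "(\<integral>x. \<bar>c * u x - c * g x\<bar> \<partial>\<mu>) < e" if \<mu>: "\<mu> \<in> S" for \<mu>
  proof -
    have "(\<integral>x. \<bar>c * u x - c * g x\<bar> \<partial>\<mu>) = \<bar>c\<bar> * (\<integral>x. \<bar>u x - g x\<bar> \<partial>\<mu>)"
      by (simp add: abs_mult flip: right_diff_distrib)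
    also have "\<dots> \<le> \<bar>c\<bar> * (e / (\<bar>c\<bar> + 1))" using g(2) \<mu> by (intro mult_left_mono) (auto intro: less_imp_le)
    also have "\<dots> < e" using e by (simp add: divide_simps)
    finally show ?thesis .
  qed
  with arctan_algebra.mult[OF arctan_algebra.const g(1)] show "\<exists>g\<in>arctan_algebra. \<forall>\<mu>\<in>S. (\<integral>x. \<bar>c * u x - g x\<bar> \<partial>\<mu>) < e"
    by (intro bexI[of _ "\<lambda>x. c * g x"]) auto
qed

lemma arctan_algebra_approx_sum:
  "(\<And>i. i \<in> I \<Longrightarrow> arctan_algebra_approx S (u i)) \<Longrightarrow> arctan_algebra_approx S (\<lambda>x. \<Sum>i\<in>I. u i x)"
  by (induction I rule: infinite_finite_induct)
    (auto intro: arctan_algebra_approx_add arctan_algebra_approx_arctan_algebra arctan_algebra.const)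

end

section \<open>Indicators of boxes as limits of test functions\<close>

text \<open>The argument n (n t - 1) tends to infinity for t > 0 and is at most -n for t \<le> 0.
  The shift by -n makes the limit at t = 0 equal to 0 instead of 1/2, so exact indicators of open
  half-lines result.\<close>

definition arctan_step :: "nat \<Rightarrow> real \<Rightarrow> real" where
  "arctan_step n t = 1 / 2 + arctan (real n * (real n * t - 1)) / pi"

lemma arctan_step_bounds: "\<bar>arctan_step n t\<bar> \<le> 1"
  using arctan_bounded[of "real n * (real n * t - 1)"] by (simp add: arctan_step_def abs_le_iff field_simps)

lemma arctan_step_tendsto: "(\<lambda>n. arctan_step n t) \<longlonglongrightarrow> (if t > 0 then 1 else 0)"
proof (cases "t > 0")
  case True
  have "\<forall>\<^sub>F n in sequentially. real n \<ge> 2 / t"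
    using filterlim_real_sequentially by (simp add: filterlim_at_top)
  then have "\<forall>\<^sub>F n in sequentially. real n \<le> real n * (real n * t - 1)"
  proof eventually_elim
    case (elim n)
    then have "1 \<le> real n * t - 1" using True by (simp add: divide_le_eq)
    then show ?case using mult_left_mono[of 1 "real n * t - 1" "real n"] by simp
  qed
  then have "filterlim (\<lambda>n. real n * (real n * t - 1)) at_top sequentially"
    by (rule filterlim_at_top_mono[OF filterlim_real_sequentially])
  then have "(\<lambda>n. arctan (real n * (real n * t - 1))) \<longlonglongrightarrow> pi / 2"
    by (rule filterlim_compose[OF tendsto_arctan_at_top])
  then have "(\<lambda>n. arctan_step n t) \<longlonglongrightarrow> 1 / 2 + (pi / 2) / pi"
    unfolding arctan_step_def by (intro tendsto_intros) auto
  then show ?thesis using True by simp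
next
  case False
  have "real n \<le> - (real n * (real n * t - 1))" for n
  proof -
    have "real n * (real n * t) \<le> 0" using False by (simp add: mult_nonneg_nonpos)
    then show ?thesis by (simp add: algebra_simps)
  qed
  then have "filterlim (\<lambda>n. - (real n * (real n * t - 1))) at_top sequentially"
    by (intro filterlim_at_top_mono[OF filterlim_real_sequentially]) simp
  then have "(\<lambda>n. arctan (- (real n * (real n * t - 1)))) \<longlonglongrightarrow> pi / 2"
    by (rule filterlim_compose[OF tendsto_arctan_at_top])
  from tendsto_minus[OF this] have "(\<lambda>n. arctan (real n * (real n * t - 1))) \<longlonglongrightarrow> - (pi / 2)"
    by (simp add: arctan_minus)
  then have "(\<lambda>n. arctan_step n t) \<longlonglongrightarrow> 1 / 2 + (- (pi / 2)) / pi"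
    unfolding arctan_step_def by (intro tendsto_intros) auto
  then show ?thesis using False by simp
qed

lemma arctan_step_arctan_algebra: "(\<lambda>x :: real ^ 'd. arctan_step n (a * x $ j + b)) \<in> arctan_algebra"
proof -
  have "(\<lambda>x :: real ^ 'd. 1 / 2 + 1 / pi * arctan (real n * real n * a * x $ j + (real n * real n * b - real n))) \<in> arctan_algebra"
    by (intro arctan_algebra.intros)
  also have "(\<lambda>x :: real ^ 'd. 1 / 2 + 1 / pi * arctan (real n * real n * a * x $ j + (real n * real n * b - real n)))
      = (\<lambda>x. arctan_step n (a * x $ j + b))"
    by (simp add: arctan_step_def algebra_simps)
  finally show ?thesis .
qed

context prob_family
begin

lemma arctan_algebra_approx_box: "arctan_algebra_approx S (indicator (box a b))"
proof (rule arctan_algebra_approx_limit)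
  \<comment> \<open>Two steps per coordinate, one for each face of the box. The coefficients 1 and
    -1 are written out to match the affine form in
    \<open>arctan_step_arctan_algebra\<close>.\<close>
  let ?U = "\<lambda>n x. \<Prod>j\<in>UNIV. arctan_step n (1 * x $ j + (- a $ j)) * arctan_step n ((-1) * x $ j + b $ j)"
  show "arctan_algebra_approx S (?U n)" for n
    by (intro arctan_algebra_approx_arctan_algebra arctan_algebra_prod arctan_algebra.mult arctan_step_arctan_algebra)
  show "\<bar>?U n x\<bar> \<le> 1" for n x
    unfolding abs_prod abs_mult by (intro prod_le_1 conjI mult_nonneg_nonneg mult_le_one arctan_step_bounds abs_ge_zero)
  fix x
  have "(\<lambda>n. ?U n x) \<longlonglongrightarrow> (\<Prod>j\<in>UNIV. (if 1 * x $ j + (- a $ j) > 0 then 1 else 0) * (if (-1) * x $ j + b $ j > 0 then 1 else 0))"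
    by (intro tendsto_prod tendsto_mult arctan_step_tendsto)
  also have "(\<Prod>j\<in>UNIV. (if 1 * x $ j + (- a $ j) > 0 then 1 else 0) * (if (-1) * x $ j + b $ j > 0 then 1 else 0 :: real))
      = indicator (box a b) x"
  proof (cases "x \<in> box a b")
    case True
    then show ?thesis by (simp add: mem_box_cart)
  next
    case False
    then obtain j where "\<not> (a $ j < x $ j \<and> x $ j < b $ j)" by (auto simp: mem_box_cart)
    then show ?thesis using False by (auto intro!: prod_zero bexI[of _ j])
  qed
  finally show "(\<lambda>n. ?U n x) \<longlonglongrightarrow> indicator (box a b) x" .
qed

text \<open>A \<pi>-\<lambda> argument: boxes are stable under intersection and generate the Borel
  sets. Disjointness turns indicators of finite unions into sums, and countable unions are bounded
  limits of these.\<close>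

lemma arctan_algebra_approx_indicator:
  assumes "A \<in> sets borel"
  shows "arctan_algebra_approx S (indicator A)"
proof -
  let ?G = "range (\<lambda>(a, b). box a b :: (real ^ 'd) set)"
  have "A \<in> sigma_sets UNIV ?G"
    using assms by (simp add: borel_eq_box)
  then show ?thesis
  proof (rule sigma_sets_induct_disjoint[rotated 2])
    show "Int_stable ?G"
      unfolding Int_stable_def by (auto simp: box_Int_box)
    show "arctan_algebra_approx S (indicator A)" if "A \<in> ?G" for A
      using that arctan_algebra_approx_box by auto
    show "arctan_algebra_approx S (indicator {})"
      using arctan_algebra_approx_arctan_algebra[OF arctan_algebra.const[of 0]] by (simp add: indicator_def[abs_def])
    show "arctan_algebra_approx S (indicator (UNIV - A))" if "arctan_algebra_approx S (indicator A)" for A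
    proof -
      have "indicator (UNIV - A) = (\<lambda>x. 1 + (-1) * indicator A x :: real)"
        by (auto simp: indicator_def)
      then show ?thesis
        using arctan_algebra_approx_add[OF arctan_algebra_approx_arctan_algebra[OF arctan_algebra.const[of 1]] arctan_algebra_approx_cmult[OF that, of "-1"]] by simp
    qed
    fix A :: "nat \<Rightarrow> (real ^ 'd) set"
    assume d: "disjoint_family A" and A: "\<And>i. arctan_algebra_approx S (indicator (A i))"
    have fin_un: "indicator (\<Union>i<n. A i) x = (\<Sum>i<n. indicator (A i) x :: real)" for n x
      using d by (intro indicator_UN_disjoint) (auto simp: disjoint_family_on_def)
    show "arctan_algebra_approx S (indicator (\<Union>i. A i))"
    proof (rule arctan_algebra_approx_limit[of "\<lambda>n. indicator (\<Union>i<n. A i)" 1])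
      show "arctan_algebra_approx S (indicator (\<Union>i<n. A i))" for n
        using arctan_algebra_approx_sum[of "{..<n}" "\<lambda>i. indicator (A i)"] A by (simp add: fin_un[abs_def])
      show "(\<lambda>n. indicator (\<Union>i<n. A i) x :: real) \<longlonglongrightarrow> indicator (\<Union>i. A i) x" for x
        by (rule LIMSEQ_indicator_UN)
    qed (auto simp: indicator_def)
  qed auto
qed

lemma arctan_algebra_approx_borel:
  assumes f: "f \<in> borel_measurable borel" "\<And>x. \<bar>f x\<bar> \<le> 1"
  shows "arctan_algebra_approx S f"
proof -
  \<comment> \<open>The induction for non-negative Borel functions passes through unbounded ones, so
    the bound is a premise of the claim; non-negativity hands it down to summands, and monotonicity
    to the members of a sequence.\<close>
  have "(\<exists>B. \<forall>x. u x \<le> B) \<longrightarrow> arctan_algebra_approx S u"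
    if "u \<in> borel_measurable borel" "\<And>x. 0 \<le> u x" for u :: "real ^ 'd \<Rightarrow> real"
    using that
  proof (induction rule: borel_measurable_induct_real)
    case (set A)
    then show ?case using arctan_algebra_approx_indicator by simp
  next
    case (mult u c)
    show ?case
    proof (cases "c = 0")
      case True
      then show ?thesis using arctan_algebra_approx_arctan_algebra[OF arctan_algebra.const[of 0]] by simp
    next
      case False
      then have c: "c > 0" using mult by simp
      show ?thesis
      proof
        assume "\<exists>B. \<forall>x. c * u x \<le> B"
        then obtain B where "\<forall>x. c * u x \<le> B" by blast
        then have "\<forall>x. u x \<le> B / c" using c by (simp add: le_divide_eq mult.commute)
        then show "arctan_algebra_approx S (\<lambda>x. c * u x)" using mult.IH arctan_algebra_approx_cmult by blast
      qed
    qed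
  next
    case (add u v)
    show ?case
    proof
      assume "\<exists>B. \<forall>x. v x + u x \<le> B"
      then obtain B where "\<forall>x. v x + u x \<le> B" by blast
      moreover have uv: "0 \<le> u x" "0 \<le> v x" for x by (rule add)+
      ultimately have "u x \<le> B" "v x \<le> B" for x
        using uv[of x] by (metis add_increasing add_increasing2 order_refl order_trans)+
      then show "arctan_algebra_approx S (\<lambda>x. v x + u x)" using add.IH arctan_algebra_approx_add by blast
    qed
  next
    case (seq U)
    show ?case
    proof
      assume "\<exists>B. \<forall>x. u x \<le> B"
      then obtain B where B: "\<forall>x. u x \<le> B" by blast
      have le: "U i x \<le> B" for i x
      proof -
        have "incseq (\<lambda>i. U i x)" using \<open>incseq U\<close> by (auto simp: incseq_def le_fun_def)
        moreover have "(\<lambda>i. U i x) \<longlonglongrightarrow> u x" by (rule seq) simp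
        ultimately show ?thesis using B incseq_le order_trans by blast
      qed
      show "arctan_algebra_approx S u"
      proof (rule arctan_algebra_approx_limit)
        show "arctan_algebra_approx S (U i)" for i using seq.IH le by blast
        show "\<bar>U i x\<bar> \<le> B" for i x
          using le[of i x] \<open>\<And>i x. 0 \<le> U i x\<close>[of i x] by simp
        show "(\<lambda>i. U i x) \<longlonglongrightarrow> u x" for x by (rule seq) simp
      qed
    qed
  qed
  note * = this
  \<comment> \<open>Adding 1 makes \<open>f\<close> non-negative; the constant -1 of the algebra
    undoes the shift.\<close>
  have b: "0 \<le> f x + 1" "f x + 1 \<le> 2" for x using f(2)[of x] by (auto simp: abs_le_iff)
  have "arctan_algebra_approx S (\<lambda>x. f x + 1)"
    using *[OF borel_measurable_add[OF f(1) borel_measurable_const[of 1]]] b by blast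
  from arctan_algebra_approx_add[OF this arctan_algebra_approx_arctan_algebra[OF arctan_algebra.const[of "-1"]]] show ?thesis by simp
qed

end

section \<open>Reduction of total variation to test functions\<close>

text \<open>An L1 approximant may exceed 1 in absolute value, whereas the estimates concern test
  functions bounded by 1. A polynomial close to the clamping function on the range of
  \<open>g\<close> overshoots by at most \<open>e\<close>, and dividing by 1 + e removes the excess.
  One \<open>e\<close> of the error comes from the polynomial, the other from this division.\<close>

lemma arctan_algebra_clamp:
  fixes g :: "real ^ 'd \<Rightarrow> real"
  assumes g: "g \<in> arctan_algebra" and e: "e > 0"
  obtains h where "h \<in> arctan_algebra" "\<And>x. \<bar>h x\<bar> \<le> 1" "\<And>x. \<bar>h x - max (-1) (min 1 (g x))\<bar> \<le> 2 * e"
proof -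
  obtain B where B: "\<And>x. \<bar>g x\<bar> \<le> B" using arctan_algebra_bounded[OF g] by blast
  have c: "continuous_on {-B..B} (\<lambda>t::real. max (-1) (min 1 t))"
    by (intro continuous_intros)
  obtain p where p: "real_polynomial_function p" "\<And>t. t \<in> {-B..B} \<Longrightarrow> \<bar>max (-1) (min 1 t) - p t\<bar> < e"
    using Stone_Weierstrass_real_polynomial_function[OF compact_Icc c e] by blast
  have pb: "\<bar>max (-1) (min 1 (g x)) - p (g x)\<bar> < e" for x
    using B[of x] by (intro p(2)) (auto simp: abs_le_iff)
  show thesis
  proof
    show "(\<lambda>x. (1 / (1 + e)) * p (g x)) \<in> arctan_algebra"
      by (rule arctan_algebra.mult[OF arctan_algebra.const arctan_algebra_compose_polynomial[OF p(1) g]])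
    fix x
    let ?c = "max (-1) (min 1 (g x))"
    have c1: "\<bar>?c\<bar> \<le> 1" by simp
    then have "\<bar>p (g x)\<bar> \<le> 1 + e" using pb[of x] by arith
    then show "\<bar>(1 / (1 + e)) * p (g x)\<bar> \<le> 1" using e by (simp add: abs_mult)
    have "\<bar>p (g x) - (1 + e) * ?c\<bar> \<le> 2 * e"
    proof -
      have "\<bar>e * ?c\<bar> \<le> e * 1" unfolding abs_mult using c1 e by (intro mult_mono) auto
      moreover have "p (g x) - (1 + e) * ?c = - (?c - p (g x)) - e * ?c" by (simp add: distrib_right)
      ultimately show ?thesis using pb[of x] by arith
    qed
    then have "\<bar>p (g x) - (1 + e) * ?c\<bar> / (1 + e) \<le> 2 * e / 1" using e by (intro frac_le) auto
    moreover have "(1 / (1 + e)) * p (g x) - ?c = (p (g x) - (1 + e) * ?c) / (1 + e)"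
      using e by (simp add: field_simps)
    ultimately show "\<bar>(1 / (1 + e)) * p (g x) - ?c\<bar> \<le> 2 * e" using e by (simp only: abs_divide) simp
  qed
qed

lemma expectation_difference_le_arctan_algebra:
  fixes X :: "'a \<Rightarrow> real ^ 'd" and Y :: "'b \<Rightarrow> real ^ 'd"
  assumes M: "prob_space M" and X: "X \<in> borel_measurable M"
    and N: "prob_space N" and Y: "Y \<in> borel_measurable N"
    and le: "\<And>g. g \<in> arctan_algebra \<Longrightarrow> (\<forall>x. \<bar>g x\<bar> \<le> 1) \<Longrightarrow> \<bar>(\<integral>\<omega>. g (X \<omega>) \<partial>M) - (\<integral>\<omega>. g (Y \<omega>) \<partial>N)\<bar> \<le> \<eta>"
    and f: "f \<in> borel_measurable borel" "\<And>x. \<bar>f x\<bar> \<le> 1"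
  shows "\<bar>(\<integral>\<omega>. f (X \<omega>) \<partial>M) - (\<integral>\<omega>. f (Y \<omega>) \<partial>N)\<bar> \<le> \<eta>"
proof (rule field_le_epsilon)
  let ?\<mu> = "distr M borel X" and ?\<nu> = "distr N borel Y"
  have p: "prob_space ?\<mu>" "prob_space ?\<nu>"
    by (rule prob_space.prob_space_distr[OF M X], rule prob_space.prob_space_distr[OF N Y])
  have "prob_family {?\<mu>, ?\<nu>}"
  proof (rule prob_family.intro)
    fix \<mu> assume "\<mu> \<in> {?\<mu>, ?\<nu>}"
    then have "\<mu> = ?\<mu> \<or> \<mu> = ?\<nu>" by blast
    then show "prob_space \<mu>" "sets \<mu> = sets borel"
      using p by (elim disjE; simp only: sets_distr)+
  qed simp
  then interpret prob_family "{?\<mu>, ?\<nu>}" .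
  fix e :: real assume "e > 0"
  \<comment> \<open>Per law, e / 6 is spent on the L1 approximation and 2 (e / 6) on clamping, hence
    e / 2, and \<open>e\<close> for both laws together.\<close>
  then have e: "e / 6 > 0" by simp
  from arctan_algebra_approx_borel[OF f] e obtain g where g: "g \<in> arctan_algebra"
    "\<forall>\<mu>\<in>{?\<mu>, ?\<nu>}. (\<integral>x. \<bar>f x - g x\<bar> \<partial>\<mu>) < e / 6" unfolding arctan_algebra_approx_def by blast
  obtain h where h: "h \<in> arctan_algebra" "\<And>x. \<bar>h x\<bar> \<le> 1" "\<And>x. \<bar>h x - max (-1) (min 1 (g x))\<bar> \<le> 2 * (e / 6)"
    using arctan_algebra_clamp[OF g(1) e] by blast
  \<comment> \<open>Since \<open>f\<close> takes values in [-1, 1], clamping \<open>g\<close> brings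
    it no further away from \<open>f\<close>.\<close>
  have fh: "\<bar>f x - h x\<bar> \<le> \<bar>f x - g x\<bar> + e / 3" for x
    using f(2)[of x] h(3)[of x] by linarith
  have "\<bar>(\<integral>x. f x \<partial>\<mu>) - (\<integral>x. h x \<partial>\<mu>)\<bar> \<le> e / 2" if \<mu>: "\<mu> \<in> {?\<mu>, ?\<nu>}" for \<mu>
  proof -
    interpret \<mu>: prob_space \<mu> by (rule prob[OF \<mu>])
    have i: "integrable \<mu> f" "integrable \<mu> g" "integrable \<mu> h"
      using bounded_integrable[OF \<mu> f(1), of 1] f(2) arctan_algebra_integrable[OF \<mu>] g(1) h(1) by auto
    have "\<bar>(\<integral>x. f x \<partial>\<mu>) - (\<integral>x. h x \<partial>\<mu>)\<bar> = \<bar>\<integral>x. f x - h x \<partial>\<mu>\<bar>" using i by simp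
    also have "\<dots> \<le> (\<integral>x. \<bar>f x - h x\<bar> \<partial>\<mu>)" by (rule integral_abs_bound)
    also have "\<dots> \<le> (\<integral>x. \<bar>f x - g x\<bar> + e / 3 \<partial>\<mu>)" using i fh by (intro integral_mono) auto
    also have "\<dots> = (\<integral>x. \<bar>f x - g x\<bar> \<partial>\<mu>) + e / 3" using i by (simp add: \<mu>.prob_space)
    also have "\<dots> \<le> e / 6 + e / 3" using g(2) \<mu> by (intro add_right_mono less_imp_le) blast
    finally show ?thesis by simp
  qed
  from this[of ?\<mu>] this[of ?\<nu>]
  have "\<bar>(\<integral>\<omega>. f (X \<omega>) \<partial>M) - (\<integral>\<omega>. h (X \<omega>) \<partial>M)\<bar> \<le> e / 2"
    "\<bar>(\<integral>\<omega>. f (Y \<omega>) \<partial>N) - (\<integral>\<omega>. h (Y \<omega>) \<partial>N)\<bar> \<le> e / 2"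
    using f(1) arctan_algebra_measurable[OF h(1)] X Y by (simp_all add: integral_distr)
  moreover have "\<bar>(\<integral>\<omega>. h (X \<omega>) \<partial>M) - (\<integral>\<omega>. h (Y \<omega>) \<partial>N)\<bar> \<le> \<eta>"
    using le[OF h(1)] h(2) by blast
  ultimately show "\<bar>(\<integral>\<omega>. f (X \<omega>) \<partial>M) - (\<integral>\<omega>. f (Y \<omega>) \<partial>N)\<bar> \<le> \<eta> + e"
    by arith
qed

section \<open>Total variation distance\<close>

lemma abs_expectation_le_1:
  assumes "prob_space M" "\<And>x. \<bar>f x :: real\<bar> \<le> 1"
  shows "\<bar>\<integral>\<omega>. f (X \<omega>) \<partial>M\<bar> \<le> 1"
proof (cases "integrable M (\<lambda>\<omega>. f (X \<omega>))")
  case True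
  interpret prob_space M by fact
  have "\<bar>\<integral>\<omega>. f (X \<omega>) \<partial>M\<bar> \<le> (\<integral>\<omega>. \<bar>f (X \<omega>)\<bar> \<partial>M)" by (rule integral_abs_bound)
  also have "\<dots> \<le> (\<integral>\<omega>. 1 \<partial>M)" using True assms(2) by (intro integral_mono) auto
  finally show ?thesis by (simp add: prob_space)
qed (simp add: not_integrable_integral_eq)

lemma expectation_difference_le_tv_dist:
  fixes X :: "'a \<Rightarrow> real ^ 'd" and Y :: "'b \<Rightarrow> real ^ 'd"
  assumes "prob_space M" "prob_space N" "f \<in> borel_measurable borel" "\<And>x. \<bar>f x\<bar> \<le> 1"
  shows "\<bar>(\<integral>\<omega>. f (X \<omega>) \<partial>M) - (\<integral>\<omega>. f (Y \<omega>) \<partial>N)\<bar> \<le> tv_dist M X N Y"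
  unfolding tv_dist_def
proof (rule cSUP_upper)
  \<comment> \<open>A real supremum is an upper bound only for a set bounded above; here 2 is a
    bound.\<close>
  show "bdd_above ((\<lambda>f. \<bar>(\<integral>\<omega>. f (X \<omega>) \<partial>M) - (\<integral>\<omega>. f (Y \<omega>) \<partial>N)\<bar>) `
    {f :: real ^ 'd \<Rightarrow> real. f \<in> borel_measurable borel \<and> (\<forall>x. \<bar>f x\<bar> \<le> 1)})"
  proof (rule bdd_aboveI2)
    fix f :: "real ^ 'd \<Rightarrow> real" assume "f \<in> {f. f \<in> borel_measurable borel \<and> (\<forall>x. \<bar>f x\<bar> \<le> 1)}"
    then have "\<And>x. \<bar>f x\<bar> \<le> 1" by simp
    from abs_expectation_le_1[where f=f and X=X, OF assms(1) this]
      abs_expectation_le_1[where f=f and X=Y, OF assms(2) this]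
    show "\<bar>(\<integral>\<omega>. f (X \<omega>) \<partial>M) - (\<integral>\<omega>. f (Y \<omega>) \<partial>N)\<bar> \<le> 2" by arith
  qed
qed (use assms in auto)

lemma tv_dist_le:
  fixes X :: "'a \<Rightarrow> real ^ 'd" and Y :: "'b \<Rightarrow> real ^ 'd"
  assumes "\<And>f. f \<in> borel_measurable borel \<Longrightarrow> (\<And>x. \<bar>f x\<bar> \<le> 1) \<Longrightarrow>
    \<bar>(\<integral>\<omega>. f (X \<omega>) \<partial>M) - (\<integral>\<omega>. f (Y \<omega>) \<partial>N)\<bar> \<le> c"
  shows "tv_dist M X N Y \<le> c"
  unfolding tv_dist_def
proof (rule cSUP_least)
  have "(\<lambda>_. 0) \<in> {f :: real ^ 'd \<Rightarrow> real. f \<in> borel_measurable borel \<and> (\<forall>x. \<bar>f x\<bar> \<le> 1)}" by simp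
  then show "{f :: real ^ 'd \<Rightarrow> real. f \<in> borel_measurable borel \<and> (\<forall>x. \<bar>f x\<bar> \<le> 1)} \<noteq> {}" by blast
qed (use assms in auto)

lemma tv_dist_nonneg:
  assumes "prob_space M" "prob_space N"
  shows "0 \<le> tv_dist M X N Y"
  using expectation_difference_le_tv_dist[OF assms, of "\<lambda>_. 0" X Y] by simp

lemma distributed_expectation:
  fixes f :: "'e :: euclidean_space \<Rightarrow> real" and X :: "'a \<Rightarrow> 'e"
  assumes d: "distributed M lborel X (\<lambda>x. ennreal (p x))" and p: "\<And>x. 0 \<le> p x"
    and f: "f \<in> borel_measurable borel"
  shows "(\<integral>\<omega>. f (X \<omega>) \<partial>M) = (\<integral>x. p x * f x \<partial>lborel)"
  using distributed_integral[OF d _ p, of f] f by simp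

text \<open>The sign of the difference of the densities is an admissible test function and yields
  the full L1 norm, without a factor 1/2, because test functions range over [-1, 1].\<close>

lemma L1_dist_densities_le_tv_dist:
  fixes X :: "'a \<Rightarrow> real ^ 'd" and Y :: "'b \<Rightarrow> real ^ 'd"
  assumes M: "prob_space M" and N: "prob_space N"
    and p: "distributed M lborel X (\<lambda>x. ennreal (p x))" "\<And>x. 0 \<le> p x"
    and q: "distributed N lborel Y (\<lambda>x. ennreal (q x))" "\<And>x. 0 \<le> q x"
  shows "(\<integral>x. \<bar>p x - q x\<bar> \<partial>lborel) \<le> tv_dist M X N Y"
proof -
  have pm: "p \<in> borel_measurable lborel" "q \<in> borel_measurable lborel"
    using distributed_real_measurable[OF _ p(1)] distributed_real_measurable[OF _ q(1)] p(2) q(2) by auto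
  define f where "f x = sgn (p x - q x)" for x
  have f: "f \<in> borel_measurable borel" unfolding f_def using pm by simp
  have f1: "\<bar>f x\<bar> \<le> 1" for x by (simp add: f_def sgn_if)
  \<comment> \<open>Integrability of a density is transferred from that of the constant 1 on the
    probability space.\<close>
  have "integrable lborel (\<lambda>x. p x * 1) \<longleftrightarrow> integrable M (\<lambda>_. 1 :: real)"
    by (rule distributed_integrable[OF p(1)]) (simp_all add: p(2))
  moreover have "integrable lborel (\<lambda>x. q x * 1) \<longleftrightarrow> integrable N (\<lambda>_. 1 :: real)"
    by (rule distributed_integrable[OF q(1)]) (simp_all add: q(2))
  ultimately have i: "integrable lborel p" "integrable lborel q"
    using M N by (simp_all add: prob_space.finite_measure finite_measure.integrable_const)
  have fi': "integrable lborel (\<lambda>x. u x * f x)" if u: "integrable lborel u" for u :: "real ^ 'd \<Rightarrow> real"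
    by (rule Bochner_Integration.integrable_bound[OF u])
      (use u f f1 in \<open>auto simp: abs_mult mult_left_le\<close>)
  note fi = fi'[OF i(1)] fi'[OF i(2)]
  have "\<bar>p x - q x\<bar> = p x * f x - q x * f x" for x
    by (simp add: f_def sgn_if)
  then have "(\<integral>x. \<bar>p x - q x\<bar> \<partial>lborel) = (\<integral>x. p x * f x \<partial>lborel) - (\<integral>x. q x * f x \<partial>lborel)"
    using fi by simp
  also have "\<dots> = (\<integral>\<omega>. f (X \<omega>) \<partial>M) - (\<integral>\<omega>. f (Y \<omega>) \<partial>N)"
    using distributed_expectation[OF p f] distributed_expectation[OF q f] by simp
  also have "\<dots> \<le> \<bar>(\<integral>\<omega>. f (X \<omega>) \<partial>M) - (\<integral>\<omega>. f (Y \<omega>) \<partial>N)\<bar>" by simp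
  also have "\<dots> \<le> tv_dist M X N Y"
    by (rule expectation_difference_le_tv_dist[OF M N f f1])
  finally show ?thesis .
qed

theorem theorem2p8:
  fixes N :: "nat \<Rightarrow> 'a noise"
    and Fn :: "nat \<Rightarrow> (nat \<Rightarrow> real) \<Rightarrow> real ^ 'd"
    and Q :: "'b measure"
    and F :: "'b \<Rightarrow> real ^ 'd"
  assumes noise: "\<And>n. noise_vector (N n)"
    and Fn: "\<And>n. Fn n \<in> simple_functionals (N n)"
    and A_bounded: "\<And>q::real. q \<ge> 1 \<Longrightarrow> (SUP n. A_norm q (N n) (Fn n)) < \<infinity>"
    and nondegenerate:
      "((\<lambda>\<epsilon>::real. limsup (\<lambda>n. ereal (measure (Prob (N n))
            {\<omega> \<in> space (Prob (N n)). det (malliavin_matrix (N n) (Fn n) (Vec (N n) \<omega>)) \<le> \<epsilon>})))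
        \<longlongrightarrow> 0) (at_right 0)"
    and F_space: "prob_space Q"
    and F_measurable: "F \<in> borel_measurable Q"
    and F_integrable: "integrable Q F"
    and F_distr: "converges_in_distribution (\<lambda>n. Prob (N n)) (\<lambda>n \<omega>. Fn n (Vec (N n) \<omega>)) Q F"
    and F_mean: "(\<lambda>n. \<integral>\<omega>. Fn n (Vec (N n) \<omega>) \<partial>Prob (N n)) \<longlonglongrightarrow> (\<integral>\<omega>. F \<omega> \<partial>Q)"
  shows "(\<lambda>n. tv_dist Q F (Prob (N n)) (\<lambda>\<omega>. Fn n (Vec (N n) \<omega>))) \<longlonglongrightarrow> 0 \<and>
    (\<forall>(pF :: real ^ 'd \<Rightarrow> real) (pFn :: nat \<Rightarrow> real ^ 'd \<Rightarrow> real).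
        (\<forall>x. 0 \<le> pF x) \<and> (\<forall>n x. 0 \<le> pFn n x) \<and>
        distributed Q lborel F (\<lambda>x. ennreal (pF x)) \<and>
        (\<forall>n. distributed (Prob (N n)) lborel (\<lambda>\<omega>. Fn n (Vec (N n) \<omega>)) (\<lambda>x. ennreal (pFn n x)))
        \<longrightarrow> (\<lambda>n. \<integral>x. \<bar>pF x - pFn n x\<bar> \<partial>lborel) \<longlonglongrightarrow> 0)"
proof -
  interpret functional_seq N Fn by (rule functional_seq.intro[OF noise Fn])
  have M: "prob_space (Prob (N n))" for n
    using noise[of n] by (simp add: noise_vector_def)
  have tv: "(\<lambda>n. tv_dist Q F (Prob (N n)) (X n)) \<longlonglongrightarrow> 0"
  proof (rule tendstoI)
    fix e :: real assume e: "e > 0"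
    \<comment> \<open>Threefold e / 6 gives e / 2, which leaves room for the strict inequality in
      the limit.\<close>
    then have e6: "e / 6 > 0" by simp
    obtain r where r: "r > 0" "\<forall>\<^sub>F n in sequentially. \<forall>f\<in>arctan_algebra. (\<forall>x. \<bar>f x\<bar> \<le> 1) \<longrightarrow> (\<forall>h. norm h \<le> r \<longrightarrow>
        \<bar>(\<integral>\<omega>. f (X n \<omega> + h) \<partial>Prob (N n)) - (\<integral>\<omega>. f (X n \<omega>) \<partial>Prob (N n))\<bar> \<le> e / 6)"
      using eventually_translation_small[OF A_bounded nondegenerate e6] by blast
    have "\<forall>\<^sub>F n in sequentially. \<forall>f\<in>{f \<in> arctan_algebra. \<forall>x. \<bar>f x\<bar> \<le> 1}.
        \<bar>(\<integral>\<omega>. f (F \<omega>) \<partial>Q) - (\<integral>\<omega>. f (X n \<omega>) \<partial>Prob (N n))\<bar> \<le> 3 * (e / 6)"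
    proof (rule eventually_expectations_close[OF M X_measurable F_space F_measurable F_distr _ _ r(1) e6])
      show "\<forall>\<^sub>F n in sequentially. \<forall>f\<in>{f \<in> arctan_algebra. \<forall>x. \<bar>f x\<bar> \<le> 1}. \<forall>h. norm h \<le> r \<longrightarrow>
        \<bar>(\<integral>\<omega>. f (X n \<omega> + h) \<partial>Prob (N n)) - (\<integral>\<omega>. f (X n \<omega>) \<partial>Prob (N n))\<bar> \<le> e / 6"
        using r(2) by (rule eventually_mono) blast
    qed (auto intro: arctan_algebra_continuous)
    then show "\<forall>\<^sub>F n in sequentially. dist (tv_dist Q F (Prob (N n)) (X n)) 0 < e"
    proof eventually_elim
      case (elim n)
      have "tv_dist Q F (Prob (N n)) (X n) \<le> 3 * (e / 6)"
      proof (rule tv_dist_le)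
        fix f :: "real ^ 'd \<Rightarrow> real"
        assume f: "f \<in> borel_measurable borel" "\<And>x. \<bar>f x\<bar> \<le> 1"
        show "\<bar>(\<integral>\<omega>. f (F \<omega>) \<partial>Q) - (\<integral>\<omega>. f (X n \<omega>) \<partial>Prob (N n))\<bar> \<le> 3 * (e / 6)"
        proof (rule expectation_difference_le_arctan_algebra[OF F_space F_measurable M X_measurable _ f])
          fix g :: "real ^ 'd \<Rightarrow> real"
          assume "g \<in> arctan_algebra" "\<forall>x. \<bar>g x\<bar> \<le> 1"
          then have "g \<in> {f \<in> arctan_algebra. \<forall>x. \<bar>f x\<bar> \<le> 1}" by blast
          with elim show "\<bar>(\<integral>\<omega>. g (F \<omega>) \<partial>Q) - (\<integral>\<omega>. g (X n \<omega>) \<partial>Prob (N n))\<bar> \<le> 3 * (e / 6)"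
            by (rule bspec)
        qed
      qed
      moreover have "0 \<le> tv_dist Q F (Prob (N n)) (X n)" by (rule tv_dist_nonneg[OF F_space M])
      ultimately show ?case using e by (simp add: dist_real_def)
    qed
  qed
  have densities: "(\<lambda>n. \<integral>x. \<bar>pF x - pFn n x\<bar> \<partial>lborel) \<longlonglongrightarrow> 0"
    if p: "\<forall>x. 0 \<le> pF x" "\<forall>n x. 0 \<le> pFn n x" "distributed Q lborel F (\<lambda>x. ennreal (pF x))"
      "\<forall>n. distributed (Prob (N n)) lborel (X n) (\<lambda>x. ennreal (pFn n x))"
    for pF :: "real ^ 'd \<Rightarrow> real" and pFn :: "nat \<Rightarrow> real ^ 'd \<Rightarrow> real"
  \<comment> \<open>The L1 distances lie between 0 and the total variation distances.\<close>
  proof (rule tendsto_sandwich[OF _ _ tendsto_const tv])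
    show "\<forall>\<^sub>F n in sequentially. (\<integral>x. \<bar>pF x - pFn n x\<bar> \<partial>lborel) \<le> tv_dist Q F (Prob (N n)) (X n)"
      by (intro always_eventually allI
          L1_dist_densities_le_tv_dist[OF F_space M p(3)[rule_format] p(1)[rule_format] p(4)[rule_format] p(2)[rule_format]])
  qed simp
  show ?thesis
    by (rule conjI[OF tv]) (intro allI impI, elim conjE, rule densities)
qed

end
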